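(* Let $m\ge3$ and let $p_1,p_2,\dots,p_{m-1}\in(0,\infty]$. Define the number $r$ by $$\frac1r=\frac1{p_1^\sharp}+\frac1{p_{m-1}^\sharp},\qquad\text{where } p^\sharp=\max\{p,2\}.$$ Let $\mathfrak S$ be a symmetrically quasinormed ideal of operators on Hilbert space. Suppose that $$\int\cdots\int\Psi(x_1,\dots,x_m)\,dE_1(x_1)T_1\,dE_2(x_2)T_2\cdots T_{m-1}\,dE_m(x_m)\in\mathfrak S$$ whenever $E_1,E_2,\dots,E_m$ are spectral measures on Hilbert space, $\Psi$ belongs to the Haagerup tensor product $L^\infty(E_1)\otimes_{\rm h}L^\infty(E_2)\otimes_{\rm h}\cdots\otimes_{\rm h}L^\infty(E_m)$, and $T_1,T_2,\dots,T_{m-1}$ are linear operators such that $T_j\in\boldsymbol S_{p_j}$ for $j=1,2,\dots,m-1$. Then $\mathfrak S\supset\boldsymbol S_r$.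
   Context: Hilbert space here means an infinite-dimensional separable Hilbert space $\mathcal H$. $\boldsymbol S_p$ ($0<p<\infty$) is the Schatten--von Neumann class; $1/\infty=0$, and $T\in\boldsymbol S_\infty$ means that $T$ is a bounded linear operator. A symmetrically quasinormed ideal is a two-sided ideal of the algebra of bounded operators equipped with a quasinorm satisfying $\|AXB\|_{\mathfrak S}\le\|A\|\,\|X\|_{\mathfrak S}\,\|B\|$ for bounded $A,B$ and $X\in\mathfrak S$. $\mathcal B$ denotes the space of infinite matrices that induce bounded operators on $\ell^2$, with the operator norm. Let $E_1,\dots,E_m$ be spectral measures on $\mathcal H$, where $E_i$ is defined on a measurable space $\mathcal X_i$. The Haagerup tensor product $L^\infty(E_1)\otimes_{\rm h}\cdots\otimes_{\rm h}L^\infty(E_m)$ is the space of functions $\Psi$ on $\mathcal X_1\times\cdots\times\mathcal X_m$ of the form $$\Psi(x_1,\dots,x_m)=\sum_{j_1,\dots,j_{m-1}\ge0}\alpha^{(1)}_{j_1}(x_1)\,\alpha^{(2)}_{j_1j_2}(x_2)\cdots\alpha^{(m-1)}_{j_{m-2}j_{m-1}}(x_{m-1})\,\alpha^{(m)}_{j_{m-1}}(x_m)$$ with measurable coefficient functions such that $\{\alpha^{(1)}_j\}_{j\ge0}\in L^\infty_{E_1}(\ell^2)$, $\{\alpha^{(m)}_j\}_{j\ge0}\in L^\infty_{E_m}(\ell^2)$, and $\{\alpha^{(i)}_{jk}\}_{j,k\ge0}\in L^\infty_{E_i}(\mathcal B)$ for $2\le i\le m-1$ (essential boundedness, with respect to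 the corresponding spectral measure, of the $\ell^2$-norm, respectively of the operator norm of the matrix). The sum is the (a.e. existing) limit of the rectangular partial sums as all upper summation limits tend to infinity. For bounded operators $T_1,\dots,T_{m-1}$ the multiple operator integral with integrand $\Psi$ is defined by $$\int\cdots\int\Psi\,dE_1T_1\,dE_2T_2\cdots T_{m-1}\,dE_m=\sum_{j_1,\dots,j_{m-1}\ge0}A^{(1)}_{j_1}T_1A^{(2)}_{j_1j_2}T_2\cdots A^{(m-1)}_{j_{m-2}j_{m-1}}T_{m-1}A^{(m)}_{j_{m-1}},$$ where $A^{(i)}_{\cdot}=\int\alpha^{(i)}_{\cdot}\,dE_i$; the series (limit of rectangular partial sums) converges in the weak operator topology, and its sum does not depend on the choice of the representation of $\Psi$. *)

theory Defs
  imports "HOL-Analysis.Analysis"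
begin

section \<open>Complex Hilbert space\<close>

text \<open>The class extends the real inner product class, so that \<^const>\<open>norm\<close>, \<^const>\<open>onorm\<close>,
  \<^const>\<open>bounded_linear\<close> and limits are those of the library; the real inner product is the real
  part of the complex one, which is linear in its first argument.\<close>

class complex_hilbert_space = real_inner + complete_space +
  fixes scaleC :: "complex \<Rightarrow> 'a \<Rightarrow> 'a"
    and cinner :: "'a \<Rightarrow> 'a \<Rightarrow> complex"
  assumes scaleC_add_right: "scaleC c (x + y) = scaleC c x + scaleC c y"
    and scaleC_add_left: "scaleC (c + d) x = scaleC c x + scaleC d x"
    and scaleC_scaleC: "scaleC c (scaleC d x) = scaleC (c * d) x"
    and scaleC_of_real: "scaleC (complex_of_real t) x = scaleR t x"
    and cinner_add_left: "cinner (x + y) z = cinner x z + cinner y z"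
    and cinner_scaleC_left: "cinner (scaleC c x) y = c * cinner x y"
    and cinner_commute: "cinner x y = cnj (cinner y x)"
    and inner_eq_Re_cinner: "inner x y = Re (cinner x y)"

global_interpretation complex_vector:
  vector_space "scaleC :: complex \<Rightarrow> 'a \<Rightarrow> 'a::complex_hilbert_space"
proof
  show "scaleC 1 x = x" for x :: 'a
    using scaleC_of_real[of 1 x] by simp
qed (simp_all add: scaleC_add_right scaleC_add_left scaleC_scaleC)


section \<open>Bounded operators, singular numbers, Schatten classes\<close>

definition bounded_clinear ::
    "('h::complex_hilbert_space \<Rightarrow> 'h) \<Rightarrow> bool" where
  "bounded_clinear T \<longleftrightarrow> bounded_linear T \<and> (\<forall>c u. T (scaleC c u) = scaleC c (T u))"

text \<open>The dimension function of the library is \<open>0\<close> on infinite-dimensional spaces, so it is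
  avoided here.\<close>

definition rank_le :: "('h::complex_hilbert_space \<Rightarrow> 'h) \<Rightarrow> nat \<Rightarrow> bool" where
  "rank_le R n \<longleftrightarrow> (\<exists>B. finite B \<and> card B \<le> n \<and> range R \<subseteq> complex_vector.span B)"

definition singular_number :: "('h::complex_hilbert_space \<Rightarrow> 'h) \<Rightarrow> nat \<Rightarrow> real" where
  "singular_number T n = Inf {onorm (\<lambda>u. T u - R u) | R. bounded_clinear R \<and> rank_le R n}"

text \<open>\<open>\<infinity>\<close> stands for the class of all bounded operators, not only the compact ones.\<close>

definition schatten :: "ennreal \<Rightarrow> ('h::complex_hilbert_space \<Rightarrow> 'h) set" where
  "schatten p =
     (if p = \<infinity> then {T. bounded_clinear T}
      else {T. bounded_clinear T \<and> summable (\<lambda>n. singular_number T n powr enn2real p)})"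

definition sharp :: "ennreal \<Rightarrow> ennreal" where
  "sharp p = max p 2"

locale symmetrically_quasinormed_ideal =
  fixes S :: "('h::complex_hilbert_space \<Rightarrow> 'h) set"
    and q :: "('h \<Rightarrow> 'h) \<Rightarrow> real"
  assumes bounded: "X \<in> S \<Longrightarrow> bounded_clinear X"
    and zero: "(\<lambda>u. 0) \<in> S"
    and add: "X \<in> S \<Longrightarrow> Y \<in> S \<Longrightarrow> (\<lambda>u. X u + Y u) \<in> S"
    and scale: "X \<in> S \<Longrightarrow> (\<lambda>u. scaleC c (X u)) \<in> S"
    and two_sided:
      "X \<in> S \<Longrightarrow> bounded_clinear A \<Longrightarrow> bounded_clinear B \<Longrightarrow> A \<circ> X \<circ> B \<in> S"
    and quasinorm_nonneg: "X \<in> S \<Longrightarrow> 0 \<le> q X"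
    and quasinorm_eq_0_iff: "X \<in> S \<Longrightarrow> q X = 0 \<longleftrightarrow> X = (\<lambda>u. 0)"
    and quasinorm_scale: "X \<in> S \<Longrightarrow> q (\<lambda>u. scaleC c (X u)) = cmod c * q X"
    and quasinorm_add: "\<exists>K. \<forall>X\<in>S. \<forall>Y\<in>S. q (\<lambda>u. X u + Y u) \<le> K * (q X + q Y)"
    and quasinorm_symmetric:
      "X \<in> S \<Longrightarrow> bounded_clinear A \<Longrightarrow> bounded_clinear B \<Longrightarrow>
        q (A \<circ> X \<circ> B) \<le> onorm A * q X * onorm B"


section \<open>Spectral measures\<close>

definition orthogonal_projection :: "('h::complex_hilbert_space \<Rightarrow> 'h) \<Rightarrow> bool" where
  "orthogonal_projection P \<longleftrightarrow>
     bounded_clinear P \<and> P \<circ> P = P \<and> (\<forall>u v. cinner (P u) v = cinner u (P v))"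

text \<open>Of the library measure \<open>M\<close> only the underlying measurable space
  (\<^term>\<open>space M\<close>, \<^term>\<open>sets M\<close>) is used. Countable additivity is in the strong operator
  topology. The points range over one type \<open>'x\<close>, with arbitrary carriers and \<open>\<sigma>\<close>-algebras in it. An
  assumption on all spectral measures over \<open>'x\<close> has its full force only if \<open>'x\<close> is large enough to
  carry nonatomic ones, for instance if the reals embed into \<open>'x\<close>; over a countable \<open>'x\<close> all
  spectral measures are atomic.\<close>

definition spectral_measure ::
    "'x measure \<Rightarrow> ('x set \<Rightarrow> 'h \<Rightarrow> 'h::complex_hilbert_space) \<Rightarrow> bool" where
  "spectral_measure M E \<longleftrightarrow>
     (\<forall>A\<in>sets M. orthogonal_projection (E A)) \<and>
     E (space M) = id \<and>
     (\<forall>A :: nat \<Rightarrow> 'x set. range A \<subseteq> sets M \<longrightarrow> disjoint_family A \<longrightarrow>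
        (\<forall>u. (\<lambda>n. E (A n) u) sums E (\<Union>n. A n) u))"

definition spectral_AE ::
    "'x measure \<Rightarrow> ('x set \<Rightarrow> 'h \<Rightarrow> 'h::complex_hilbert_space) \<Rightarrow> ('x \<Rightarrow> bool) \<Rightarrow> bool" where
  "spectral_AE M E P \<longleftrightarrow> (\<exists>N\<in>sets M. E N = (\<lambda>u. 0) \<and> (\<forall>x\<in>space M - N. P x))"

definition scalar_spectral_measure ::
    "'x measure \<Rightarrow> ('x set \<Rightarrow> 'h \<Rightarrow> 'h::complex_hilbert_space) \<Rightarrow> 'h \<Rightarrow> 'x measure" where
  "scalar_spectral_measure M E u =
     measure_of (space M) (sets M) (\<lambda>A. ennreal (Re (cinner (E A u) u)))"

text \<open>\<open>\<integral> f dE\<close> is the operator with quadratic form \<open>u \<mapsto> \<integral> f d(E u, u)\<close>; by polarization the form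
  determines the operator, and it exists for measurable \<open>E\<close>-essentially bounded \<open>f\<close>.\<close>

definition has_spectral_integral ::
    "'x measure \<Rightarrow> ('x set \<Rightarrow> 'h \<Rightarrow> 'h::complex_hilbert_space) \<Rightarrow> ('x \<Rightarrow> complex) \<Rightarrow> ('h \<Rightarrow> 'h) \<Rightarrow> bool" where
  "has_spectral_integral M E f A \<longleftrightarrow>
     bounded_clinear A \<and>
     (\<forall>u. integrable (scalar_spectral_measure M E u) f \<and>
          cinner (A u) u = integral\<^sup>L (scalar_spectral_measure M E u) f)"

definition spectral_integral ::
    "'x measure \<Rightarrow> ('x set \<Rightarrow> 'h \<Rightarrow> 'h::complex_hilbert_space) \<Rightarrow> ('x \<Rightarrow> complex) \<Rightarrow> 'h \<Rightarrow> 'h" where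
  "spectral_integral M E f = (THE A. has_spectral_integral M E f A)"


section \<open>Haagerup tensor products\<close>

definition ell2 :: "(nat \<Rightarrow> complex) set" where
  "ell2 = {c. summable (\<lambda>j. (cmod (c j))\<^sup>2)}"

definition ell2_norm :: "(nat \<Rightarrow> complex) \<Rightarrow> real" where
  "ell2_norm c = sqrt (\<Sum>j. (cmod (c j))\<^sup>2)"

text \<open>The matrix \<open>a\<close> induces an operator on \<open>\<ell>\<^sup>2\<close> of norm at most \<open>C\<close>.\<close>

definition matrix_norm_le :: "(nat \<Rightarrow> nat \<Rightarrow> complex) \<Rightarrow> real \<Rightarrow> bool" where
  "matrix_norm_le a C \<longleftrightarrow>
     (\<forall>c\<in>ell2. (\<forall>j. summable (\<lambda>k. a j k * c k)) \<and>
        (\<lambda>j. \<Sum>k. a j k * c k) \<in> ell2 \<and>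
        ell2_norm (\<lambda>j. \<Sum>k. a j k * c k) \<le> C * ell2_norm c)"

definition Linf_ell2 ::
    "'x measure \<Rightarrow> ('x set \<Rightarrow> 'h \<Rightarrow> 'h::complex_hilbert_space) \<Rightarrow> (nat \<Rightarrow> 'x \<Rightarrow> complex) set" where
  "Linf_ell2 M E =
     {a. (\<forall>j. a j \<in> borel_measurable M) \<and>
         (\<exists>C. spectral_AE M E (\<lambda>x. (\<lambda>j. a j x) \<in> ell2 \<and> ell2_norm (\<lambda>j. a j x) \<le> C))}"

definition Linf_matrix ::
    "'x measure \<Rightarrow> ('x set \<Rightarrow> 'h \<Rightarrow> 'h::complex_hilbert_space) \<Rightarrow> (nat \<Rightarrow> nat \<Rightarrow> 'x \<Rightarrow> complex) set" where
  "Linf_matrix M E =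
     {a. (\<forall>j k. a j k \<in> borel_measurable M) \<and>
         (\<exists>C. spectral_AE M E (\<lambda>x. matrix_norm_le (\<lambda>j k. a j k x) C))}"

text \<open>A multi-index \<open>(j\<^sub>1, \<dots>, j\<^sub>m\<^sub>-\<^sub>1)\<close> is a function on \<open>{1..<m}\<close>. The second definition is the filter
  along which all the upper summation limits \<open>n\<^sub>1, \<dots>, n\<^sub>m\<^sub>-\<^sub>1\<close> tend to infinity, independently of each
  other (\<open>m \<ge> 2\<close>).\<close>

definition rectangle :: "nat \<Rightarrow> (nat \<Rightarrow> nat) \<Rightarrow> (nat \<Rightarrow> nat) set" where
  "rectangle m n = (\<Pi>\<^sub>E i\<in>{1..<m}. {..n i})"

definition limits_at_top :: "nat \<Rightarrow> (nat \<Rightarrow> nat) filter" where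
  "limits_at_top m = filtercomap (\<lambda>n. Min (n ` {1..<m})) at_top"

text \<open>The coefficient functions of the first, of the \<open>i\<close>-th (\<open>2 \<le> i \<le> m - 1\<close>) and of the last variable
  are \<open>a j\<close>, \<open>\<alpha> i j k\<close> and \<open>b j\<close>, respectively.\<close>

definition haagerup_term ::
    "nat \<Rightarrow> (nat \<Rightarrow> 'x \<Rightarrow> complex) \<Rightarrow> (nat \<Rightarrow> nat \<Rightarrow> nat \<Rightarrow> 'x \<Rightarrow> complex) \<Rightarrow> (nat \<Rightarrow> 'x \<Rightarrow> complex) \<Rightarrow>
      (nat \<Rightarrow> nat) \<Rightarrow> (nat \<Rightarrow> 'x) \<Rightarrow> complex" where
  "haagerup_term m a \<alpha> b j x =
     a (j 1) (x 1) * (\<Prod>i=2..m - 1. \<alpha> i (j (i - 1)) (j i) (x i)) * b (j (m - 1)) (x m)"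

text \<open>The exceptional set of the almost everywhere convergence is of the form
  \<open>{x. \<exists>i. x\<^sub>i \<in> N\<^sub>i}\<close> with \<open>E\<^sub>i\<close>-null sets \<open>N\<^sub>i\<close>. Functions on the product of the spaces are
  functions of \<open>x\<close> in the extensional product over \<open>{1..m}\<close>.\<close>

definition haagerup_representation ::
    "nat \<Rightarrow> (nat \<Rightarrow> 'x measure) \<Rightarrow> (nat \<Rightarrow> 'x set \<Rightarrow> 'h \<Rightarrow> 'h::complex_hilbert_space) \<Rightarrow>
      ((nat \<Rightarrow> 'x) \<Rightarrow> complex) \<Rightarrow>
      (nat \<Rightarrow> 'x \<Rightarrow> complex) \<Rightarrow> (nat \<Rightarrow> nat \<Rightarrow> nat \<Rightarrow> 'x \<Rightarrow> complex) \<Rightarrow> (nat \<Rightarrow> 'x \<Rightarrow> complex) \<Rightarrow> bool" where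
  "haagerup_representation m M E \<Psi> a \<alpha> b \<longleftrightarrow>
     a \<in> Linf_ell2 (M 1) (E 1) \<and>
     (\<forall>i\<in>{2..m - 1}. \<alpha> i \<in> Linf_matrix (M i) (E i)) \<and>
     b \<in> Linf_ell2 (M m) (E m) \<and>
     (\<exists>N. (\<forall>i\<in>{1..m}. N i \<in> sets (M i) \<and> E i (N i) = (\<lambda>u. 0)) \<and>
          (\<forall>x \<in> (\<Pi>\<^sub>E i\<in>{1..m}. space (M i) - N i).
             ((\<lambda>n. \<Sum>j\<in>rectangle m n. haagerup_term m a \<alpha> b j x) \<longlongrightarrow> \<Psi> x) (limits_at_top m)))"

definition haagerup_tensor ::
    "nat \<Rightarrow> (nat \<Rightarrow> 'x measure) \<Rightarrow> (nat \<Rightarrow> 'x set \<Rightarrow> 'h \<Rightarrow> 'h::complex_hilbert_space) \<Rightarrow>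
      ((nat \<Rightarrow> 'x) \<Rightarrow> complex) set" where
  "haagerup_tensor m M E = {\<Psi>. \<exists>a \<alpha> b. haagerup_representation m M E \<Psi> a \<alpha> b}"


section \<open>Multiple operator integrals\<close>

text \<open>The product \<open>A\<^sub>1 T\<^sub>1 A\<^sub>2 T\<^sub>2 \<dots> A\<^sub>m\<^sub>-\<^sub>1 T\<^sub>m\<^sub>-\<^sub>1 A\<^sub>m\<close> in which \<open>A\<^sub>i\<close> is the spectral integral of the
  \<open>i\<close>-th factor of \<^const>\<open>haagerup_term\<close>; the fold multiplies \<open>A\<^sub>1\<close> by
  \<open>T\<^sub>i\<^sub>-\<^sub>1 A\<^sub>i\<close> from the right for \<open>i = 2, \<dots>, m - 1\<close>.\<close>

definition operator_term ::
    "nat \<Rightarrow> (nat \<Rightarrow> 'x measure) \<Rightarrow> (nat \<Rightarrow> 'x set \<Rightarrow> 'h \<Rightarrow> 'h::complex_hilbert_space) \<Rightarrow>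
      (nat \<Rightarrow> 'h \<Rightarrow> 'h) \<Rightarrow>
      (nat \<Rightarrow> 'x \<Rightarrow> complex) \<Rightarrow> (nat \<Rightarrow> nat \<Rightarrow> nat \<Rightarrow> 'x \<Rightarrow> complex) \<Rightarrow> (nat \<Rightarrow> 'x \<Rightarrow> complex) \<Rightarrow>
      (nat \<Rightarrow> nat) \<Rightarrow> 'h \<Rightarrow> 'h" where
  "operator_term m M E T a \<alpha> b j =
     fold (\<lambda>i W. W \<circ> T (i - 1) \<circ> spectral_integral (M i) (E i) (\<alpha> i (j (i - 1)) (j i)))
       [2..<m] (spectral_integral (M 1) (E 1) (a (j 1)))
     \<circ> T (m - 1) \<circ> spectral_integral (M m) (E m) (b (j (m - 1)))"

text \<open>\<open>R\<close> is the multiple operator integral of \<open>\<Psi>\<close>: the sum of the operator series of a representation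
  of \<open>\<Psi>\<close>, in the weak operator topology. Every representation gives a convergent series with the
  same sum, so this is a (total and single-valued) function of \<open>\<Psi>\<close> in the Haagerup tensor product and
  of bounded \<open>T\<^sub>1, \<dots>, T\<^sub>m\<^sub>-\<^sub>1\<close>; it is kept as a relation, like \<^const>\<open>has_integral\<close>.\<close>

definition has_multiple_operator_integral ::
    "nat \<Rightarrow> (nat \<Rightarrow> 'x measure) \<Rightarrow> (nat \<Rightarrow> 'x set \<Rightarrow> 'h \<Rightarrow> 'h::complex_hilbert_space) \<Rightarrow>
      ((nat \<Rightarrow> 'x) \<Rightarrow> complex) \<Rightarrow> (nat \<Rightarrow> 'h \<Rightarrow> 'h) \<Rightarrow> ('h \<Rightarrow> 'h) \<Rightarrow> bool" where
  "has_multiple_operator_integral m M E \<Psi> T R \<longleftrightarrow>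
     bounded_clinear R \<and>
     (\<exists>a \<alpha> b. haagerup_representation m M E \<Psi> a \<alpha> b \<and>
        (\<forall>u v. ((\<lambda>n. cinner (\<Sum>j\<in>rectangle m n. operator_term m M E T a \<alpha> b j u) v)
                 \<longlongrightarrow> cinner (R u) v) (limits_at_top m)))"

end

theory Submission
  imports Defs
begin

text \<open>The operators \<open>T j\<close> stay fixed while the summation index \<open>k\<close>
  varies, so only the spectral coefficients can isolate the \<open>k\<close>-th term. With the outer
  projections alone, all rows \<open>P_k T_1\<close> would have to be multiples of one functional;
  then \<open>T_1\<close> has rank one and \<open>a\<close> is forced into the space of square
  summable sequences. An inner factor depending on \<open>k\<close> removes this restriction by
  carrying a different vector back to \<open>e_0\<close> for each \<open>k\<close>. A reflection can
  do so at no cost: its coefficient takes the values 1 and -1, so a diagonal matrix of such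
  functions has norm at most 1. The reflections have to commute in order to be functions of a single
  spectral measure, and the digit flips achieve this.

  The exponents balance because \<open>\<sigma>\<close> splits into its powers with exponents
  \<open>r\<close> times the reciprocals of the two sharp exponents, and these add up to 1. The
  points of the spectral measures form an arbitrary type that is only known to be large, so the
  joint spectral measure is built from a map of that type onto all binary sequences.\<close>

text \<open>An operator in \<open>S\<^sub>r\<close> factors through a diagonal operator with entries \<open>\<sigma>\<^sub>k = a\<^sub>k b\<^sub>k\<close>, where \<open>a\<close> and
  \<open>b\<close> have the summability of \<open>p\<^sub>1\<^sup>\<sharp>\<close> and \<open>p\<^sub>m\<^sub>-\<^sub>1\<^sup>\<sharp>\<close>, so it suffices to write each such diagonal
  operator as a multiple operator integral. Let \<open>e\<^sub>k\<close> be an orthonormal basis, let \<open>P\<^sub>k\<close> be the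
  projection onto \<open>e\<^sub>k\<close>, and let \<open>R\<^sub>k\<close> be the commuting reflections that act on the index of the basis
  vectors by flipping the \<open>k\<close>-th binary digit. The unit vectors \<open>R\<^sub>k e\<^sub>0\<close> are orthonormal. If
  \<open>p\<^sub>1 \<ge> 2\<close>, take \<open>T\<^sub>1 = \<Sum> a\<^sub>k (\<cdot>, R\<^sub>k e\<^sub>0) e\<^sub>k\<close>, for which \<open>P\<^sub>k T\<^sub>1 R\<^sub>k = a\<^sub>k (\<cdot>, e\<^sub>0) e\<^sub>k\<close>; if \<open>p\<^sub>1 < 2\<close>, then
  \<open>a \<in> \<ell>\<^sup>2\<close> and the rank one operator \<open>T\<^sub>1 = (\<cdot>, e\<^sub>0) a\<close> satisfies \<open>P\<^sub>k T\<^sub>1 = a\<^sub>k (\<cdot>, e\<^sub>0) e\<^sub>k\<close>. The last factor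
  is treated symmetrically, the remaining \<open>T\<^sub>j\<close> are \<open>(\<cdot>, e\<^sub>0) e\<^sub>0\<close>, and the sum
  \<open>\<Sum>\<^sub>k P\<^sub>k T\<^sub>1 (R\<^sub>k or 1) T\<^sub>2 \<dots> (R\<^sub>k or 1) T\<^sub>m\<^sub>-\<^sub>1 P\<^sub>k\<close> is a multiple operator integral of a function with
  diagonal coefficient matrices, because commuting projections always come from one spectral
  measure.\<close>

section \<open>Inner products and bounded operators\<close>

instance complex_hilbert_space \<subseteq> banach ..

lemma cinner_zero_left [simp]: "cinner 0 (y::'h::complex_hilbert_space) = 0"
  using cinner_scaleC_left[of 0 0 y] by simp

lemma cinner_zero_right [simp]: "cinner (x::'h::complex_hilbert_space) 0 = 0"
  by (subst cinner_commute) simp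

lemma cinner_add_right:
  "cinner (x::'h::complex_hilbert_space) (y + z) = cinner x y + cinner x z"
  by (metis cinner_add_left cinner_commute complex_cnj_add)

lemma cinner_scaleC_right:
  "cinner (x::'h::complex_hilbert_space) (scaleC c y) = cnj c * cinner x y"
  by (metis cinner_commute cinner_scaleC_left complex_cnj_mult)

lemma scaleR_eq_scaleC: "scaleR t (x::'h::complex_hilbert_space) = scaleC (complex_of_real t) x"
  by (simp add: scaleC_of_real)

lemma scaleC_one [simp]: "scaleC 1 (x::'h::complex_hilbert_space) = x"
  using scaleC_of_real[of 1 x] by simp

lemma scaleC_minus_one [simp]: "scaleC (-1) (x::'h::complex_hilbert_space) = - x"
  using scaleC_of_real[of "-1" x] by simp

lemma cinner_minus_left [simp]: "cinner (- x) (y::'h::complex_hilbert_space) = - cinner x y"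
  using cinner_scaleC_left[of "-1" x y] by simp

lemma cinner_minus_right [simp]: "cinner x (- y::'h::complex_hilbert_space) = - cinner x y"
  by (metis cinner_commute cinner_minus_left complex_cnj_minus)

lemma cinner_diff_left: "cinner (x - y) (z::'h::complex_hilbert_space) = cinner x z - cinner y z"
  using cinner_add_left[of x "- y" z] by simp

lemma cinner_diff_right: "cinner (x::'h::complex_hilbert_space) (y - z) = cinner x y - cinner x z"
  using cinner_add_right[of x y "- z"] by simp

lemma cinner_sum_left: "cinner (\<Sum>i\<in>A. f i) (y::'h::complex_hilbert_space) = (\<Sum>i\<in>A. cinner (f i) y)"
  by (induction A rule: infinite_finite_induct) (auto simp: cinner_add_left)

lemma cinner_sum_right: "cinner (x::'h::complex_hilbert_space) (\<Sum>i\<in>A. f i) = (\<Sum>i\<in>A. cinner x (f i))"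
  by (induction A rule: infinite_finite_induct) (auto simp: cinner_add_right)

lemma cinner_self: "cinner (x::'h::complex_hilbert_space) x = complex_of_real ((norm x)\<^sup>2)"
proof (rule complex_eqI)
  have "Im (cinner x x) = - Im (cinner x x)"
    by (metis cinner_commute cnj.simps(2))
  then show "Im (cinner x x) = Im (complex_of_real ((norm x)\<^sup>2))" by simp
qed (simp add: inner_eq_Re_cinner[symmetric] power2_norm_eq_inner)

lemma cinner_eq_0_commute:
  "cinner (x::'h::complex_hilbert_space) y = 0 \<longleftrightarrow> cinner y x = 0"
  by (metis cinner_commute complex_cnj_zero)

lemma norm_scaleC: "norm (scaleC c (x::'h::complex_hilbert_space)) = cmod c * norm x"
proof -
  have "complex_of_real ((norm (scaleC c x))\<^sup>2) = (c * cnj c) * cinner x x"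
    by (simp only: cinner_self[symmetric] cinner_scaleC_left cinner_scaleC_right) (simp add: mult_ac)
  also have "\<dots> = complex_of_real ((cmod c * norm x)\<^sup>2)"
    by (simp only: cinner_self complex_norm_square[symmetric] power_mult_distrib of_real_mult)
  finally have "(norm (scaleC c x))\<^sup>2 = (cmod c * norm x)\<^sup>2"
    by (simp only: of_real_eq_iff)
  then show ?thesis by (simp add: power2_eq_iff_nonneg)
qed

lemma cmod_cinner_le: "cmod (cinner (x::'h::complex_hilbert_space) y) \<le> norm x * norm y"
proof (cases "cinner x y = 0")
  case False
  define c where "c = cnj (sgn (cinner x y))"
  have c: "cmod c = 1" using False by (simp add: c_def norm_sgn)
  have "c * cinner x y = complex_of_real (cmod (cinner x y))"
    using False by (simp add: c_def sgn_eq complex_norm_square[symmetric] power2_eq_square field_simps)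
      
  then have "cmod (cinner x y) = inner (scaleC c x) y"
    by (simp add: inner_eq_Re_cinner cinner_scaleC_left)
  also have "\<dots> \<le> norm (scaleC c x) * norm y" by (rule norm_cauchy_schwarz)
  finally show ?thesis by (simp add: norm_scaleC c)
qed simp

lemma bounded_linear_cinner_left: "bounded_linear (\<lambda>x::'h::complex_hilbert_space. cinner x y)"
  by (rule bounded_linear_intro[where K = "norm y"])
    (simp_all add: cinner_add_left scaleR_eq_scaleC cinner_scaleC_left cmod_cinner_le scaleR_conv_of_real)

lemma bounded_linear_cinner_right: "bounded_linear (\<lambda>y::'h::complex_hilbert_space. cinner x y)"
  by (rule bounded_linear_intro[where K = "norm x"])
    (simp_all add: cinner_add_right scaleR_eq_scaleC cinner_scaleC_right cmod_cinner_le
      scaleR_conv_of_real mult.commute[of "norm _" "norm x"])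

lemma bounded_linear_scaleC: "bounded_linear (\<lambda>x::'h::complex_hilbert_space. scaleC c x)"
  by (rule bounded_linear_intro[where K = "cmod c"])
    (simp_all add: scaleC_add_right scaleR_eq_scaleC scaleC_scaleC norm_scaleC mult.commute)

lemma bounded_clinearI:
  fixes T :: "'h::complex_hilbert_space \<Rightarrow> 'h"
  assumes "\<And>u v. T (u + v) = T u + T v" and "\<And>c u. T (scaleC c u) = scaleC c (T u)"
    and "\<And>u. norm (T u) \<le> norm u * K"
  shows "bounded_clinear T"
  unfolding bounded_clinear_def
  using assms by (auto simp: scaleR_eq_scaleC intro!: bounded_linear_intro[where K = K])

lemma bounded_clinearD:
  assumes "bounded_clinear (T::'h::complex_hilbert_space \<Rightarrow> 'h)"
  shows "bounded_linear T" and "T (scaleC c u) = scaleC c (T u)" and "T 0 = 0"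
    and "T (u + v) = T u + T v" and "T (u - v) = T u - T v" and "T (\<Sum>i\<in>A. f i) = (\<Sum>i\<in>A. T (f i))"
proof -
  show *: "bounded_linear T" "T (scaleC c u) = scaleC c (T u)"
    using assms by (auto simp: bounded_clinear_def)
  interpret bounded_linear T by fact
  show "T 0 = 0" "T (u + v) = T u + T v" "T (u - v) = T u - T v" "T (\<Sum>i\<in>A. f i) = (\<Sum>i\<in>A. T (f i))"
    by (rule zero add diff sum)+
qed

lemma bounded_clinear_id: "bounded_clinear (\<lambda>u. u)"
  by (rule bounded_clinearI[where K = 1]) auto

lemma bounded_clinear_zero: "bounded_clinear (\<lambda>u. 0)"
  by (rule bounded_clinearI[where K = 1]) auto

lemma bounded_clinear_compose:
  "bounded_clinear A \<Longrightarrow> bounded_clinear B \<Longrightarrow> bounded_clinear (\<lambda>u. A (B u))"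
  unfolding bounded_clinear_def by (auto intro: bounded_linear_compose)

lemma bounded_clinear_add:
  "bounded_clinear A \<Longrightarrow> bounded_clinear B \<Longrightarrow> bounded_clinear (\<lambda>u. A u + B u)"
  unfolding bounded_clinear_def by (auto intro: bounded_linear_add simp: scaleC_add_right)

lemma bounded_clinear_diff:
  "bounded_clinear A \<Longrightarrow> bounded_clinear B \<Longrightarrow> bounded_clinear (\<lambda>u. A u - B u)"
  unfolding bounded_clinear_def
  by (auto intro: bounded_linear_sub simp: complex_vector.scale_right_diff_distrib)

lemma bounded_clinear_scaleC:
  "bounded_clinear A \<Longrightarrow> bounded_clinear (\<lambda>u. scaleC c (A u))"
  unfolding bounded_clinear_def
  by (auto intro: bounded_linear_compose[OF bounded_linear_scaleC] simp: scaleC_scaleC mult.commute)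

text \<open>Polarization: evaluating the forms at \<open>u + v\<close> gives the sum of two mixed
  terms, and replacing \<open>u\<close> by \<open>scaleC \<i> u\<close> turns it into a difference,
  which separates them.\<close>

lemma bounded_clinear_eqI:
  fixes A B :: "'h::complex_hilbert_space \<Rightarrow> 'h"
  assumes A: "bounded_clinear A" and B: "bounded_clinear B"
    and eq: "\<And>u. cinner (A u) u = cinner (B u) u"
  shows "A = B"
proof -
  have pol: "cinner (A u) v + cinner (A v) u = cinner (B u) v + cinner (B v) u" for u v
    using eq[of "u + v"] eq[of u] eq[of v]
    by (simp add: bounded_clinearD(4)[OF A] bounded_clinearD(4)[OF B] cinner_add_left cinner_add_right)
      (simp add: algebra_simps)
  have "cinner (A u) v = cinner (B u) v" for u v
  proof -
    have "\<i> * cinner (A u) v - \<i> * cinner (A v) u = \<i> * cinner (B u) v - \<i> * cinner (B v) u"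
      using pol[of "scaleC \<i> u" v]
      by (simp add: bounded_clinearD(2)[OF A] bounded_clinearD(2)[OF B] cinner_scaleC_left cinner_scaleC_right)
    then have "\<i> * (cinner (A u) v - cinner (A v) u) = \<i> * (cinner (B u) v - cinner (B v) u)"
      by (simp add: algebra_simps)
    then have "cinner (A u) v - cinner (A v) u = cinner (B u) v - cinner (B v) u" by simp
    with pol[of u v] show ?thesis by (simp add: complex_eq_iff)
  qed
  then have "cinner (A u - B u) (A u - B u) = 0" for u
    by (simp add: cinner_diff_left)
  then show ?thesis by (auto simp: cinner_self)
qed

section \<open>Orthogonal families and diagonal operators\<close>

lemma singular_number_nonneg:
  assumes T: "bounded_clinear T"
  shows "0 \<le> singular_number T n"
  unfolding singular_number_def
proof (rule cInf_greatest)
  have "rank_le (\<lambda>u. 0) n" unfolding rank_le_def by (intro exI[of _ "{}"]) auto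
  then show "{onorm (\<lambda>u. T u - R u) | R. bounded_clinear R \<and> rank_le R n} \<noteq> {}"
    using bounded_clinear_zero by blast
  fix t assume "t \<in> {onorm (\<lambda>u. T u - R u) | R. bounded_clinear R \<and> rank_le R n}"
  then show "0 \<le> t"
    by (auto intro!: onorm_pos_le bounded_clinearD(1)[OF bounded_clinear_diff[OF T]])
qed

lemma singular_number_le:
  assumes T: "bounded_clinear T" and R: "bounded_clinear R" "rank_le R n"
  shows "singular_number T n \<le> onorm (\<lambda>u. T u - R u)"
  unfolding singular_number_def
proof (rule cInf_lower)
  show "bdd_below {onorm (\<lambda>u. T u - R u) | R. bounded_clinear R \<and> rank_le R n}"
    by (rule bdd_belowI[where m = 0])
      (auto intro!: onorm_pos_le bounded_clinearD(1)[OF bounded_clinear_diff[OF T]])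
qed (use R in blast)

definition ortho_family :: "(nat \<Rightarrow> 'h::complex_hilbert_space) \<Rightarrow> bool" where
  "ortho_family x \<longleftrightarrow> (\<forall>i j. i \<noteq> j \<longrightarrow> cinner (x i) (x j) = 0) \<and> (\<forall>i. norm (x i) \<le> 1)"

lemma cinner_imp_orthogonal: "cinner x y = 0 \<Longrightarrow> orthogonal x y"
  by (simp add: orthogonal_def inner_eq_Re_cinner)

lemma norm_sum_ortho:
  assumes "ortho_family y" "finite A"
  shows "(norm (\<Sum>i\<in>A. scaleC (d i) (y i)))\<^sup>2 = (\<Sum>i\<in>A. (cmod (d i))\<^sup>2 * (norm (y i))\<^sup>2)"
  using assms
  by (subst norm_sum_Pythagorean)
    (auto simp: ortho_family_def pairwise_def norm_scaleC power_mult_distrib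
      cinner_scaleC_left cinner_scaleC_right intro!: cinner_imp_orthogonal)

lemma norm_sum_ortho_le:
  assumes "ortho_family y" "finite A"
  shows "(norm (\<Sum>i\<in>A. scaleC (d i) (y i)))\<^sup>2 \<le> (\<Sum>i\<in>A. (cmod (d i))\<^sup>2)"
  unfolding norm_sum_ortho[OF assms]
  using assms(1) by (intro sum_mono mult_left_le) (auto simp: ortho_family_def power_le_one)

text \<open>The usual expansion of the square of \<open>norm (u - ?p)\<close>. As the vectors may be
  shorter than 1, the square of \<open>norm ?p\<close> is only bounded by \<open>?s\<close>, which
  is enough.\<close>

lemma bessel_sum:
  assumes "ortho_family x" "finite A"
  shows "(\<Sum>i\<in>A. (cmod (cinner u (x i)))\<^sup>2) \<le> (norm u)\<^sup>2"
proof -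
  let ?p = "\<Sum>i\<in>A. scaleC (cinner u (x i)) (x i)"
  let ?s = "\<Sum>i\<in>A. (cmod (cinner u (x i)))\<^sup>2"
  have "inner u ?p = ?s"
    by (simp add: inner_eq_Re_cinner cinner_sum_right cinner_scaleC_right mult.commute[of "cnj _"]
        flip: complex_norm_square)
  moreover have "0 \<le> (norm (u - ?p))\<^sup>2" by simp
  ultimately have "0 \<le> (norm u)\<^sup>2 - 2 * ?s + (norm ?p)\<^sup>2"
    by (simp add: power2_norm_eq_inner inner_diff_left inner_diff_right inner_commute)
  with norm_sum_ortho_le[OF assms, of "\<lambda>i. cinner u (x i)"] show ?thesis by simp
qed

lemma bessel_summable:
  assumes "ortho_family x"
  shows "summable (\<lambda>i. (cmod (cinner u (x i)))\<^sup>2)"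
  by (rule summableI_nonneg_bounded[where x = "(norm u)\<^sup>2"]) (auto intro: bessel_sum assms)

lemma bessel_suminf:
  assumes "ortho_family x"
  shows "(\<Sum>i. (cmod (cinner u (x i)))\<^sup>2) \<le> (norm u)\<^sup>2"
  by (rule suminf_le_const[OF bessel_summable[OF assms]]) (auto intro: bessel_sum assms)

lemma ortho_summable:
  assumes y: "ortho_family y" and d: "summable (\<lambda>n. (cmod (d n))\<^sup>2)"
  shows "summable (\<lambda>n. scaleC (d n) (y n))"
    and "norm (\<Sum>n. scaleC (d n) (y n)) \<le> sqrt (\<Sum>n. (cmod (d n))\<^sup>2)"
proof -
  show s: "summable (\<lambda>n. scaleC (d n) (y n))"
    unfolding summable_Cauchy
  proof (intro allI impI)
    fix e :: real assume e: "e > 0"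
    then have "e\<^sup>2 > 0" by simp
    with d obtain N where N: "\<And>m n. m \<ge> N \<Longrightarrow> norm (\<Sum>i\<in>{m..<n}. (cmod (d i))\<^sup>2) < e\<^sup>2"
      unfolding summable_Cauchy by blast
    have "norm (\<Sum>i\<in>{m..<n}. scaleC (d i) (y i)) < e" if "m \<ge> N" for m n
    proof -
      have "(norm (\<Sum>i\<in>{m..<n}. scaleC (d i) (y i)))\<^sup>2 < e\<^sup>2"
        using norm_sum_ortho_le[OF y, of "{m..<n}" d] N[OF that, of n] by (simp add: sum_nonneg)
      then show ?thesis using e by (simp add: power_less_imp_less_base)
    qed
    then show "\<exists>N. \<forall>m\<ge>N. \<forall>n. norm (\<Sum>i\<in>{m..<n}. scaleC (d i) (y i)) < e" by blast
  qed
  have "norm (\<Sum>i<n. scaleC (d i) (y i)) \<le> sqrt (\<Sum>n. (cmod (d n))\<^sup>2)" for n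
    using norm_sum_ortho_le[OF y, of "{..<n}" d] sum_le_suminf[OF d, of "{..<n}"]
    by (intro real_le_rsqrt) auto
  moreover have "(\<lambda>n. norm (\<Sum>i<n. scaleC (d i) (y i))) \<longlonglongrightarrow> norm (\<Sum>n. scaleC (d n) (y n))"
    using summable_LIMSEQ[OF s] by (rule tendsto_norm)
  ultimately show "norm (\<Sum>n. scaleC (d n) (y n)) \<le> sqrt (\<Sum>n. (cmod (d n))\<^sup>2)"
    by (intro LIMSEQ_le_const2) auto
qed

section \<open>Diagonal operators between orthogonal families\<close>

definition diagop ::
    "(nat \<Rightarrow> complex) \<Rightarrow> (nat \<Rightarrow> 'h::complex_hilbert_space) \<Rightarrow> (nat \<Rightarrow> 'h) \<Rightarrow> 'h \<Rightarrow> 'h" where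
  "diagop c x y u = (\<Sum>n. scaleC (c n * cinner u (x n)) (y n))"

context
  fixes c :: "nat \<Rightarrow> complex" and x y :: "nat \<Rightarrow> 'h::complex_hilbert_space" and C :: real
  assumes x: "ortho_family x" and y: "ortho_family y" and c: "\<And>n. cmod (c n) \<le> C"
begin

lemma diagop_coeff_le: "(cmod (c n * cinner u (x n)))\<^sup>2 \<le> C\<^sup>2 * (cmod (cinner u (x n)))\<^sup>2"
  using c[of n] by (simp add: norm_mult power_mult_distrib mult_right_mono power_mono)

lemma diagop_coeff_summable: "summable (\<lambda>n. (cmod (c n * cinner u (x n)))\<^sup>2)"
  by (rule summable_comparison_test[OF _ summable_mult[OF bessel_summable[OF x], of "C\<^sup>2"]])
    (use diagop_coeff_le in auto)

lemma diagop_sums: "(\<lambda>n. scaleC (c n * cinner u (x n)) (y n)) sums diagop c x y u"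
  unfolding diagop_def by (rule summable_sums[OF ortho_summable(1)[OF y diagop_coeff_summable]])

lemma norm_diagop_le: "norm (diagop c x y u) \<le> C * norm u"
proof -
  have C: "0 \<le> C" using c[of 0] norm_ge_zero[of "c 0"] by linarith
  have "(\<Sum>n. (cmod (c n * cinner u (x n)))\<^sup>2) \<le> (\<Sum>n. C\<^sup>2 * (cmod (cinner u (x n)))\<^sup>2)"
    by (intro suminf_le diagop_coeff_le diagop_coeff_summable summable_mult bessel_summable x)
  also have "\<dots> = C\<^sup>2 * (\<Sum>n. (cmod (cinner u (x n)))\<^sup>2)"
    by (rule suminf_mult[OF bessel_summable[OF x]])
  also have "\<dots> \<le> C\<^sup>2 * (norm u)\<^sup>2" by (intro mult_left_mono bessel_suminf x) auto
  finally have "sqrt (\<Sum>n. (cmod (c n * cinner u (x n)))\<^sup>2) \<le> C * norm u"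
    using C by (intro real_le_lsqrt) (auto simp: power_mult_distrib)
  with ortho_summable(2)[OF y diagop_coeff_summable, of u] show ?thesis
    unfolding diagop_def by linarith
qed

lemma bounded_clinear_diagop: "bounded_clinear (diagop c x y)"
proof (rule bounded_clinearI[where K = C])
  fix u v d
  have "(\<lambda>n. scaleC (c n * cinner u (x n)) (y n) + scaleC (c n * cinner v (x n)) (y n))
      sums (diagop c x y u + diagop c x y v)"
    by (intro sums_add diagop_sums)
  also have "(\<lambda>n. scaleC (c n * cinner u (x n)) (y n) + scaleC (c n * cinner v (x n)) (y n))
    = (\<lambda>n. scaleC (c n * cinner (u + v) (x n)) (y n))"
    by (simp add: cinner_add_left scaleC_add_left distrib_left)
  finally show "diagop c x y (u + v) = diagop c x y u + diagop c x y v"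
    using diagop_sums sums_unique2 by blast
  have "(\<lambda>n. scaleC d (scaleC (c n * cinner u (x n)) (y n))) sums scaleC d (diagop c x y u)"
    by (intro bounded_linear.sums[OF bounded_linear_scaleC] diagop_sums)
  also have "(\<lambda>n. scaleC d (scaleC (c n * cinner u (x n)) (y n)))
    = (\<lambda>n. scaleC (c n * cinner (scaleC d u) (x n)) (y n))"
    by (simp add: cinner_scaleC_left scaleC_scaleC mult.left_commute)
  finally show "diagop c x y (scaleC d u) = scaleC d (diagop c x y u)"
    using diagop_sums sums_unique2 by blast
  show "norm (diagop c x y u) \<le> norm u * C"
    using norm_diagop_le by (simp add: mult.commute)
qed

lemma diagop_cinner_sums:
  "(\<lambda>n. c n * cinner u (x n) * cinner (y n) v) sums cinner (diagop c x y u) v"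
  using bounded_linear.sums[OF bounded_linear_cinner_left diagop_sums[of u], of v]
  by (simp add: cinner_scaleC_left)

lemma cinner_diagop: "cinner (diagop c x y u) (y j) = c j * cinner u (x j) * cinner (y j) (y j)"
proof -
  have "(\<lambda>n. c n * cinner u (x n) * cinner (y n) (y j)) sums (c j * cinner u (x j) * cinner (y j) (y j))"
    using sums_finite[of "{j}" "\<lambda>n. c n * cinner u (x n) * cinner (y n) (y j)"] y
    by (auto simp: ortho_family_def)
  then show ?thesis using diagop_cinner_sums sums_unique2 by blast
qed

lemma diagop_apply: "diagop c x y (x j) = scaleC (c j * cinner (x j) (x j)) (y j)"
proof -
  have "(\<lambda>n. scaleC (c n * cinner (x j) (x n)) (y n)) sums scaleC (c j * cinner (x j) (x j)) (y j)"
    using sums_finite[of "{j}" "\<lambda>n. scaleC (c n * cinner (x j) (x n)) (y n)"] x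
    by (auto simp: ortho_family_def)
  then show ?thesis using diagop_sums sums_unique2 by blast
qed

text \<open>The first \<open>n\<close> terms form an operator of rank at most \<open>n\<close>, and
  what is left is again diagonal, with coefficients bounded by \<open>D\<close>.\<close>

lemma singular_number_diagop_le:
  assumes tail: "\<And>k. k \<ge> n \<Longrightarrow> cmod (c k) \<le> D" and D: "0 \<le> D"
  shows "singular_number (diagop c x y) n \<le> D"
proof -
  define R where "R = diagop (\<lambda>k. if k < n then c k else 0) x y"
  have C: "0 \<le> C" using c[of 0] norm_ge_zero[of "c 0"] by linarith
  have Rsum: "R u = (\<Sum>k<n. scaleC (c k * cinner u (x k)) (y k))" for u
    unfolding R_def diagop_def by (subst suminf_finite[of "{..<n}"]) (auto intro!: sum.cong)
  have R: "bounded_clinear R"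
    unfolding R_def using x y c C by (intro Submission.bounded_clinear_diagop[where C = C]) auto
  have rank: "rank_le R n"
    unfolding rank_le_def
  proof (intro exI conjI)
    show "finite (y ` {..<n})" by simp
    show "card (y ` {..<n}) \<le> n" using card_image_le[of "{..<n}" y] by simp
    show "range R \<subseteq> complex_vector.span (y ` {..<n})"
      unfolding Rsum
      by (intro image_subsetI complex_vector.span_sum complex_vector.span_scale
          complex_vector.span_base imageI) auto
  qed
  have eq: "diagop c x y u - R u = diagop (\<lambda>k. if k < n then 0 else c k) x y u" for u
  proof -
    have "(\<lambda>k. scaleC ((if k < n then c k else 0) * cinner u (x k)) (y k)) sums R u"
      unfolding R_def using x y c C by (intro Submission.diagop_sums[where C = C]) auto
    from sums_diff[OF diagop_sums[of u] this]
    have "(\<lambda>k. scaleC ((if k < n then 0 else c k) * cinner u (x k)) (y k)) sums (diagop c x y u - R u)"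
      by (rule back_subst[of "\<lambda>f. f sums _"]) auto
    then show ?thesis unfolding diagop_def[of "\<lambda>k. if k < n then 0 else c k"] by (simp add: sums_iff)
  qed
  have "onorm (\<lambda>u. diagop c x y u - R u) \<le> D"
    unfolding eq using x y tail D
    by (intro onorm_bound Submission.norm_diagop_le) auto
  with singular_number_le[OF bounded_clinear_diagop R rank] show ?thesis by linarith
qed

end

section \<open>Orthonormal bases\<close>

definition onset :: "'h::complex_hilbert_space set \<Rightarrow> bool" where
  "onset C \<longleftrightarrow> (\<forall>x\<in>C. \<forall>y\<in>C. cinner x y = (if x = y then 1 else 0))"

lemma norm_eq_1_if_cinner: "cinner x x = 1 \<Longrightarrow> norm (x::'h::complex_hilbert_space) = 1"
proof -
  assume "cinner x x = 1"
  then have "(norm x)\<^sup>2 = 1"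
    using cinner_self[of x] by (simp only: of_real_eq_1_iff)
  then show ?thesis by (simp add: power2_eq_1_iff) (metis norm_ge_zero le_minus_one_simps(3))
qed

lemma onset_norm: "onset C \<Longrightarrow> x \<in> C \<Longrightarrow> norm x = 1"
  by (rule norm_eq_1_if_cinner) (simp add: onset_def)

lemma onset_residual:
  assumes C: "onset C" "finite C" and c: "c \<in> C"
  shows "cinner (b - (\<Sum>d\<in>C. scaleC (cinner b d) d)) c = 0"
proof -
  have "(\<Sum>d\<in>C. cinner b d * cinner d c) = (\<Sum>d\<in>C. if d = c then cinner b d else 0)"
    using C c by (intro sum.cong) (auto simp: onset_def)
  also have "\<dots> = cinner b c" using C c by simp
  finally show ?thesis by (simp add: cinner_diff_left cinner_sum_left cinner_scaleC_left)
qed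

lemma onset_insert:
  assumes C: "onset C" and w: "w \<noteq> 0" and perp: "\<And>c. c \<in> C \<Longrightarrow> cinner w c = 0"
  shows "onset (insert (scaleC (1 / complex_of_real (norm w)) w) C)"
    and "\<And>c. c \<in> C \<Longrightarrow> cinner (scaleC (1 / complex_of_real (norm w)) w) c = 0"
proof -
  let ?x = "scaleC (1 / complex_of_real (norm w)) w"
  have x: "cinner ?x ?x = 1"
    using w by (simp add: cinner_self norm_scaleC norm_divide)
  show perp': "\<And>c. c \<in> C \<Longrightarrow> cinner ?x c = 0"
    using perp by (simp add: cinner_scaleC_left)
  then have "?x \<notin> C" using x by force
  then show "onset (insert ?x C)"
    using C x perp' unfolding onset_def by (auto simp: cinner_eq_0_commute[of _ ?x])
qed

text \<open>Gram-Schmidt, one vector at a time: the residual of \<open>b\<close> is normalized and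
  added unless it vanishes.\<close>

lemma finite_span_onset:
  assumes "finite (B :: 'h::complex_hilbert_space set)"
  shows "\<exists>C. finite C \<and> card C \<le> card B \<and> onset C \<and> complex_vector.span B \<subseteq> complex_vector.span C"
  using assms
proof (induction B)
  case empty
  show ?case by (intro exI[of _ "{}"]) (auto simp: onset_def)
next
  case (insert b B)
  then obtain C where C: "finite C" "card C \<le> card B" "onset C"
    "complex_vector.span B \<subseteq> complex_vector.span C" by blast
  define s where "s = (\<Sum>d\<in>C. scaleC (cinner b d) d)"
  have s: "s \<in> complex_vector.span C'" if "C \<subseteq> C'" for C'
    unfolding s_def using that
    by (intro complex_vector.span_sum complex_vector.span_scale complex_vector.span_base) auto
  have sub: "complex_vector.span (insert b B) \<subseteq> complex_vector.span C'"
    if "C \<subseteq> C'" "b \<in> complex_vector.span C'" for C'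
  proof (rule complex_vector.span_minimal)
    have "B \<subseteq> complex_vector.span C'"
      using C(4) complex_vector.span_superset[of B] complex_vector.span_mono[OF that(1)] by blast
    then show "insert b B \<subseteq> complex_vector.span C'" using that by auto
  qed (rule complex_vector.subspace_span)
  show ?case
  proof (cases "b - s = 0")
    case True
    then show ?thesis using C s[of C] sub[of C] insert.hyps by (intro exI[of _ C]) auto
  next
    case False
    let ?x = "scaleC (1 / complex_of_real (norm (b - s))) (b - s)"
    have on: "onset (insert ?x C)"
      using onset_residual[OF C(3,1)] False by (intro onset_insert C) (auto simp: s_def)
    have "b = scaleC (complex_of_real (norm (b - s))) ?x + s"
      using False by (simp add: scaleC_scaleC)
    then have "b \<in> complex_vector.span (insert ?x C)"
      using s[of "insert ?x C"]
      by (metis complex_vector.span_add complex_vector.span_scale complex_vector.span_base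
          insertI1 subset_insertI)
    then show ?thesis using C sub[of "insert ?x C"] on insert.hyps
      by (intro exI[of _ "insert ?x C"]) (auto intro: le_trans[OF card_insert_le_m1] simp: card_insert_if)
  qed
qed

text \<open>This makes every orthonormal basis infinite, and it keeps the successive choice of
  singular vectors from ever stopping.\<close>

lemma unit_orthogonal_exists:
  fixes F :: "'h::complex_hilbert_space set"
  assumes inf: "\<not> (\<exists>B :: 'h set. finite B \<and> complex_vector.span B = UNIV)" and F: "finite F"
  obtains x where "norm x = 1" and "\<And>f. f \<in> F \<Longrightarrow> cinner x f = 0"
proof -
  obtain C where C: "finite C" "onset C" "complex_vector.span F \<subseteq> complex_vector.span C"
    using finite_span_onset[OF F] by blast
  obtain b where b: "b \<notin> complex_vector.span C" using inf C(1) by blast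
  define w where "w = b - (\<Sum>d\<in>C. scaleC (cinner b d) d)"
  have "(\<Sum>d\<in>C. scaleC (cinner b d) d) \<in> complex_vector.span C"
    by (intro complex_vector.span_sum complex_vector.span_scale complex_vector.span_base) auto
  then have w: "w \<noteq> 0" using b by (auto simp: w_def)
  have perp: "cinner w c = 0" if "c \<in> C" for c
    unfolding w_def by (rule onset_residual[OF C(2,1) that])
  let ?x = "scaleC (1 / complex_of_real (norm w)) w"
  have "norm ?x = 1" using w by (simp add: norm_scaleC norm_divide)
  moreover have "cinner ?x v = 0" if "v \<in> complex_vector.span C" for v
    using that
  proof (induction rule: complex_vector.span_induct_alt)
    case (step c y z)
    then show ?case using onset_insert(2)[OF C(2) w perp, of y]
      by (simp add: cinner_add_right cinner_scaleC_right)
  qed simp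
  ultimately show ?thesis
    using that[of ?x] C(3) complex_vector.span_superset[of F] by blast
qed

text \<open>Completeness is expressed by a trivial orthogonal complement: maximality yields it in
  this form, and it lets vectors be compared coordinate by coordinate.\<close>

definition onbasis :: "(nat \<Rightarrow> 'h::complex_hilbert_space) \<Rightarrow> bool" where
  "onbasis e \<longleftrightarrow> (\<forall>i j. cinner (e i) (e j) = (if i = j then 1 else 0)) \<and>
     (\<forall>u. (\<forall>n. cinner u (e n) = 0) \<longrightarrow> u = 0)"

lemma onset_dist:
  assumes "onset C" "x \<in> C" "y \<in> C" "x \<noteq> y"
  shows "1 \<le> dist x y"
proof -
  have "(dist x y)\<^sup>2 = 2"
    using onset_norm[OF assms(1,2)] onset_norm[OF assms(1,3)] assms
    by (simp add: dist_norm power2_norm_eq_inner inner_diff_left inner_diff_right)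
      (simp add: inner_eq_Re_cinner onset_def)
  then show ?thesis
    using power2_le_imp_le[of 1 "dist x y"] by simp
qed

lemma onbasis_exists:
  assumes sep: "\<exists>D :: 'h set. countable D \<and> closure D = UNIV"
    and inf: "\<not> (\<exists>B :: 'h set. finite B \<and> complex_vector.span B = UNIV)"
  obtains e :: "nat \<Rightarrow> 'h::complex_hilbert_space" where "onbasis e"
proof -
  have "\<exists>M\<in>{C :: 'h set. onset C}. \<forall>X\<in>{C. onset C}. M \<subseteq> X \<longrightarrow> X = M"
  proof (rule subset_Zorn)
    fix \<C> :: "'h set set" assume "subset.chain {C. onset C} \<C>"
    then have chain: "\<And>C. C \<in> \<C> \<Longrightarrow> onset C" "\<And>C D. C \<in> \<C> \<Longrightarrow> D \<in> \<C> \<Longrightarrow> C \<subseteq> D \<or> D \<subseteq> C"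
      by (auto simp: subset.chain_def)
    have "onset (\<Union>\<C>)"
      unfolding onset_def
    proof (intro ballI)
      fix x y assume "x \<in> \<Union>\<C>" "y \<in> \<Union>\<C>"
      then obtain C where "C \<in> \<C>" "x \<in> C" "y \<in> C" using chain(2) by blast
      then show "cinner x y = (if x = y then 1 else 0)" using chain(1) unfolding onset_def by blast
    qed
    then show "\<exists>U\<in>{C. onset C}. \<forall>X\<in>\<C>. X \<subseteq> U" by blast
  qed
  then obtain M :: "'h set" where M: "onset M" and max: "\<And>X. onset X \<Longrightarrow> M \<subseteq> X \<Longrightarrow> X = M" by blast
  \<comment> \<open>Otherwise \<open>u\<close> could be normalized and added to the maximal set
    \<open>M\<close>.\<close>
  have complete: "u = 0" if "\<And>x. x \<in> M \<Longrightarrow> cinner u x = 0" for u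
  proof (rule ccontr)
    assume "u \<noteq> 0"
    note ins = onset_insert[OF M this that]
    let ?x = "scaleC (1 / complex_of_real (norm u)) u"
    have "?x \<in> M" using max[OF ins(1)] by blast
    then show False using ins(2)[of ?x] onset_norm[OF M, of ?x] by (simp add: cinner_self)
  qed
  have "infinite M"
  proof
    assume "finite M"
    from unit_orthogonal_exists[OF inf this] obtain x
      where "norm x = 1" "\<And>f. f \<in> M \<Longrightarrow> cinner x f = 0" by blast
    with complete[of x] show False by auto
  qed
  moreover have "countable M"
  \<comment> \<open>Every vector of \<open>M\<close> picks a point of the countable dense set within
    distance \<open>1 / 2\<close>. Distinct vectors of \<open>M\<close> are at distance at least 1,
    so they pick distinct points.\<close>
  proof -
    obtain D :: "'h set" where D: "countable D" "closure D = UNIV" using sep by blast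
    have "\<forall>c. \<exists>d\<in>D. dist d c < 1 / 2"
      using D(2) by (metis UNIV_I closure_approachable half_gt_zero zero_less_one)
    then obtain f where f: "\<And>c. f c \<in> D" "\<And>c. dist (f c) c < 1 / 2" by metis
    have "inj_on f M"
    proof (rule inj_onI, rule ccontr)
      fix x y assume *: "x \<in> M" "y \<in> M" "f x = f y" "x \<noteq> y"
      have "dist x y \<le> dist (f x) x + dist (f y) y"
        using dist_triangle3[of x y "f x"] *(3) by simp
      with onset_dist[OF M *(1,2,4)] f(2)[of x] f(2)[of y] show False by simp
    qed
    moreover have "countable (f ` M)" using f(1) D(1) by (meson countable_subset image_subsetI)
    ultimately show ?thesis using countable_image_inj_on by blast
  qed
  ultimately have bij: "bij_betw (from_nat_into M) UNIV M" by (simp add: bij_betw_from_nat_into)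
  have "onbasis (from_nat_into M)"
    unfolding onbasis_def
  proof (intro conjI allI impI)
    fix i j
    have "from_nat_into M i = from_nat_into M j \<longleftrightarrow> i = j"
      using bij unfolding bij_betw_def inj_on_def by auto
    then show "cinner (from_nat_into M i) (from_nat_into M j) = (if i = j then 1 else 0)"
      using M bij unfolding onset_def bij_betw_def by (metis rangeI)
  next
    fix u assume "\<forall>n. cinner u (from_nat_into M n) = 0"
    then show "u = 0" using complete bij unfolding bij_betw_def by (metis imageE)
  qed
  then show ?thesis by (rule that)
qed

lemma onbasis_norm: "onbasis e \<Longrightarrow> norm (e n) = 1"
  by (rule norm_eq_1_if_cinner) (simp add: onbasis_def)

lemma onbasis_ortho_family: "onbasis e \<Longrightarrow> inj f \<Longrightarrow> ortho_family (\<lambda>n. e (f n))"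
  by (simp add: ortho_family_def onbasis_norm) (simp add: onbasis_def inj_eq)

lemma onbasis_ortho_family': "onbasis e \<Longrightarrow> ortho_family e"
  using onbasis_ortho_family[of e "\<lambda>n. n"] by simp

lemma onbasis_eqI:
  assumes "onbasis e" "\<And>n. cinner u (e n) = cinner v (e n)"
  shows "u = v"
  using assms unfolding onbasis_def by (metis cinner_diff_left diff_self right_minus_eq)

lemma onbasis_cinner: "onbasis e \<Longrightarrow> cinner (e i) (e j) = (if i = j then 1 else 0)"
  by (simp add: onbasis_def)

lemma onbasis_diagop_1:
  assumes e: "onbasis e"
  shows "diagop (\<lambda>_. 1) e e u = u"
  by (rule onbasis_eqI[OF e])
    (simp add: cinner_diagop[where C = 1, OF onbasis_ortho_family'[OF e] onbasis_ortho_family'[OF e]]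
      onbasis_cinner[OF e])

section \<open>Joint spectral measures of commuting projections\<close>

lemma orthogonal_projectionI:
  assumes "bounded_clinear P" "\<And>u. P (P u) = P u" "\<And>u v. cinner (P u) v = cinner u (P v)"
  shows "orthogonal_projection P"
  using assms by (auto simp: orthogonal_projection_def fun_eq_iff)

lemma orthogonal_projectionD:
  assumes "orthogonal_projection P"
  shows "bounded_clinear P" "P (P u) = P u" "cinner (P u) v = cinner u (P v)"
  using assms by (auto simp: orthogonal_projection_def fun_eq_iff)

lemma cinner_projection:
  assumes "orthogonal_projection P"
  shows "cinner (P u) u = complex_of_real ((norm (P u))\<^sup>2)"
  using orthogonal_projectionD(3)[OF assms, of "P u" u]
  by (simp add: orthogonal_projectionD(2)[OF assms] cinner_self)

lemma norm_projection_split: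
  assumes P: "orthogonal_projection P"
  shows "(norm u)\<^sup>2 = (norm (P u))\<^sup>2 + (norm (u - P u))\<^sup>2"
proof -
  have "inner (P u) u = (norm (P u))\<^sup>2"
    by (simp only: inner_eq_Re_cinner cinner_projection[OF P] Re_complex_of_real)
  moreover have "(norm (u - P u))\<^sup>2 = (norm u)\<^sup>2 - 2 * inner (P u) u + (norm (P u))\<^sup>2"
    by (simp add: power2_norm_eq_inner inner_diff_left inner_diff_right inner_commute)
  ultimately show ?thesis by simp
qed

lemma norm_projection_le:
  assumes P: "orthogonal_projection P"
  shows "norm (P u) \<le> norm u"
  using norm_projection_split[OF P, of u] by (simp add: power2_le_imp_le)

lemma projection_zero: "orthogonal_projection (\<lambda>u. 0)"
  by (rule orthogonal_projectionI) (auto intro: bounded_clinear_zero)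

lemma projection_id: "orthogonal_projection (\<lambda>u. u)"
  by (rule orthogonal_projectionI) (auto intro: bounded_clinear_id)

lemma projection_complement:
  assumes "orthogonal_projection P"
  shows "orthogonal_projection (\<lambda>u. u - P u)"
  using orthogonal_projectionD[OF assms]
  by (intro orthogonal_projectionI bounded_clinear_diff bounded_clinear_id)
    (simp_all add: bounded_clinearD(5)[OF orthogonal_projectionD(1)[OF assms]]
      cinner_diff_left cinner_diff_right)

lemma projection_compose:
  assumes P: "orthogonal_projection P" and Q: "orthogonal_projection Q"
    and comm: "\<And>u. P (Q u) = Q (P u)"
  shows "orthogonal_projection (\<lambda>u. P (Q u))"
proof (rule orthogonal_projectionI)
  show "bounded_clinear (\<lambda>u. P (Q u))"
    by (intro bounded_clinear_compose[of P Q] orthogonal_projectionD(1) P Q)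
  show "P (Q (P (Q u))) = P (Q u)" for u
    by (simp only: comm orthogonal_projectionD(2)[OF P] orthogonal_projectionD(2)[OF Q])
  show "cinner (P (Q u)) v = cinner u (P (Q v))" for u v
    by (simp only: orthogonal_projectionD(3)[OF P] orthogonal_projectionD(3)[OF Q] comm)
qed

lemma projection_eqI:
  assumes P: "orthogonal_projection P" and Q: "orthogonal_projection Q"
    and eq: "\<And>u. norm (P u) = norm (Q u)"
  shows "P = Q"
  by (rule bounded_clinear_eqI)
    (simp_all add: orthogonal_projectionD(1) P Q cinner_projection[OF P] cinner_projection[OF Q] eq)

text \<open>At the vector \<open>Q u\<close> the bound is already exhausted by
  \<open>Q (Q u) = Q u\<close>, so nothing is left for \<open>P (Q u)\<close>.\<close>

lemma projection_mult_zero: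
  assumes P: "orthogonal_projection P" and Q: "orthogonal_projection Q"
    and le: "\<And>u. (norm (P u))\<^sup>2 + (norm (Q u))\<^sup>2 \<le> (norm u)\<^sup>2"
  shows "P (Q u) = 0"
  using le[of "Q u"] by (simp add: orthogonal_projectionD(2)[OF Q])

text \<open>The bound on the norms makes the projections mutually orthogonal.\<close>

lemma projection_sums:
  fixes Q :: "nat \<Rightarrow> 'h::complex_hilbert_space \<Rightarrow> 'h"
  assumes Q: "\<And>n. orthogonal_projection (Q n)"
    and le: "\<And>i j u. i \<noteq> j \<Longrightarrow> (norm (Q i u))\<^sup>2 + (norm (Q j u))\<^sup>2 \<le> (norm u)\<^sup>2"
  shows "\<exists>P. orthogonal_projection P \<and> (\<forall>u. (\<lambda>n. Q n u) sums P u) \<and>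
    (\<forall>u. (\<lambda>n. (norm (Q n u))\<^sup>2) sums (norm (P u))\<^sup>2)"
proof -
  note Q0 = projection_mult_zero[OF Q Q le]
  define P where "P u = (\<Sum>n. Q n u)" for u
  \<comment> \<open>Normalizing the pieces gives an orthogonal family, with the value 0 where
    \<open>Q n u = 0\<close> because division by zero yields 0. The sum of the projections thereby
    becomes a Bessel expansion of \<open>u\<close>.\<close>
  define y where "y u n = scaleC (1 / complex_of_real (norm (Q n u))) (Q n u)" for u n
  have y: "ortho_family (y u)" for u
    unfolding ortho_family_def y_def
    by (auto simp: cinner_scaleC_left cinner_scaleC_right norm_scaleC norm_divide
        orthogonal_projectionD(3)[OF Q] Q0)
  have yQ: "scaleC (cinner u (y u n)) (y u n) = Q n u" for u n
  proof (cases "Q n u = 0")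
    case False
    have "cinner u (Q n u) = complex_of_real ((norm (Q n u))\<^sup>2)"
      using cinner_projection[OF Q, of n u] orthogonal_projectionD(3)[OF Q, of n u u] by simp
    then show ?thesis using False
      by (simp add: y_def cinner_scaleC_right scaleC_scaleC power2_eq_square)
  qed (simp add: y_def)
  have sums: "(\<lambda>n. Q n u) sums P u" and le: "norm (P u) \<le> norm u" for u
  proof -
    note * = ortho_summable[OF y[of u] bessel_summable[OF y[of u], of u]]
    show "(\<lambda>n. Q n u) sums P u" using *(1) unfolding yQ P_def by (rule summable_sums)
    have "norm (P u) \<le> sqrt (\<Sum>n. (cmod (cinner u (y u n)))\<^sup>2)"
      using *(2) unfolding yQ P_def .
    also have "\<dots> \<le> norm u" by (intro real_le_lsqrt bessel_suminf y) auto
    finally show "norm (P u) \<le> norm u" .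
  qed
  have eqI: "P u = v" if "(\<lambda>n. Q n u) sums v" for u v
    using sums[of u] that by (rule sums_unique2)
  have bcl: "bounded_clinear P"
  proof (rule bounded_clinearI[where K = 1])
    show "P (u + v) = P u + P v" for u v
      using sums_add[OF sums[of u] sums[of v]]
      by (intro eqI) (simp add: bounded_clinearD(4)[OF orthogonal_projectionD(1)[OF Q]])
    show "P (scaleC c u) = scaleC c (P u)" for c u
      using bounded_linear.sums[OF bounded_linear_scaleC sums[of u], of c]
      by (intro eqI) (simp add: bounded_clinearD(2)[OF orthogonal_projectionD(1)[OF Q]])
  qed (use le in auto)
  have QP: "Q n (P u) = Q n u" for n u
  proof -
    have "(\<lambda>k. Q n (Q k u)) sums Q n (P u)"
      by (intro bounded_linear.sums[OF bounded_clinearD(1)[OF orthogonal_projectionD(1)[OF Q]]] sums)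
    moreover have "(\<lambda>k. Q n (Q k u)) sums Q n u"
      using sums_finite[of "{n}" "\<lambda>k. Q n (Q k u)"] Q0 by (simp add: orthogonal_projectionD(2)[OF Q])
    ultimately show ?thesis by (rule sums_unique2)
  qed
  have P: "orthogonal_projection P"
  proof (rule orthogonal_projectionI[OF bcl])
    show "P (P u) = P u" for u using sums[of u] by (intro eqI) (simp add: QP)
    show "cinner (P u) v = cinner u (P v)" for u v
      using bounded_linear.sums[OF bounded_linear_cinner_left sums[of u], of v]
        bounded_linear.sums[OF bounded_linear_cinner_right sums[of v], of u]
      unfolding orthogonal_projectionD(3)[OF Q] by (rule sums_unique2)
  qed
  have "(\<lambda>n. (norm (Q n u))\<^sup>2) sums (norm (P u))\<^sup>2" for u
    using bounded_linear.sums[OF bounded_linear_cinner_left sums[of u], of u]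
    unfolding cinner_projection[OF Q] cinner_projection[OF P]
    by (simp only: sums_of_real_iff)
  with P sums show ?thesis by blast
qed

text \<open>The sets whose measures \<open>\<mu> u\<close> are the quadratic form of a projection form a Dynkin system.\<close>

lemma projection_valued_extension:
  fixes \<mu> :: "'h::complex_hilbert_space \<Rightarrow> 'x measure"
  assumes G: "G \<subseteq> Pow \<Omega>" "Int_stable G"
    and sets: "\<And>u. sets (\<mu> u) = sigma_sets \<Omega> G"
    and fin: "\<And>u. finite_measure (\<mu> u)"
    and tot: "\<And>u. measure (\<mu> u) \<Omega> = (norm u)\<^sup>2"
    and base: "\<And>A. A \<in> G \<Longrightarrow> \<exists>Q. orthogonal_projection Q \<and> (\<forall>u. measure (\<mu> u) A = (norm (Q u))\<^sup>2)"
  shows "\<exists>E. spectral_measure (sigma \<Omega> G) E \<and>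
    (\<forall>A\<in>sigma_sets \<Omega> G. \<forall>u. measure (\<mu> u) A = (norm (E A u))\<^sup>2)"
proof -
  define good where "good A Q \<longleftrightarrow> orthogonal_projection Q \<and> (\<forall>u. measure (\<mu> u) A = (norm (Q u))\<^sup>2)" for A Q
  interpret sa: sigma_algebra \<Omega> "sigma_sets \<Omega> G" by (rule sigma_algebra_sigma_sets[OF G(1)])
  have cup: "\<exists>P. good (\<Union>n. A n) P \<and> (\<forall>u. (\<lambda>n. Q n u) sums P u)"
    if A: "disjoint_family A" "range A \<subseteq> sigma_sets \<Omega> G" and Q: "\<And>n. good (A n) (Q n)"
    for A :: "nat \<Rightarrow> 'x set" and Q
  proof -
    \<comment> \<open>For disjoint sets the two measures add up to at most the measure of the whole
      space; this is the orthogonality that \<open>projection_sums\<close> asks for.\<close>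
    have le: "(norm (Q i u))\<^sup>2 + (norm (Q j u))\<^sup>2 \<le> (norm u)\<^sup>2" if "i \<noteq> j" for i j u
    proof -
      interpret finite_measure "\<mu> u" by (rule fin)
      have "(norm (Q i u))\<^sup>2 + (norm (Q j u))\<^sup>2 = measure (\<mu> u) (A i \<union> A j)"
        using A that Q by (subst finite_measure_Union) (auto simp: sets good_def disjoint_family_on_def)
      also have "\<dots> \<le> measure (\<mu> u) \<Omega>"
        using A sa.sets_into_space by (intro finite_measure_mono) (auto simp: sets)
      finally show ?thesis by (simp add: tot)
    qed
    have Qp: "\<And>n. orthogonal_projection (Q n)" using Q by (simp add: good_def)
    obtain P where P: "orthogonal_projection P"
      "\<And>u. (\<lambda>n. Q n u) sums P u" "\<And>u. (\<lambda>n. (norm (Q n u))\<^sup>2) sums (norm (P u))\<^sup>2"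
      using projection_sums[of Q, OF Qp le] by blast
    have "measure (\<mu> u) (\<Union>n. A n) = (norm (P u))\<^sup>2" for u
    proof -
      interpret finite_measure "\<mu> u" by (rule fin)
      have "(\<lambda>n. measure (\<mu> u) (A n)) sums measure (\<mu> u) (\<Union>n. A n)"
        using A by (intro finite_measure_UNION) (auto simp: sets)
      then have "(\<lambda>n. (norm (Q n u))\<^sup>2) sums measure (\<mu> u) (\<Union>n. A n)"
        using Q by (simp add: good_def)
      then show ?thesis using P(3)[of u] by (rule sums_unique2)
    qed
    with P show ?thesis by (auto simp: good_def)
  qed
  have ex: "\<exists>Q. good A Q" if "A \<in> sigma_sets \<Omega> G" for A
    using G(2,1) that
  proof (induction rule: sigma_sets_induct_disjoint)
    case (basic A)
    then show ?case using base by (simp add: good_def)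
  next
    case empty
    show ?case using projection_zero by (auto simp: good_def)
  next
    case (compl A)
    then obtain Q where Q: "good A Q" by blast
    have "good (\<Omega> - A) (\<lambda>u. u - Q u)"
      unfolding good_def
    proof (intro conjI allI)
      show "orthogonal_projection (\<lambda>u. u - Q u)"
        using Q projection_complement by (auto simp: good_def)
      fix u
      interpret finite_measure "\<mu> u" by (rule fin)
      have "measure (\<mu> u) (\<Omega> - A) = measure (\<mu> u) \<Omega> - measure (\<mu> u) A"
        using compl sa.sets_into_space by (intro finite_measure_Diff) (auto simp: sets)
      then show "measure (\<mu> u) (\<Omega> - A) = (norm (u - Q u))\<^sup>2"
        using Q norm_projection_split[of Q u] by (simp add: tot good_def)
    qed
    then show ?case by blast
  next
    case (union A)
    then obtain Q where "\<And>n. good (A n) (Q n)" by metis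
    then show ?case using cup[OF union.hyps] by blast
  qed
  define E where "E A = (SOME Q. good A Q)" for A
  have E: "good A (E A)" if "A \<in> sigma_sets \<Omega> G" for A
    unfolding E_def by (rule someI_ex[OF ex[OF that]])
  \<comment> \<open>The quadratic form determines the projection, so the choice in \<open>E\<close>
    is forced and the sums found in \<open>cup\<close> must be values of \<open>E\<close>.\<close>
  have unique: "Q = Q'" if "good A Q" "good A Q'" for A Q Q'
    using that by (intro projection_eqI) (auto simp: good_def power2_eq_iff_nonneg)
  have "spectral_measure (sigma \<Omega> G) E"
    unfolding spectral_measure_def space_measure_of_conv sets_measure_of[OF G(1)]
  proof (intro conjI ballI allI impI)
    show "orthogonal_projection (E A)" if "A \<in> sigma_sets \<Omega> G" for A
      using E[OF that] by (simp add: good_def)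
    have "good \<Omega> (\<lambda>u. u)" by (simp add: good_def projection_id tot)
    from unique[OF E[OF sa.top] this] show "E \<Omega> = id" by (simp add: id_def)
    fix A :: "nat \<Rightarrow> 'x set" and u
    assume A: "range A \<subseteq> sigma_sets \<Omega> G" "disjoint_family A"
    have "good (A n) (E (A n))" for n by (rule E) (use A in auto)
    from cup[OF A(2,1) this] obtain P where P: "good (\<Union>n. A n) P" "\<And>u. (\<lambda>n. E (A n) u) sums P u"
      by blast
    have "P = E (\<Union>n. A n)"
      using A P(1) by (intro unique[OF _ E] sa.countable_UN) auto
    with P(2) show "(\<lambda>n. E (A n) u) sums E (\<Union>n. A n) u" by simp
  qed
  moreover have "measure (\<mu> u) A = (norm (E A u))\<^sup>2" if "A \<in> sigma_sets \<Omega> G" for A u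
    using E[OF that] by (simp add: good_def)
  ultimately show ?thesis by blast
qed

section \<open>Measures on binary sequences with given cylinder weights\<close>

fun prefix_of :: "('x \<Rightarrow> nat \<Rightarrow> bool) \<Rightarrow> 'x \<Rightarrow> nat \<Rightarrow> bool list" where
  "prefix_of bits x 0 = []"
| "prefix_of bits x (Suc n) = bits x n # prefix_of bits x n"

text \<open>Prefixes carry the latest bit first, so \<open>length s\<close> is the index of the bit
  that \<open>b # s\<close> adds to \<open>s\<close>.\<close>

definition cylinder :: "('x \<Rightarrow> nat \<Rightarrow> bool) \<Rightarrow> bool list \<Rightarrow> 'x set" where
  "cylinder bits s = {x. prefix_of bits x (length s) = s}"

lemma prefix_of_eq_iff: "prefix_of bits x n = prefix_of bits y n \<longleftrightarrow> (\<forall>i<n. bits x i = bits y i)"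
  by (induction n) (auto simp: less_Suc_eq)

lemma length_prefix_of [simp]: "length (prefix_of bits x n) = n"
  by (induction n) auto

text \<open>Cylinders form a tree: a common point makes the shorter prefix an initial part of the
  longer one.\<close>

lemma cylinder_Int:
  assumes "length s \<le> length t"
  shows "cylinder bits s \<inter> cylinder bits t = {} \<or> cylinder bits s \<inter> cylinder bits t = cylinder bits t"
proof (cases "cylinder bits s \<inter> cylinder bits t = {}")
  case False
  then obtain x where x: "prefix_of bits x (length s) = s" "prefix_of bits x (length t) = t"
    by (auto simp: cylinder_def)
  have "prefix_of bits y (length s) = s" if "prefix_of bits y (length t) = t" for y
  proof -
    have "prefix_of bits y (length t) = prefix_of bits x (length t)" using x that by simp
    then have "prefix_of bits y (length s) = prefix_of bits x (length s)"
      using assms by (simp add: prefix_of_eq_iff)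
    then show ?thesis using x by simp
  qed
  then show ?thesis by (auto simp: cylinder_def)
qed simp

abbreviation cylinders :: "('x \<Rightarrow> nat \<Rightarrow> bool) \<Rightarrow> 'x set set" where
  "cylinders bits \<equiv> insert {} (range (cylinder bits))"

lemma Int_stable_cylinders: "Int_stable (cylinders bits)"
proof -
  have "cylinder bits s \<inter> cylinder bits t \<in> cylinders bits" for s t
    using cylinder_Int[of s t bits] cylinder_Int[of t s bits]
    by (cases "length s \<le> length t") (auto simp: Int_commute)
  then show ?thesis by (auto simp: Int_stable_def)
qed

text \<open>The interval \<open>[0, w [])\<close> is subdivided into an interval of length \<open>w s\<close> for every prefix \<open>s\<close>
  (the latest bit is the head of \<open>s\<close>), with the interval of \<open>False # s\<close> to the left of that of
  \<open>True # s\<close>. The measure with cylinder weights \<open>w\<close> is the image of Lebesgue measure under the map from a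
  point to the bits of the intervals around it.\<close>

fun interval_start :: "(bool list \<Rightarrow> real) \<Rightarrow> bool list \<Rightarrow> real" where
  "interval_start w [] = 0"
| "interval_start w (b # s) = interval_start w s + (if b then w (False # s) else 0)"

fun expansion :: "(bool list \<Rightarrow> real) \<Rightarrow> real \<Rightarrow> nat \<Rightarrow> bool list" where
  "expansion w t 0 = []"
| "expansion w t (Suc n) =
    (interval_start w (expansion w t n) + w (False # expansion w t n) \<le> t) # expansion w t n"

lemma cylinder_measure_exists:
  fixes bits :: "'x \<Rightarrow> nat \<Rightarrow> bool"
  assumes surj: "surj bits" and nonneg: "\<And>s. 0 \<le> w s"
    and split: "\<And>s. w s = w (False # s) + w (True # s)"
  shows "\<exists>M. sets M = sigma_sets UNIV (cylinders bits) \<and> finite_measure M \<and>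
    (\<forall>s. measure M (cylinder bits s) = w s)"
proof -
  \<comment> \<open>Cylinders see only the bits of a point, so any point with the right bits will
    do; surjectivity provides one.\<close>
  define h where "h t = inv bits (\<lambda>n. hd (expansion w t (Suc n)))" for t
  have bits_h: "bits (h t) n = hd (expansion w t (Suc n))" for t n
    by (simp add: h_def surj_f_inv_f[OF surj])
  have prefix_h: "prefix_of bits (h t) n = expansion w t n" for t n
    by (induction n) (auto simp: bits_h)
  define I where "I s = {interval_start w s ..< interval_start w s + w s}" for s
  \<comment> \<open>Half-open intervals, empty when the weight is 0, partition
    \<open>{0..<w []}\<close> exactly at every level.\<close>
  have I: "{t \<in> {0..<w []}. expansion w t (length s) = s} = I s" for s
  proof (induction s)
    case (Cons b s)
    have "{t \<in> {0..<w []}. expansion w t (length (b # s)) = b # s}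
      = {t \<in> I s. (interval_start w s + w (False # s) \<le> t) = b}"
      unfolding Cons.IH[symmetric] by auto
    also have "\<dots> = I (b # s)"
      using split[of s] nonneg[of "False # s"] nonneg[of "True # s"] by (cases b) (auto simp: I_def)
    finally show ?case .
  qed (auto simp: I_def)
  have I_sub: "I s \<subseteq> {0..<w []}" for s unfolding I[symmetric] by blast
  define L where "L = restrict_space lborel {0..<w []}"
  have vimage: "h -` cylinder bits s \<inter> space L = I s" for s
    unfolding I[symmetric] by (auto simp: cylinder_def prefix_h L_def space_restrict_space)
  have meas: "h \<in> measurable L (sigma UNIV (cylinders bits))"
  proof (rule measurable_measure_of)
    fix A assume "A \<in> cylinders bits"
    then show "h -` A \<inter> space L \<in> sets L"
      using I_sub by (auto simp: vimage) (auto simp: L_def sets_restrict_space_iff I_def)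
  qed auto
  define M where "M = distr L (sigma UNIV (cylinders bits)) h"
  have L: "finite_measure L"
    unfolding L_def using nonneg[of "[]"] by (intro finite_measureI) (simp add: space_restrict_space emeasure_restrict_space)
  show ?thesis
  proof (intro exI conjI allI)
    show "sets M = sigma_sets UNIV (cylinders bits)" by (simp add: M_def sets_measure_of)
    show "finite_measure M" unfolding M_def using L meas by (rule finite_measure.finite_measure_distr)
    fix s
    have "cylinder bits s \<in> sets (sigma UNIV (cylinders bits))" by (auto simp: sets_measure_of)
    then have "measure M (cylinder bits s) = measure L (I s)"
      unfolding M_def by (subst measure_distr[OF meas]) (auto simp: vimage)
    also have "\<dots> = measure lborel (I s)"
      unfolding L_def using I_sub[of s] by (intro measure_restrict_space) auto
    also have "\<dots> = w s" using nonneg[of s] by (simp add: I_def)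
    finally show "measure M (cylinder bits s) = w s" .
  qed
qed

text \<open>The spectral projection that the joint measure must give to the cylinder of a prefix; an
  absent bit contributes the complementary projection.\<close>

fun prefix_projection :: "(nat \<Rightarrow> 'h \<Rightarrow> 'h) \<Rightarrow> bool list \<Rightarrow> 'h \<Rightarrow> 'h::complex_hilbert_space" where
  "prefix_projection p [] u = u"
| "prefix_projection p (b # s) u =
    (if b then p (length s) (prefix_projection p s u)
     else prefix_projection p s u - p (length s) (prefix_projection p s u))"

text \<open>For fixed \<open>u\<close> the squared norms of the prefix projections of
  \<open>u\<close> are consistent cylinder weights, since a projection and its complement split the
  squared norm. The measures with these weights are the quadratic forms of the spectral measure
  sought.\<close>

lemma spectral_measure_of_commuting_projections:
  fixes bits :: "'x \<Rightarrow> nat \<Rightarrow> bool" and p :: "nat \<Rightarrow> 'h \<Rightarrow> 'h::complex_hilbert_space"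
  assumes surj: "surj bits" and p: "\<And>n. orthogonal_projection (p n)"
    and comm: "\<And>m n u. p m (p n u) = p n (p m u)"
  shows "\<exists>M E. spectral_measure M E \<and> space M = UNIV \<and>
    (\<forall>n. {x. bits x n} \<in> sets M) \<and> (\<forall>n. E {x. bits x n} = p n)"
proof -
  let ?P = "prefix_projection p"
  note lin = orthogonal_projectionD(1)[OF p]
  have comm_P: "p m (?P s u) = ?P s (p m u)" for m s u
  proof (induction s)
    case (Cons b s)
    then show ?case by (simp add: comm[of m "length s"] bounded_clinearD(5)[OF lin])
  qed simp
  have P: "orthogonal_projection (?P s)" for s
  proof (induction s)
    case (Cons b s)
    have "orthogonal_projection (\<lambda>u. p (length s) (?P s u))"
      by (intro projection_compose[OF p Cons] comm_P)
    moreover have "orthogonal_projection (\<lambda>u. ?P s u - p (length s) (?P s u))"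
    proof (rule projection_compose[OF projection_complement[OF p] Cons])
      show "?P s u - p (length s) (?P s u) = ?P s (u - p (length s) u)" for u
        by (simp only: comm_P bounded_clinearD(5)[OF orthogonal_projectionD(1)[OF Cons]])
    qed
    ultimately show ?case by (cases b) simp_all
  qed (simp add: projection_id)
  let ?w = "\<lambda>u s. (norm (?P s u))\<^sup>2"
  have split: "?w u s = ?w u (False # s) + ?w u (True # s)" for u s
    using norm_projection_split[OF p[of "length s"], of "?P s u"] by simp
  have "\<forall>u. \<exists>M. sets M = sigma_sets UNIV (cylinders bits) \<and> finite_measure M \<and>
      (\<forall>s. measure M (cylinder bits s) = ?w u s)"
  proof (intro allI cylinder_measure_exists surj)
    show "0 \<le> ?w u s" for u s by simp
    show "?w u s = ?w u (False # s) + ?w u (True # s)" for u s by (rule split)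
  qed
  then obtain \<mu> where \<mu>: "\<And>u. sets (\<mu> u) = sigma_sets UNIV (cylinders bits)"
    "\<And>u. finite_measure (\<mu> u)" "\<And>u s. measure (\<mu> u) (cylinder bits s) = ?w u s"
    by metis
  have cyl_Nil: "cylinder bits [] = UNIV" by (auto simp: cylinder_def)
  have tot: "measure (\<mu> u) UNIV = (norm u)\<^sup>2" for u
    using \<mu>(3)[of u "[]"] by (simp add: cyl_Nil)
  have base: "\<exists>Q. orthogonal_projection Q \<and> (\<forall>u. measure (\<mu> u) A = (norm (Q u))\<^sup>2)"
    if A: "A \<in> cylinders bits" for A
  proof (cases "A = {}")
    case True
    then show ?thesis using projection_zero by (intro exI[of _ "\<lambda>u. 0"]) auto
  next
    case False
    with A obtain s where "A = cylinder bits s" by blast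
    then show ?thesis using P[of s] \<mu>(3) by blast
  qed
  have sub: "cylinders bits \<subseteq> Pow UNIV" by simp
  obtain E where E: "spectral_measure (sigma UNIV (cylinders bits)) E"
    "\<And>A u. A \<in> sigma_sets UNIV (cylinders bits) \<Longrightarrow> measure (\<mu> u) A = (norm (E A u))\<^sup>2"
    using projection_valued_extension[OF sub Int_stable_cylinders \<mu>(1,2) tot base] by metis
  have cyl: "cylinder bits s \<in> sigma_sets UNIV (cylinders bits)" for s by auto
  have fin: "finite {s :: bool list. length s = n}" for n
    using finite_lists_length_eq[of "UNIV :: bool set" n] by simp
  \<comment> \<open>Bit \<open>n\<close> is the head of the prefixes of length \<open>n + 1\<close>,
    so this set is a finite union of cylinders.\<close>
  have bit: "{x. bits x n} = (\<Union>s\<in>{s. length s = n}. cylinder bits (True # s))" for n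
    by (auto simp: cylinder_def)
  have all: "UNIV = (\<Union>s\<in>{s. length s = n}. cylinder bits s)" for n
    by (auto simp: cylinder_def)
  have disj: "disjoint_family_on (\<lambda>s. cylinder bits (True # s)) {s. length s = n}"
    "disjoint_family_on (cylinder bits) {s. length s = n}" for n
    by (auto simp: disjoint_family_on_def cylinder_def)
  have meas: "{x. bits x n} \<in> sigma_sets UNIV (cylinders bits)" for n
    unfolding bit
    using sigma_algebra.countable_UN'[OF sigma_algebra_sigma_sets[OF sub], of "{s. length s = n}"]
      fin[of n] cyl by (auto intro!: sigma_algebra.countable_UN'' sigma_algebra_sigma_sets countable_finite)
  have "E {x. bits x n} = p n" for n
  proof (rule projection_eqI[OF _ p])
    show "orthogonal_projection (E {x. bits x n})"
      using E(1) meas[of n] unfolding spectral_measure_def by (simp add: sets_measure_of)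
    fix u
    have "(norm (E {x. bits x n} u))\<^sup>2 = measure (\<mu> u) {x. bits x n}" using E(2)[OF meas] by simp
    also have "\<dots> = (\<Sum>s | length s = n. measure (\<mu> u) (cylinder bits (True # s)))"
      unfolding bit using fin[of n] \<mu>(2)[of u] cyl disj
      by (intro finite_measure.finite_measure_finite_Union) (simp_all add: \<mu>(1) image_subset_iff)
    \<comment> \<open>Commutation moves \<open>p n\<close> to the vector: the prefix
      \<open>True # s\<close> has the same weight at \<open>u\<close> as \<open>s\<close> has at
      \<open>p n u\<close>. Summing over all \<open>s\<close> of length \<open>n\<close> gives the
      total mass at \<open>p n u\<close>.\<close>
    also have "\<dots> = (\<Sum>s | length s = n. measure (\<mu> (p n u)) (cylinder bits s))"
      by (intro sum.cong) (auto simp: \<mu>(3) comm_P)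
    also have "\<dots> = measure (\<mu> (p n u)) UNIV"
      unfolding all[of n] using fin[of n] \<mu>(2)[of "p n u"] cyl disj
      by (intro finite_measure.finite_measure_finite_Union[symmetric]) (simp_all add: \<mu>(1) image_subset_iff)
    finally show "norm (E {x. bits x n} u) = norm (p n u)"
      by (simp add: tot power2_eq_iff_nonneg)
  qed
  with E(1) meas show ?thesis
    by (intro exI[of _ "sigma UNIV (cylinders bits)"] exI[of _ E]) (auto simp: sets_measure_of)
qed

section \<open>Spectral measures and spectral integrals\<close>

lemma spectral_measureD:
  assumes "spectral_measure M E"
  shows "A \<in> sets M \<Longrightarrow> orthogonal_projection (E A)" and "E (space M) = id"
    and "range F \<subseteq> sets M \<Longrightarrow> disjoint_family F \<Longrightarrow> (\<lambda>n. E (F n) u) sums E (\<Union>n. F n) u"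
  using assms by (auto simp: spectral_measure_def)

context
  fixes M :: "'x measure" and E :: "'x set \<Rightarrow> 'h \<Rightarrow> 'h::complex_hilbert_space"
  assumes sm: "spectral_measure M E"
begin

text \<open>Additivity for the constantly empty family: a convergent series with constant terms has
  zero terms.\<close>

lemma spectral_measure_empty: "E {} u = 0"
proof -
  have "(\<lambda>n::nat. E {} u) sums E {} u"
    using spectral_measureD(3)[OF sm, of "\<lambda>n. {}" u] by (simp add: disjoint_family_on_def)
  then have "(\<lambda>n::nat. E {} u) \<longlonglongrightarrow> 0" by (intro summable_LIMSEQ_zero sums_summable)
  then show ?thesis by (simp add: LIMSEQ_const_iff)
qed

lemma spectral_measure_Un:
  assumes A: "A \<in> sets M" and B: "B \<in> sets M" and disj: "A \<inter> B = {}"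
  shows "E (A \<union> B) u = E A u + E B u"
proof -
  have "disjoint_family (binaryset A B)"
    using disj by (auto simp: disjoint_family_on_def binaryset_def)
  then have "(\<lambda>n. E (binaryset A B n) u) sums E (A \<union> B) u"
    using spectral_measureD(3)[OF sm, of "binaryset A B" u] A B
    by (simp add: range_binaryset_eq UN_binaryset_eq)
  moreover have "(\<lambda>n. E (binaryset A B n) u) sums (\<Sum>n\<in>{0, Suc 0}. E (binaryset A B n) u)"
    by (rule sums_finite) (auto simp: binaryset_def spectral_measure_empty)
  ultimately show ?thesis using sums_unique2 by (fastforce simp: binaryset_def)
qed

lemma spectral_measure_Compl:
  assumes A: "A \<in> sets M"
  shows "E (space M - A) u = u - E A u"
  using spectral_measure_Un[OF A, of "space M - A" u] A spectral_measureD(2)[OF sm]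
    sets.sets_into_space[OF A]
  by (simp add: Un_absorb1 algebra_simps)

lemma spectral_measure_disjoint:
  assumes A: "A \<in> sets M" and B: "B \<in> sets M" and disj: "A \<inter> B = {}"
  shows "E A (E B u) = 0"
proof -
  note op = spectral_measureD(1)[OF sm]
  have AB: "A \<union> B \<in> sets M" using A B by simp
  have le: "(norm (E A u))\<^sup>2 + (norm (E B u))\<^sup>2 \<le> (norm u)\<^sup>2" for u
  proof -
    have "cinner (E (A \<union> B) u) u = cinner (E A u) u + cinner (E B u) u"
      by (simp only: spectral_measure_Un[OF A B disj] cinner_add_left)
    then have "complex_of_real ((norm (E (A \<union> B) u))\<^sup>2) = complex_of_real ((norm (E A u))\<^sup>2 + (norm (E B u))\<^sup>2)"
      by (simp only: of_real_add cinner_projection[OF op[OF A]] cinner_projection[OF op[OF B]]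
          cinner_projection[OF op[OF AB]])
    then have "(norm (E A u))\<^sup>2 + (norm (E B u))\<^sup>2 = (norm (E (A \<union> B) u))\<^sup>2"
      by (simp only: of_real_eq_iff)
    also have "\<dots> \<le> (norm u)\<^sup>2"
      by (intro power_mono norm_projection_le op AB) auto
    finally show ?thesis .
  qed
  show ?thesis by (rule projection_mult_zero[OF op[OF A] op[OF B] le])
qed

text \<open>The definition demands additivity only. Multiplicativity follows by cutting both sets
  along their intersection, because disjoint sets have orthogonal projections.\<close>

lemma spectral_measure_Int:
  assumes A: "A \<in> sets M" and B: "B \<in> sets M"
  shows "E (A \<inter> B) u = E A (E B u)"
proof -
  note op = spectral_measureD(1)[OF sm]
  have AB: "A \<inter> B \<in> sets M" and AD: "A - B \<in> sets M" and BD: "B - A \<in> sets M" using A B by auto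
  have 1: "E A v = E (A \<inter> B) v + E (A - B) v" for v
    using spectral_measure_Un[OF AB AD, of v] by (simp add: Int_Diff_Un Int_Diff_disjoint)
  have 2: "E B v = E (A \<inter> B) v + E (B - A) v" for v
    using spectral_measure_Un[OF AB BD, of v] by (simp add: Int_commute[of A] Int_Diff_Un Int_Diff_disjoint)
  have "E A (E B u) = E A (E (A \<inter> B) u) + E A (E (B - A) u)"
    using bounded_clinearD(4)[OF orthogonal_projectionD(1)[OF op[OF A]]] 2 by simp
  also have "E A (E (B - A) u) = 0" by (intro spectral_measure_disjoint A BD) auto
  also have "E A (E (A \<inter> B) u) = E (A \<inter> B) u"
    using 1[of "E (A \<inter> B) u"] spectral_measure_disjoint[OF AD AB, of u]
      orthogonal_projectionD(2)[OF op[OF AB]] by auto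
  finally show ?thesis by simp
qed

end

context
  fixes M :: "'x measure" and E :: "'x set \<Rightarrow> 'h \<Rightarrow> 'h::complex_hilbert_space"
  assumes sm: "spectral_measure M E"
begin

lemma space_scalar_spectral_measure [simp]: "space (scalar_spectral_measure M E u) = space M"
  by (simp add: scalar_spectral_measure_def space_measure_of_conv)

lemma sets_scalar_spectral_measure [simp]: "sets (scalar_spectral_measure M E u) = sets M"
  unfolding scalar_spectral_measure_def by (simp add: sets.space_closed sets_measure_of sets.sigma_sets_eq)

lemma emeasure_scalar_spectral_measure:
  assumes A: "A \<in> sets M"
  shows "emeasure (scalar_spectral_measure M E u) A = ennreal ((norm (E A u))\<^sup>2)"
proof -
  have form: "Re (cinner (E A u) u) = (norm (E A u))\<^sup>2" if "A \<in> sets M" for A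
    by (simp only: cinner_projection[OF spectral_measureD(1)[OF sm that]] Re_complex_of_real)
  have "emeasure (scalar_spectral_measure M E u) A = ennreal (Re (cinner (E A u) u))"
    \<comment> \<open>\<open>measure_of\<close> takes the prescribed values only if they are
      countably additive, so additivity is first carried over from vectors to the quadratic
      form.\<close>
    unfolding scalar_spectral_measure_def
  proof (rule emeasure_measure_of_sigma)
    show "sigma_algebra (space M) (sets M)" by (rule sets.sigma_algebra_axioms)
    show "positive (sets M) (\<lambda>A. ennreal (Re (cinner (E A u) u)))"
      by (simp add: positive_def spectral_measure_empty[OF sm])
    show "countably_additive (sets M) (\<lambda>A. ennreal (Re (cinner (E A u) u)))"
    proof (rule countably_additiveI)
      fix F :: "nat \<Rightarrow> 'x set"
      assume F: "range F \<subseteq> sets M" "disjoint_family F" "(\<Union>n. F n) \<in> sets M"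
      have "(\<lambda>n. cinner (E (F n) u) u) sums cinner (E (\<Union>n. F n) u) u"
        by (rule bounded_linear.sums[OF bounded_linear_cinner_left spectral_measureD(3)[OF sm F(1,2)]])
      then have *: "(\<lambda>n. Re (cinner (E (F n) u) u)) sums Re (cinner (E (\<Union>n. F n) u) u)"
        by (rule sums_Re)
      have "0 \<le> Re (cinner (E (F n) u) u)" for n
        using form[of "F n"] F(1) by auto
      then show "(\<Sum>n. ennreal (Re (cinner (E (F n) u) u))) = ennreal (Re (cinner (E (\<Union>n. F n) u) u))"
        using * by (subst suminf_ennreal2) (auto simp: sums_iff)
    qed
  qed (rule A)
  with form[OF A] show ?thesis by simp
qed

text \<open>Two values cover every coefficient that occurs: indicators, signs and, with the empty
  set, constants.\<close>

lemma spectral_integral_two_valued: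
  assumes A: "A \<in> sets M"
  shows "spectral_integral M E (\<lambda>x. if x \<in> A then c else d)
    = (\<lambda>u. scaleC c (E A u) + scaleC d (u - E A u))"
proof -
  note op = spectral_measureD(1)[OF sm A]
  let ?f = "\<lambda>x. if x \<in> A then c else d"
  let ?T = "\<lambda>u. scaleC c (E A u) + scaleC d (u - E A u)"
  have CA: "space M - A \<in> sets M" using A by simp
  have bcl: "bounded_clinear ?T"
    by (intro bounded_clinear_add bounded_clinear_scaleC bounded_clinear_diff bounded_clinear_id
        orthogonal_projectionD(1) op)
  have int: "has_bochner_integral (scalar_spectral_measure M E u) ?f (cinner (?T u) u)" for u
  proof -
    let ?\<mu> = "scalar_spectral_measure M E u"
    have m: "measure ?\<mu> A = (norm (E A u))\<^sup>2" "measure ?\<mu> (space M - A) = (norm (u - E A u))\<^sup>2"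
      using emeasure_scalar_spectral_measure[OF A, of u] emeasure_scalar_spectral_measure[OF CA, of u]
      by (simp_all add: measure_def spectral_measure_Compl[OF sm A])
    have "has_bochner_integral ?\<mu> (\<lambda>x. indicator A x *\<^sub>R c + indicator (space M - A) x *\<^sub>R d)
      (measure ?\<mu> A *\<^sub>R c + measure ?\<mu> (space M - A) *\<^sub>R d)"
      using A CA by (intro has_bochner_integral_add has_bochner_integral_indicator)
        (simp_all add: emeasure_scalar_spectral_measure)
    also have "measure ?\<mu> A *\<^sub>R c + measure ?\<mu> (space M - A) *\<^sub>R d = cinner (?T u) u"
      using cinner_projection[OF op, of u] cinner_projection[OF projection_complement[OF op], of u]
      by (simp add: m cinner_add_left cinner_scaleC_left scaleR_conv_of_real mult.commute)
    finally show ?thesis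
      by (rule has_bochner_integral_cong[THEN iffD1, rotated 3]) (auto simp: indicator_def)
  qed
  have "has_spectral_integral M E ?f ?T"
    unfolding has_spectral_integral_def using bcl int
    by (auto simp: has_bochner_integral_iff)
  moreover have "B = ?T" if "has_spectral_integral M E ?f B" for B
    using that int bcl unfolding has_spectral_integral_def
    by (intro bounded_clinear_eqI) (auto simp: has_bochner_integral_iff)
  ultimately show ?thesis unfolding spectral_integral_def by (rule the_equality)
qed

lemma spectral_integral_const:
  "spectral_integral M E (\<lambda>x. c) = (\<lambda>u. scaleC c u)"
  using spectral_integral_two_valued[of "{}" 0 c] by (simp add: spectral_measure_empty[OF sm])

end

section \<open>Commuting reflections of a basis\<close>

text \<open>If \<open>e\<close> is thought of as the Walsh basis of \<open>L\<^sup>2\<close> of the coin tossing space, this is the multiplication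
  by the \<open>n\<close>-th Rademacher function, and \<open>e 0\<close> is the constant function.\<close>

definition reflection :: "(nat \<Rightarrow> 'h::complex_hilbert_space) \<Rightarrow> nat \<Rightarrow> 'h \<Rightarrow> 'h" where
  "reflection e n = diagop (\<lambda>_. 1) e (\<lambda>k. e (flip_bit n k))"

lemma flip_bit_flip_bit: "flip_bit n (flip_bit n k) = (k::nat)"
  by (rule bit_eqI) (auto simp: bit_simps)

lemma flip_bit_commute: "flip_bit m (flip_bit n k) = flip_bit n (flip_bit m (k::nat))"
  by (rule bit_eqI) (auto simp: bit_simps)

lemma inj_flip_bit: "inj (flip_bit n :: nat \<Rightarrow> nat)"
  by (metis flip_bit_flip_bit injI)

context
  fixes e :: "nat \<Rightarrow> 'h::complex_hilbert_space"
  assumes e: "onbasis e"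
begin

lemmas reflection_families = onbasis_ortho_family'[OF e] onbasis_ortho_family[OF e inj_flip_bit]

lemma bounded_clinear_reflection: "bounded_clinear (reflection e n)"
  unfolding reflection_def by (rule bounded_clinear_diagop[where C = 1]) (simp_all add: reflection_families)

lemma cinner_reflection: "cinner (reflection e n u) (e k) = cinner u (e (flip_bit n k))"
  using cinner_diagop[OF reflection_families, of "\<lambda>_. 1" 1 n u "flip_bit n k"]
  by (simp add: reflection_def flip_bit_flip_bit onbasis_cinner[OF e])

lemma reflection_basis: "reflection e n (e k) = e (flip_bit n k)"
  using diagop_apply[OF reflection_families, of "\<lambda>_. 1" 1 n k]
  by (simp add: reflection_def onbasis_cinner[OF e])

lemma reflection_reflection: "reflection e n (reflection e n u) = u"
  by (rule onbasis_eqI[OF e]) (simp add: cinner_reflection flip_bit_flip_bit)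

lemma reflection_commute: "reflection e m (reflection e n u) = reflection e n (reflection e m u)"
  by (rule onbasis_eqI[OF e]) (simp add: cinner_reflection flip_bit_commute)

lemma cinner_reflection_left: "cinner (reflection e n u) v = cinner u (reflection e n v)"
proof -
  have *: "cinner (e k) (reflection e n v) = cinner (e (flip_bit n k)) v" for k
    using cinner_reflection[of n v k] by (metis cinner_commute)
  have "(\<lambda>k. cinner u (e k) * cinner (e (flip_bit n k)) v) sums cinner (reflection e n u) v"
    using diagop_cinner_sums[OF reflection_families, of "\<lambda>_. 1" 1 u n v] by (simp add: reflection_def)
  \<comment> \<open>Parseval's identity, obtained from the identity written as a diagonal operator;
    by \<open>*\<close> the two series have the same terms.\<close>
  moreover have "(\<lambda>k. cinner u (e k) * cinner (e k) (reflection e n v)) sums cinner u (reflection e n v)"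
    using diagop_cinner_sums[OF reflection_families(1) reflection_families(1), of "\<lambda>_. 1" 1 u "reflection e n v"]
    by (simp add: onbasis_diagop_1[OF e])
  ultimately show ?thesis unfolding * by (rule sums_unique2)
qed

text \<open>The projection onto the vectors fixed by the reflection. It turns commuting reflections
  into commuting projections.\<close>

definition reflection_projection :: "nat \<Rightarrow> 'h \<Rightarrow> 'h" where
  "reflection_projection n u = scaleC (1 / 2) (u + reflection e n u)"

lemma half_plus_half: "scaleC (1 / 2) (u + u) = (u::'h)"
  using scaleC_add_left[of "1/2" "1/2" u] by (simp add: scaleC_add_right)

lemma projection_reflection_projection: "orthogonal_projection (reflection_projection n)"
proof (rule orthogonal_projectionI)
  note lin = bounded_clinearD[OF bounded_clinear_reflection]
  show "bounded_clinear (reflection_projection n)"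
    unfolding reflection_projection_def
    by (intro bounded_clinear_scaleC bounded_clinear_add bounded_clinear_id bounded_clinear_reflection)
  show "reflection_projection n (reflection_projection n u) = reflection_projection n u" for u
    unfolding reflection_projection_def
    by (simp add: lin(2,4) reflection_reflection add.commute half_plus_half)
  show "cinner (reflection_projection n u) v = cinner u (reflection_projection n v)" for u v
    by (simp add: reflection_projection_def cinner_scaleC_left cinner_scaleC_right cinner_add_left
        cinner_add_right cinner_reflection_left)
qed

lemma reflection_projection_commute:
  "reflection_projection m (reflection_projection n u) = reflection_projection n (reflection_projection m u)"
proof -
  note lin = bounded_clinearD[OF bounded_clinear_reflection]
  show ?thesis
    by (simp add: reflection_projection_def lin(2,4) scaleC_add_right reflection_commute[of m n] add_ac)
qed

text \<open>The left side has the shape of \<open>spectral_integral_two_valued\<close> for a sign,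
  which makes the reflection a spectral integral.\<close>

lemma reflection_projection_diff:
  "scaleC 1 (reflection_projection n u) + scaleC (-1) (u - reflection_projection n u) = reflection e n u"
proof -
  have "reflection_projection n u + reflection_projection n u = u + reflection e n u"
    using half_plus_half[of "u + reflection e n u"]
    by (simp add: reflection_projection_def scaleC_add_right)
  then show ?thesis by (simp add: algebra_simps)
qed

definition basis_projection :: "nat \<Rightarrow> 'h \<Rightarrow> 'h" where
  "basis_projection n u = scaleC (cinner u (e n)) (e n)"

lemma basis_projection_mult:
  "basis_projection m (basis_projection n u) = (if m = n then basis_projection n u else 0)"
  by (simp add: basis_projection_def cinner_scaleC_left onbasis_cinner[OF e])

lemma projection_basis_projection: "orthogonal_projection (basis_projection n)"
proof (rule orthogonal_projectionI)
  show "bounded_clinear (basis_projection n)"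
  proof (rule bounded_clinearI[where K = 1])
    show "norm (basis_projection n u) \<le> norm u * 1" for u
      using cmod_cinner_le[of u "e n"] by (simp add: basis_projection_def norm_scaleC onbasis_norm[OF e])
  qed (simp_all add: basis_projection_def cinner_add_left scaleC_add_left cinner_scaleC_left scaleC_scaleC)
  show "cinner (basis_projection n u) v = cinner u (basis_projection n v)" for u v
    using cinner_commute[of v "e n"]
    by (simp add: basis_projection_def cinner_scaleC_left cinner_scaleC_right)
qed (simp add: basis_projection_mult)

end

section \<open>Multiple operator integrals with diagonal coefficients\<close>

text \<open>The restriction is needed because the elements of \<open>rectangle\<close> are
  extensional functions.\<close>

definition diagonal_index :: "nat \<Rightarrow> nat \<Rightarrow> nat \<Rightarrow> nat" where
  "diagonal_index m k = restrict (\<lambda>_. k) {1..<m}"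

lemma eq_diagonal_index:
  assumes j: "j \<in> extensional {1..<m}" and step: "\<And>i. i \<in> {2..m - 1} \<Longrightarrow> j (i - 1) = j i"
  shows "j = diagonal_index m (j 1)"
proof (rule extensionalityI[OF j])
  show "diagonal_index m (j 1) \<in> extensional {1..<m}" by (simp add: diagonal_index_def)
  have "1 \<le> i \<Longrightarrow> i < m \<Longrightarrow> j i = j 1" for i
  proof (induction i rule: nat_induct_at_least)
    case (Suc i)
    have "j (Suc i - 1) = j (Suc i)" by (rule step) (use Suc in auto)
    with Suc show ?case by simp
  qed simp
  then show "j i = diagonal_index m (j 1) i" if "i \<in> {1..<m}" for i
    unfolding diagonal_index_def using that by (metis atLeastLessThan_iff restrict_apply')
qed

text \<open>The diagonal index of \<open>k\<close> lies in the rectangle exactly if \<open>k\<close>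
  is at most the smallest upper limit. Hence the limit along \<open>limits_at_top\<close> reduces to
  the sum of an ordinary series.\<close>

lemma sum_rectangle_diagonal:
  fixes F :: "(nat \<Rightarrow> nat) \<Rightarrow> 'a::comm_monoid_add"
  assumes m: "2 \<le> m"
    and F: "\<And>j i. i \<in> {2..m - 1} \<Longrightarrow> j (i - 1) \<noteq> j i \<Longrightarrow> F j = 0"
  shows "(\<Sum>j\<in>rectangle m n. F j) = (\<Sum>k\<le>Min (n ` {1..<m}). F (diagonal_index m k))"
proof -
  have "diagonal_index m k 1 = k" for k using m by (simp add: diagonal_index_def)
  then have inj: "inj_on (diagonal_index m) A" for A by (metis inj_onI)
  have sub: "diagonal_index m ` {..Min (n ` {1..<m})} \<subseteq> rectangle m n"
    using m by (auto simp: diagonal_index_def rectangle_def)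
  have "F j = 0" if j: "j \<in> rectangle m n - diagonal_index m ` {..Min (n ` {1..<m})}" for j
  proof (rule ccontr)
    assume Fj: "F j \<noteq> 0"
    have *: "j = diagonal_index m (j 1)"
    proof (rule eq_diagonal_index)
      show "j \<in> extensional {1..<m}" using j by (simp add: rectangle_def PiE_def)
      show "j (i - 1) = j i" if "i \<in> {2..m - 1}" for i
        using F[OF that, of j] Fj by blast
    qed
    have "j 1 \<le> n i" if "i \<in> {1..<m}" for i
    proof -
      have "j i = j 1" using fun_cong[OF *, of i] that by (simp add: diagonal_index_def)
      moreover have "j i \<in> {..n i}" using j that by (auto simp: rectangle_def dest: PiE_mem)
      ultimately show ?thesis by simp
    qed
    then have "j 1 \<le> Min (n ` {1..<m})" using m by (subst Min_ge_iff) auto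
    then have "j \<in> diagonal_index m ` {..Min (n ` {1..<m})}" by (subst *) simp
    with j show False by blast
  qed
  then have "(\<Sum>j\<in>rectangle m n. F j) = (\<Sum>j\<in>diagonal_index m ` {..Min (n ` {1..<m})}. F j)"
    using sub by (intro sum.mono_neutral_right) (auto simp: rectangle_def intro!: finite_PiE)
  also have "\<dots> = (\<Sum>k\<le>Min (n ` {1..<m}). F (diagonal_index m k))"
    by (subst sum.reindex[OF inj]) simp
  finally show ?thesis .
qed

lemma tendsto_rectangle_diagonal:
  fixes F :: "(nat \<Rightarrow> nat) \<Rightarrow> 'a::real_normed_vector"
  assumes m: "2 \<le> m"
    and F: "\<And>j i. i \<in> {2..m - 1} \<Longrightarrow> j (i - 1) \<noteq> j i \<Longrightarrow> F j = 0"
    and sums: "(\<lambda>k. F (diagonal_index m k)) sums s"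
  shows "((\<lambda>n. \<Sum>j\<in>rectangle m n. F j) \<longlongrightarrow> s) (limits_at_top m)"
proof -
  have "(\<lambda>N. \<Sum>k\<le>N. F (diagonal_index m k)) \<longlonglongrightarrow> s"
    using sums by (simp add: sums_def_le)
  moreover have "(\<Sum>j\<in>rectangle m n. F j) = (\<Sum>k\<le>Min (n ` {1..<m}). F (diagonal_index m k))" for n
    by (rule sum_rectangle_diagonal[OF m F])
  ultimately show ?thesis
    unfolding limits_at_top_def
    by (simp only:) (rule filterlim_compose[OF _ filterlim_filtercomap])
qed

section \<open>Coefficient functions for diagonal sums\<close>

lemma ell2_norm_scalar:
  assumes "\<And>j. cmod (s j) \<le> 1" "c \<in> ell2"
  shows "(\<lambda>j. s j * c j) \<in> ell2" and "ell2_norm (\<lambda>j. s j * c j) \<le> ell2_norm c"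
proof -
  have le: "(cmod (s j * c j))\<^sup>2 \<le> (cmod (c j))\<^sup>2" for j
    using assms(1)[of j] by (intro power_mono) (auto simp: norm_mult mult_left_le_one_le)
  have c: "summable (\<lambda>j. (cmod (c j))\<^sup>2)" using assms(2) by (simp add: ell2_def)
  have sc: "summable (\<lambda>j. (cmod (s j * c j))\<^sup>2)"
    by (rule summable_comparison_test[OF _ c]) (use le in auto)
  show "(\<lambda>j. s j * c j) \<in> ell2" using sc by (simp add: ell2_def)
  show "ell2_norm (\<lambda>j. s j * c j) \<le> ell2_norm c"
    unfolding ell2_norm_def by (intro real_sqrt_le_mono suminf_le le sc c)
qed

lemma matrix_norm_le_diagonal:
  assumes s: "\<And>j. cmod (s j) \<le> 1"
  shows "matrix_norm_le (\<lambda>j k. if j = k then s j else 0) 1"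
proof -
  have sums: "(\<lambda>k. (if j = k then s j else 0) * c k) sums (s j * c j)" for j and c :: "nat \<Rightarrow> complex"
    using sums_finite[of "{j}" "\<lambda>k. (if j = k then s j else 0) * c k"] by simp
  have eq: "(\<Sum>k. (if j = k then s j else 0) * c k) = s j * c j" for j and c :: "nat \<Rightarrow> complex"
    using sums[of j c] by (simp add: sums_iff)
  show ?thesis
    unfolding matrix_norm_le_def eq using ell2_norm_scalar[of s, OF s] sums[THEN sums_summable] by auto
qed

lemma spectral_AE_I:
  assumes "spectral_measure M E" "\<And>x. P x"
  shows "spectral_AE M E P"
  unfolding spectral_AE_def
  using assms(2) by (intro bexI[of _ "{}"]) (auto simp: spectral_measure_empty[OF assms(1)])

text \<open>These sets are disjoint, and they agree almost everywhere with the sets \<open>{x. bits x k}\<close> if the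
  latter have mutually orthogonal spectral projections.\<close>

definition first_bit :: "('x \<Rightarrow> nat \<Rightarrow> bool) \<Rightarrow> nat \<Rightarrow> 'x set" where
  "first_bit bits k = {x. bits x k \<and> (\<forall>i<k. \<not> bits x i)}"

lemma first_bit_unique: "x \<in> first_bit bits j \<Longrightarrow> x \<in> first_bit bits k \<Longrightarrow> j = k"
  unfolding first_bit_def by (metis (mono_tags, lifting) linorder_neqE_nat mem_Collect_eq)

text \<open>Removing an earlier set multiplies \<open>p k\<close> by the complement of
  \<open>p n\<close>, which changes nothing because \<open>p n\<close> annihilates the range of
  \<open>p k\<close>.\<close>

lemma first_bit_spectral:
  assumes sm: "spectral_measure M E" and sp: "space M = UNIV"
    and meas: "\<And>n. {x. bits x n} \<in> sets M" and E: "\<And>n. E {x. bits x n} = p n"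
    and orth: "\<And>i k u. i \<noteq> k \<Longrightarrow> p i (p k u) = 0"
  shows "first_bit bits k \<in> sets M" and "E (first_bit bits k) = p k"
proof -
  have "n \<le> k \<Longrightarrow> {x. bits x k \<and> (\<forall>i<n. \<not> bits x i)} \<in> sets M \<and>
      E {x. bits x k \<and> (\<forall>i<n. \<not> bits x i)} = p k" for n
  proof (induction n)
    case (Suc n)
    let ?A = "{x. bits x k \<and> (\<forall>i<n. \<not> bits x i)}" and ?B = "{x. bits x n}"
    have A: "?A \<in> sets M" and EA: "E ?A = p k" using Suc by auto
    have B: "space M - ?B \<in> sets M" using meas[of n] by simp
    have eq: "{x. bits x k \<and> (\<forall>i<Suc n. \<not> bits x i)} = (space M - ?B) \<inter> ?A"
      by (auto simp: sp less_Suc_eq)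
    have "E ((space M - ?B) \<inter> ?A) u = p k u" for u
      using Suc.prems
      by (simp add: spectral_measure_Int[OF sm B A] spectral_measure_Compl[OF sm meas] EA E orth)
    then have "E ((space M - ?B) \<inter> ?A) = p k" by (rule ext)
    then show ?case unfolding eq using A B by blast
  qed (use meas E in auto)
  then show "first_bit bits k \<in> sets M" "E (first_bit bits k) = p k"
    unfolding first_bit_def by auto
qed

text \<open>Since the sets are disjoint, at most one coefficient is nonzero at each point.\<close>

lemma Linf_ell2_first_bit:
  assumes sm: "spectral_measure M E" and meas: "\<And>k. first_bit bits k \<in> sets M"
  shows "(\<lambda>j x. if x \<in> first_bit bits j then 1 else 0) \<in> Linf_ell2 M E"
proof -
  have "spectral_AE M E (\<lambda>x. (\<lambda>j. if x \<in> first_bit bits j then 1 else 0) \<in> ell2 \<and>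
      ell2_norm (\<lambda>j. if x \<in> first_bit bits j then 1 else 0) \<le> 1)"
  proof (rule spectral_AE_I[OF sm])
    fix x
    let ?c = "\<lambda>j. if x \<in> first_bit bits j then 1 else 0 :: complex"
    have "\<exists>s\<le>1. (\<lambda>j. (cmod (?c j))\<^sup>2) sums s"
    proof (cases "\<exists>k. x \<in> first_bit bits k")
      case True
      then obtain k where k: "x \<in> first_bit bits k" by blast
      have "(\<lambda>j. (cmod (?c j))\<^sup>2) sums (\<Sum>j\<in>{k}. (cmod (?c j))\<^sup>2)"
        by (intro sums_finite) (auto dest: first_bit_unique[OF k])
      then show ?thesis using k by (intro exI[of _ 1]) auto
    next
      case False
      then show ?thesis by (intro exI[of _ 0]) auto
    qed
    then show "?c \<in> ell2 \<and> ell2_norm ?c \<le> 1" by (auto simp: ell2_def ell2_norm_def sums_iff)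
  qed
  moreover have "(\<lambda>x. if x \<in> first_bit bits j then 1 else 0 :: complex) \<in> borel_measurable M" for j
    using meas[of j] by (intro measurable_If_set) auto
  ultimately show ?thesis
    unfolding Linf_ell2_def by blast
qed

section \<open>The operator product for one multi-index\<close>

lemma fold_compose_Suc:
  "2 \<le> n \<Longrightarrow> fold (\<lambda>i W. W \<circ> T (i - 1) \<circ> Z i) [2..<Suc n] W
    = fold (\<lambda>i W. W \<circ> T (i - 1) \<circ> Z i) [2..<n] W \<circ> T (n - 1) \<circ> Z n"
  by simp

text \<open>A zero produced by \<open>Z i\<close> still has to pass through all factors on its left,
  which is why each of them is required to fix 0.\<close>

lemma fold_compose_zero:
  fixes W :: "'h::complex_hilbert_space \<Rightarrow> 'h"
  assumes "W 0 = 0" and "\<And>i. 1 \<le> i \<Longrightarrow> i < n - 1 \<Longrightarrow> T i 0 = 0"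
    and "\<And>i. 2 \<le> i \<Longrightarrow> i < n \<Longrightarrow> Z i 0 = 0"
  shows "fold (\<lambda>i W. W \<circ> T (i - 1) \<circ> Z i) [2..<n] W 0 = 0"
    and "2 \<le> i \<Longrightarrow> i < n \<Longrightarrow> (\<And>u. Z i u = 0) \<Longrightarrow> fold (\<lambda>i W. W \<circ> T (i - 1) \<circ> Z i) [2..<n] W u = 0"
proof -
  let ?V = "\<lambda>n. fold (\<lambda>i W. W \<circ> T (i - 1) \<circ> Z i) [2..<n] W"
  \<comment> \<open>The assumptions refer to a fixed \<open>n\<close>, so the induction runs over
    the partial products with \<open>k \<le> n\<close>.\<close>
  have *: "k \<le> n \<Longrightarrow> ?V k 0 = 0 \<and> (\<forall>i u. 2 \<le> i \<longrightarrow> i < k \<longrightarrow> (\<forall>u. Z i u = 0) \<longrightarrow> ?V k u = 0)" for k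
  proof (induction k)
    case (Suc k)
    show ?case
    proof (cases "2 \<le> k")
      case True
      have eq: "?V (Suc k) u = ?V k (T (k - 1) (Z k u))" for u
        using fold_compose_Suc[OF True, of T Z W] by simp
      have T0: "T (k - 1) 0 = 0" using assms(2)[of "k - 1"] Suc.prems True by auto
      have Z0: "Z k 0 = 0" using assms(3)[of k] Suc.prems True by auto
      have IH: "?V k 0 = 0" "\<And>i u. 2 \<le> i \<Longrightarrow> i < k \<Longrightarrow> \<forall>u. Z i u = 0 \<Longrightarrow> ?V k u = 0"
        using Suc.IH[OF Suc_leD[OF Suc.prems]] by blast+
      show ?thesis
        unfolding eq
      proof (intro conjI allI impI)
        show "?V k (T (k - 1) (Z k 0)) = 0" by (simp only: T0 Z0 IH(1))
        fix i u assume i: "2 \<le> i" "i < Suc k" "\<forall>u. Z i u = 0"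
        show "?V k (T (k - 1) (Z k u)) = 0"
        proof (cases "i = k")
          case True
          then have "Z k u = 0" using i(3) by blast
          then show ?thesis by (simp only: T0 IH(1))
        next
          case False
          with i show ?thesis by (intro IH(2)[of i]) auto
        qed
      qed
    qed (use assms(1) in auto)
  qed (use assms(1) in auto)
  show "?V n 0 = 0" using *[of n] by simp
  show "2 \<le> i \<Longrightarrow> i < n \<Longrightarrow> (\<And>u. Z i u = 0) \<Longrightarrow> ?V n u = 0" using *[of n] by blast
qed

text \<open>\<open>d1\<close> and \<open>d2\<close> tell whether the first and the last factor need the reflection. For \<open>m = 3\<close> both
  reflections fall into the same slot, where they cancel.\<close>

lemma fold_compose_diagonal:
  fixes e :: "nat \<Rightarrow> 'h::complex_hilbert_space"
  assumes e: "onbasis e" and m: "3 \<le> m"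
    and left: "\<And>u. cinner (T 1 (if d1 then reflection e k u else u)) (e k) = a * cinner u (e 0)"
    and middle: "\<And>i u. 2 \<le> i \<Longrightarrow> i \<le> m - 2 \<Longrightarrow> T i u = scaleC (cinner u (e 0)) (e 0)"
    and Z: "\<And>i u. 2 \<le> i \<Longrightarrow> i < m \<Longrightarrow>
      Z i u = (if (i = 2 \<and> d1) \<noteq> (i = m - 1 \<and> d2) then reflection e k u else u)"
  shows "fold (\<lambda>i W. W \<circ> T (i - 1) \<circ> Z i) [2..<m] (basis_projection e k) u
    = scaleC (a * cinner (if d2 then reflection e k u else u) (e 0)) (e k)"
proof -
  let ?V = "\<lambda>n. fold (\<lambda>i W. W \<circ> T (i - 1) \<circ> Z i) [2..<n] (basis_projection e k)"
  \<comment> \<open>At \<open>n = 3\<close> the product contains \<open>T 1\<close> and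
    \<open>Z 2\<close> for the first time. The reflection of the last factor sits in slot
    \<open>m - 1\<close>, which is multiplied in only when \<open>n = m\<close>.\<close>
  have "3 \<le> n \<Longrightarrow> n \<le> m \<Longrightarrow>
    ?V n u = scaleC (a * cinner (if n = m \<and> d2 then reflection e k u else u) (e 0)) (e k)" for n u
  proof (induction n arbitrary: u rule: nat_induct_at_least)
    case base
    have "?V 3 u = basis_projection e k (T 1 (Z 2 u))"
      by (simp add: upt_rec[of 2 3])
    also have "\<dots> = scaleC (cinner (T 1 (Z 2 u)) (e k)) (e k)"
      by (simp add: basis_projection_def[OF e])
    also have "cinner (T 1 (Z 2 u)) (e k) = a * cinner (if 3 = m \<and> d2 then reflection e k u else u) (e 0)"
    proof -
      have Z2: "Z 2 u = (if d1 \<noteq> (m = 3 \<and> d2) then reflection e k u else u)"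
        using Z[of 2 u] m by (cases "m = 3") auto
      \<comment> \<open>If \<open>m = 3\<close> and both flags hold, then \<open>Z 2\<close> is the
        identity; \<open>left\<close> is then applied to \<open>reflection e k u\<close>, whose
        reflection is \<open>u\<close>.\<close>
      show ?thesis
        using left[of u] left[of "reflection e k u"]
        unfolding Z2 by (auto simp: reflection_reflection[OF e])
    qed
    finally show ?case .
  next
    case (Suc n)
    have "?V (Suc n) u = ?V n (T (n - 1) (Z n u))"
      using fold_compose_Suc[of n T Z "basis_projection e k"] Suc.hyps by simp
    also have "T (n - 1) (Z n u) = scaleC (cinner (Z n u) (e 0)) (e 0)"
      using Suc by (intro middle) auto
    also have "?V n \<dots> = scaleC (a * cinner (scaleC (cinner (Z n u) (e 0)) (e 0)) (e 0)) (e k)"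
      using Suc.IH[of "scaleC (cinner (Z n u) (e 0)) (e 0)"] Suc.prems by (simp add: o_def)
    also have "\<dots> = scaleC (a * cinner (Z n u) (e 0)) (e k)"
      by (simp add: cinner_scaleC_left onbasis_cinner[OF e])
    also have "Z n u = (if Suc n = m \<and> d2 then reflection e k u else u)"
      using Z[of n u] Suc by auto
    finally show ?case .
  qed
  from this[of m u] m show ?thesis by simp
qed

lemma haagerup_term_eq_0:
  assumes "i \<in> {2..m - 1}" "\<alpha> i (j (i - 1)) (j i) (x i) = 0"
  shows "haagerup_term m a \<alpha> b j x = 0"
proof -
  have "(\<Prod>i=2..m - 1. \<alpha> i (j (i - 1)) (j i) (x i)) = 0"
    using assms by (intro prod_zero) auto
  then show ?thesis by (simp add: haagerup_term_def)
qed

text \<open>By \<open>left\<close>, row \<open>k\<close> of the first operator is, up to a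
  reflection, \<open>a k\<close> times the functional of \<open>e 0\<close>; by
  \<open>right\<close>, column \<open>k\<close> of the last one is, up to a reflection,
  \<open>b k\<close> times \<open>e 0\<close>. Each diagonal multi-index therefore contributes
  \<open>a k * b k\<close> times the projection onto \<open>e k\<close>, and the other multi-indices
  contribute nothing.\<close>

lemma diagonal_multiple_operator_integral:
  fixes bits :: "'x \<Rightarrow> nat \<Rightarrow> bool" and e :: "nat \<Rightarrow> 'h::complex_hilbert_space"
  assumes surj: "surj bits" and e: "onbasis e" and m: "3 \<le> m"
    and T: "\<And>i. 1 \<le> i \<Longrightarrow> i < m \<Longrightarrow> T i 0 = 0" and lin: "\<And>c u. T (m - 1) (scaleC c u) = scaleC c (T (m - 1) u)"
    and left: "\<And>k u. cinner (T 1 (if d1 then reflection e k u else u)) (e k) = a k * cinner u (e 0)"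
    and middle: "\<And>i u. 2 \<le> i \<Longrightarrow> i \<le> m - 2 \<Longrightarrow> T i u = scaleC (cinner u (e 0)) (e 0)"
    and right: "\<And>k. T (m - 1) (e k) = scaleC (b k) (if d2 then reflection e k (e 0) else e 0)"
    and bounded: "\<And>k. cmod (a k * b k) \<le> C"
  shows "\<exists>M E \<Psi>. (\<forall>i\<in>{1..m}. spectral_measure (M i :: 'x measure) (E i)) \<and>
    \<Psi> \<in> haagerup_tensor m M E \<and>
    has_multiple_operator_integral m M E \<Psi> T (diagop (\<lambda>k. a k * b k) e e)"
proof -
  have comm: "basis_projection e i (basis_projection e j u) = basis_projection e j (basis_projection e i u)"
    for i j u by (simp add: basis_projection_mult[OF e])
  obtain M1 :: "'x measure" and E1 where "spectral_measure M1 E1 \<and> space M1 = UNIV \<and>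
    (\<forall>n. {x. bits x n} \<in> sets M1) \<and> (\<forall>n. E1 {x. bits x n} = basis_projection e n)"
    using spectral_measure_of_commuting_projections[of bits "basis_projection e", OF surj projection_basis_projection[OF e] comm]
    by blast
  then have 1: "spectral_measure M1 E1" "space M1 = UNIV"
    "\<And>n. {x. bits x n} \<in> sets M1" "\<And>n. E1 {x. bits x n} = basis_projection e n"
    by simp_all
  obtain M2 :: "'x measure" and E2 where "spectral_measure M2 E2 \<and> space M2 = UNIV \<and>
    (\<forall>n. {x. bits x n} \<in> sets M2) \<and> (\<forall>n. E2 {x. bits x n} = reflection_projection e n)"
    using spectral_measure_of_commuting_projections[of bits "reflection_projection e", OF surj projection_reflection_projection[OF e]
      reflection_projection_commute[OF e]]
    by blast
  then have 2: "spectral_measure M2 E2" "space M2 = UNIV"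
    "\<And>n. {x. bits x n} \<in> sets M2" "\<And>n. E2 {x. bits x n} = reflection_projection e n"
    by simp_all
  \<comment> \<open>The two outer variables carry the basis projections, all inner ones the joint
    spectral measure of the reflections.\<close>
  define M where "M i = (if i = 1 \<or> i = m then M1 else M2)" for i
  define E where "E i = (if i = 1 \<or> i = m then E1 else E2)" for i
  have ME: "M 1 = M1" "E 1 = E1" "M m = M1" "E m = E1" by (auto simp: M_def E_def)
  have ME2: "M i = M2" "E i = E2" if "i \<in> {2..m - 1}" for i using that m by (auto simp: M_def E_def)
  have sm: "spectral_measure (M i) (E i)" for i using 1(1) 2(1) by (simp add: M_def E_def)
  have fb: "first_bit bits k \<in> sets M1" "E1 (first_bit bits k) = basis_projection e k" for k
    using first_bit_spectral[where p = "basis_projection e" and k = k, OF 1] basis_projection_mult[OF e] by auto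
  \<comment> \<open>Exclusive or, since two reflections in the same slot cancel; this happens for
    \<open>m = 3\<close>.\<close>
  define fl where "fl i \<longleftrightarrow> (i = 2 \<and> d1) \<noteq> (i = m - 1 \<and> d2)" for i
  define A :: "nat \<Rightarrow> 'x \<Rightarrow> complex" where "A j = (\<lambda>x. if x \<in> first_bit bits j then 1 else 0)" for j
  define sg :: "nat \<Rightarrow> 'x \<Rightarrow> complex" where "sg k = (\<lambda>x. if x \<in> {x. bits x k} then 1 else - 1)" for k
  define \<alpha> where "\<alpha> i j k = (if j = k then if fl i then sg j else (\<lambda>x. 1) else (\<lambda>x. 0))" for i j k :: nat
  have SA: "spectral_integral M1 E1 (A j) = basis_projection e j" for j
    unfolding A_def by (subst spectral_integral_two_valued[OF 1(1) fb(1)]) (simp add: fb(2))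
  have Ssg: "spectral_integral M2 E2 (sg j) = reflection e j" for j
    unfolding sg_def
    by (subst spectral_integral_two_valued[OF 2(1) 2(3)]) (simp only: 2(4) reflection_projection_diff[OF e])
  have SZ: "spectral_integral (M i) (E i) (\<alpha> i j k) u
      = (if j = k then if fl i then reflection e j u else u else 0)" if "i \<in> {2..m - 1}" for i j k u
    by (simp add: ME2[OF that] \<alpha>_def Ssg spectral_integral_const[OF 2(1)])
  have rep: "\<exists>\<Psi>. haagerup_representation m M E \<Psi> A \<alpha> A"
  proof -
    let ?t = "\<lambda>x k. haagerup_term m A \<alpha> A (diagonal_index m k) x"
    let ?\<Psi> = "\<lambda>x. \<Sum>k. ?t x k"
    have Asets: "A \<in> Linf_ell2 M1 E1"
      unfolding A_def by (rule Linf_ell2_first_bit[OF 1(1) fb(1)])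
    have \<alpha>sets: "\<alpha> i \<in> Linf_matrix M2 E2" for i
    proof -
      have "sg j \<in> borel_measurable M2" for j
        unfolding sg_def using 2(3)[of j] by (intro measurable_If_set) (auto simp: 2(2))
      then have "\<alpha> i j k \<in> borel_measurable M2" for j k by (simp add: \<alpha>_def)
      moreover have "spectral_AE M2 E2 (\<lambda>x. matrix_norm_le (\<lambda>j k. \<alpha> i j k x) 1)"
      proof (rule spectral_AE_I[OF 2(1)])
        fix x
        have "matrix_norm_le (\<lambda>j k. if j = k then (if fl i then sg j x else 1) else 0) 1"
          by (rule matrix_norm_le_diagonal) (simp add: sg_def)
        moreover have "\<alpha> i j k x = (if j = k then (if fl i then sg j x else 1) else 0)" for j k
          by (simp add: \<alpha>_def)
        ultimately show "matrix_norm_le (\<lambda>j k. \<alpha> i j k x) 1" by simp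
      qed
      ultimately show ?thesis unfolding Linf_matrix_def by blast
    qed
    have conv: "((\<lambda>n. \<Sum>j\<in>rectangle m n. haagerup_term m A \<alpha> A j x) \<longlongrightarrow> ?\<Psi> x) (limits_at_top m)" for x
    proof (rule tendsto_rectangle_diagonal)
      show "haagerup_term m A \<alpha> A j x = 0" if "i \<in> {2..m - 1}" "j (i - 1) \<noteq> j i" for j i
        by (rule haagerup_term_eq_0[OF that(1)]) (use that(2) in \<open>simp add: \<alpha>_def\<close>)
      \<comment> \<open>At each point at most one \<open>k\<close> has a nonzero factor
        \<open>A k (x 1)\<close>, so the series has at most one nonzero term and converges
        everywhere.\<close>
      have "finite {k. x 1 \<in> first_bit bits k}"
      proof (cases "\<exists>k. x 1 \<in> first_bit bits k")
        case True
        then obtain k where k: "x 1 \<in> first_bit bits k" by blast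
        then have "{k. x 1 \<in> first_bit bits k} \<subseteq> {k}" using first_bit_unique[OF k] by blast
        then show ?thesis by (rule finite_subset) simp
      qed simp
      moreover have "?t x k = 0" if "k \<notin> {k. x 1 \<in> first_bit bits k}" for k
        using that m by (simp add: haagerup_term_def A_def diagonal_index_def)
      ultimately show "?t x sums ?\<Psi> x" by (intro summable_sums summable_finite)
    qed (use m in simp)
    have "haagerup_representation m M E ?\<Psi> A \<alpha> A"
      unfolding haagerup_representation_def ME
    proof (intro conjI ballI exI[of _ "\<lambda>_. {}"])
      show "\<alpha> i \<in> Linf_matrix (M i) (E i)" if "i \<in> {2..m - 1}" for i
        using \<alpha>sets by (simp add: ME2[OF that])
      show "E i {} = (\<lambda>u. 0)" for i by (rule ext) (rule spectral_measure_empty[OF sm])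
    qed (use Asets conv in auto)
    then show ?thesis by blast
  qed
  then obtain \<Psi> where \<Psi>: "haagerup_representation m M E \<Psi> A \<alpha> A" by blast
  note fam = onbasis_ortho_family'[OF e]
  let ?D = "diagop (\<lambda>k. a k * b k) e e"
  have D: "bounded_clinear ?D" by (rule bounded_clinear_diagop[OF fam fam bounded])
  have zero: "operator_term m M E T A \<alpha> A j u = 0" if i: "i \<in> {2..m - 1}" "j (i - 1) \<noteq> j i" for i j u
  proof -
    let ?Z = "\<lambda>i. spectral_integral (M i) (E i) (\<alpha> i (j (i - 1)) (j i))"
    have "fold (\<lambda>i W. W \<circ> T (i - 1) \<circ> ?Z i) [2..<m] (basis_projection e (j 1)) u = 0" for u
    proof (rule fold_compose_zero(2))
      show "basis_projection e (j 1) 0 = 0" by (simp add: basis_projection_def[OF e])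
      show "T i 0 = 0" if "1 \<le> i" "i < m - 1" for i using T[of i] that by simp
      show "?Z i 0 = 0" if "2 \<le> i" "i < m" for i
        using that m SZ[of i] bounded_clinearD(3)[OF bounded_clinear_reflection[OF e]] by auto
      show "2 \<le> i" "i < m" using i m by auto
      show "?Z i u = 0" for u using i SZ[of i] by simp
    qed
    then show ?thesis by (simp only: operator_term_def ME SA o_apply)
  qed
  have diag: "operator_term m M E T A \<alpha> A (diagonal_index m k) u
      = scaleC (a k * b k * cinner u (e k)) (e k)" for k u
  proof -
    let ?Z = "\<lambda>i. spectral_integral (M i) (E i) (\<alpha> i (diagonal_index m k (i - 1)) (diagonal_index m k i))"
    have idx: "diagonal_index m k 1 = k" "diagonal_index m k (m - 1) = k"
      using m by (auto simp: diagonal_index_def)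
    have Z: "?Z i u = (if (i = 2 \<and> d1) \<noteq> (i = m - 1 \<and> d2) then reflection e k u else u)"
      if "2 \<le> i" "i < m" for i u
    proof -
      have "diagonal_index m k (i - 1) = k" "diagonal_index m k i = k"
        using that by (auto simp: diagonal_index_def)
      moreover have "i \<in> {2..m - 1}" using that by auto
      ultimately show ?thesis by (simp only: SZ) (simp add: fl_def)
    qed
    have "operator_term m M E T A \<alpha> A (diagonal_index m k) u
      = fold (\<lambda>i W. W \<circ> T (i - 1) \<circ> ?Z i) [2..<m] (basis_projection e k) (T (m - 1) (basis_projection e k u))"
      by (simp only: operator_term_def ME SA idx o_apply)
    also have "\<dots> = scaleC (a k * cinner (if d2 then reflection e k (T (m - 1) (basis_projection e k u))
        else T (m - 1) (basis_projection e k u)) (e 0)) (e k)"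
      by (rule fold_compose_diagonal[of e m T d1 k "a k" ?Z d2, OF e m left middle Z])
    also have "T (m - 1) (basis_projection e k u)
        = scaleC (cinner u (e k) * b k) (if d2 then reflection e k (e 0) else e 0)"
      by (simp only: basis_projection_def[OF e] lin right scaleC_scaleC)
    also have "cinner (if d2 then reflection e k \<dots> else \<dots>) (e 0) = cinner u (e k) * b k"
      by (simp add: bounded_clinearD(2)[OF bounded_clinear_reflection[OF e]] reflection_reflection[OF e]
          cinner_scaleC_left onbasis_cinner[OF e])
    finally show ?thesis by (simp add: mult_ac)
  qed
  have "((\<lambda>n. cinner (\<Sum>j\<in>rectangle m n. operator_term m M E T A \<alpha> A j u) v)
      \<longlongrightarrow> cinner (?D u) v) (limits_at_top m)" for u v
    unfolding cinner_sum_left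
  proof (rule tendsto_rectangle_diagonal)
    show "cinner (operator_term m M E T A \<alpha> A j u) v = 0" if "i \<in> {2..m - 1}" "j (i - 1) \<noteq> j i" for j i
      using zero[OF that] by simp
    show "(\<lambda>k. cinner (operator_term m M E T A \<alpha> A (diagonal_index m k) u) v) sums cinner (?D u) v"
      unfolding diag cinner_scaleC_left by (rule diagop_cinner_sums[OF fam fam bounded])
  qed (use m in simp)
  with D \<Psi> have "has_multiple_operator_integral m M E \<Psi> T ?D"
    unfolding has_multiple_operator_integral_def by blast
  moreover have "\<Psi> \<in> haagerup_tensor m M E" using \<Psi> unfolding haagerup_tensor_def by blast
  ultimately show ?thesis using sm by blast
qed

section \<open>Singular value decomposition\<close>

text \<open>Adding a vector \<open>c\<close> replaces the set by a continuous image of its product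
  with a disc.\<close>

lemma compact_coefficient_sums:
  fixes C :: "'h::complex_hilbert_space set"
  assumes "finite C"
  shows "compact {\<Sum>c\<in>C. scaleC (f c) c | f. \<forall>c\<in>C. cmod (f c) \<le> r}"
  using assms
proof (induction C)
  case empty
  have "{\<Sum>c\<in>{}. scaleC (f c) c | f. \<forall>c\<in>{}::'h set. cmod (f c) \<le> r} = {0}" by simp
  then show ?case by simp
next
  case (insert c C)
  let ?S = "\<lambda>C. {\<Sum>c\<in>C. scaleC (f c) c | f. \<forall>c\<in>C. cmod (f c) \<le> r} :: 'h set"
  have bl: "bounded_linear (\<lambda>z. scaleC z c)"
    by (rule bounded_linear_intro[where K = "norm c"])
      (simp_all add: scaleC_add_left scaleR_eq_scaleC scaleC_scaleC norm_scaleC scaleR_conv_of_real)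
  have "continuous_on A (\<lambda>p. scaleC (fst p) c + snd p)" for A
    by (intro continuous_on_add bounded_linear.continuous_on[OF bl] continuous_on_fst
        continuous_on_snd continuous_on_id)
  then have "compact ((\<lambda>p. scaleC (fst p) c + snd p) ` (cball 0 r \<times> ?S C))"
    by (intro compact_continuous_image compact_Times insert.IH compact_cball)
  also have "(\<lambda>p. scaleC (fst p) c + snd p) ` (cball 0 r \<times> ?S C) = ?S (insert c C)"
  proof (intro equalityI subsetI)
    fix w assume "w \<in> (\<lambda>p. scaleC (fst p) c + snd p) ` (cball 0 r \<times> ?S C)"
    then obtain z f where *: "cmod z \<le> r" "\<forall>d\<in>C. cmod (f d) \<le> r"
      "w = scaleC z c + (\<Sum>d\<in>C. scaleC (f d) d)"
      by (elim imageE SigmaE CollectE exE conjE) (simp add: mem_cball)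
    have "(\<Sum>d\<in>C. scaleC ((f(c := z)) d) d) = (\<Sum>d\<in>C. scaleC (f d) d)"
      using insert.hyps by (intro sum.cong) auto
    then have "w = (\<Sum>d\<in>insert c C. scaleC ((f(c := z)) d) d)"
      using insert.hyps * by simp
    moreover have "\<forall>d\<in>insert c C. cmod ((f(c := z)) d) \<le> r" using * by simp
    ultimately show "w \<in> ?S (insert c C)" by blast
  next
    fix w assume "w \<in> ?S (insert c C)"
    then obtain f where f: "\<forall>d\<in>insert c C. cmod (f d) \<le> r" "w = (\<Sum>d\<in>insert c C. scaleC (f d) d)"
      by blast
    then have "w = scaleC (fst (f c, \<Sum>d\<in>C. scaleC (f d) d)) c + snd (f c, \<Sum>d\<in>C. scaleC (f d) d)"
      using insert.hyps by simp
    moreover have "(f c, \<Sum>d\<in>C. scaleC (f d) d) \<in> cball 0 r \<times> ?S C" using f(1) by auto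
    ultimately show "w \<in> (\<lambda>p. scaleC (fst p) c + snd p) ` (cball 0 r \<times> ?S C)" by blast
  qed
  finally show ?case .
qed

lemma span_onset_expansion:
  assumes C: "onset C" "finite C" and w: "w \<in> complex_vector.span C"
  shows "w = (\<Sum>c\<in>C. scaleC (cinner w c) c)"
proof -
  let ?d = "w - (\<Sum>c\<in>C. scaleC (cinner w c) c)"
  have "cinner ?d v = 0" if "v \<in> complex_vector.span C" for v
    using that
  proof (induction rule: complex_vector.span_induct_alt)
    case (step a c v)
    then show ?case using onset_residual[OF C, of c w] by (simp add: cinner_add_right cinner_scaleC_right)
  qed simp
  moreover have "?d \<in> complex_vector.span C"
    by (intro complex_vector.span_diff w complex_vector.span_sum complex_vector.span_scale
        complex_vector.span_base) auto
  ultimately have "cinner ?d ?d = 0" by blast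
  then show ?thesis by (simp add: cinner_self)
qed

lemma norm_le_onorm: "bounded_clinear T \<Longrightarrow> norm (T u) \<le> onorm T * norm u"
  by (intro onorm bounded_clinearD(1))

lemma finite_rank_image_compact:
  assumes R: "bounded_clinear R" "rank_le R n"
  shows "\<exists>K. compact K \<and> R ` cball 0 1 \<subseteq> K"
proof -
  obtain B where "finite B" "range R \<subseteq> complex_vector.span B" using R(2) by (auto simp: rank_le_def)
  then obtain C where C: "onset C" "finite C" "range R \<subseteq> complex_vector.span C"
    using finite_span_onset[of B] by blast
  let ?K = "{\<Sum>c\<in>C. scaleC (f c) c | f. \<forall>c\<in>C. cmod (f c) \<le> onorm R}"
  have "R u \<in> ?K" if "u \<in> cball 0 1" for u
  proof -
    have "R u = (\<Sum>c\<in>C. scaleC (cinner (R u) c) c)"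
      using C(3) by (intro span_onset_expansion C) auto
    moreover have "cmod (cinner (R u) c) \<le> onorm R" if "c \<in> C" for c
    proof -
      have "cmod (cinner (R u) c) \<le> norm (R u) * norm c" by (rule cmod_cinner_le)
      also have "norm c = 1" by (rule onset_norm[OF C(1) that])
      also have "norm (R u) * 1 \<le> onorm R * norm u" using norm_le_onorm[OF R(1)] by simp
      also have "\<dots> \<le> onorm R"
        using \<open>u \<in> cball 0 1\<close> onorm_pos_le[OF bounded_clinearD(1)[OF R(1)]] by (simp add: mult_left_le)
      finally show ?thesis .
    qed
    ultimately show ?thesis by blast
  qed
  then show ?thesis using compact_coefficient_sums[OF C(2), of "onorm R"] by blast
qed

lemma compact_image_closure:
  assumes X: "bounded_clinear X"
    and approx: "\<And>\<epsilon>. 0 < \<epsilon> \<Longrightarrow> \<exists>R n. bounded_clinear R \<and> rank_le R n \<and> onorm (\<lambda>u. X u - R u) < \<epsilon>"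
  shows "compact (closure (X ` cball 0 1))"
  unfolding compact_eq_totally_bounded
proof (intro conjI allI impI)
  show "complete (closure (X ` cball 0 1))" by (simp add: complete_eq_closed)
  fix e :: real assume e: "0 < e"
  \<comment> \<open>Two errors of \<open>e / 4\<close> lead to closed balls of radius
    \<open>e / 2\<close>. Their finite union is closed, so it covers the closure as well, and it
    lies in the open balls of radius \<open>e\<close>.\<close>
  obtain R n where R: "bounded_clinear R" "rank_le R n" "onorm (\<lambda>u. X u - R u) < e / 4"
    using approx[of "e / 4"] e by auto
  obtain K where K: "compact K" "R ` cball 0 1 \<subseteq> K"
    using finite_rank_image_compact[OF R(1,2)] by blast
  then obtain k where k: "finite k" "K \<subseteq> (\<Union>x\<in>k. ball x (e / 4))"
    using e unfolding compact_eq_totally_bounded by (metis zero_less_divide_iff zero_less_numeral)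
  have "X ` cball 0 1 \<subseteq> (\<Union>x\<in>k. cball x (e / 2))"
  proof
    fix w assume "w \<in> X ` cball 0 1"
    then obtain u where u: "norm u \<le> 1" "w = X u" by auto
    then have "R u \<in> K" using K(2) by auto
    then obtain x where x: "x \<in> k" "dist x (R u) < e / 4" using k(2) by auto
    have bl: "bounded_clinear (\<lambda>u. X u - R u)" by (intro bounded_clinear_diff X R)
    have "norm (X u - R u) \<le> onorm (\<lambda>u. X u - R u) * norm u"
      using norm_le_onorm[OF bl] .
    also have "\<dots> \<le> onorm (\<lambda>u. X u - R u)"
      using u(1) onorm_pos_le[OF bounded_clinearD(1)[OF bl]] by (simp add: mult_left_le)
    finally have "dist (R u) (X u) < e / 4" using R(3) by (simp add: dist_norm norm_minus_commute)
    then have "dist x w \<le> e / 2" using x(2) u(2) dist_triangle[of x w "R u"] by simp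
    then show "w \<in> (\<Union>x\<in>k. cball x (e / 2))" using x(1) by auto
  qed
  then have "closure (X ` cball 0 1) \<subseteq> (\<Union>x\<in>k. cball x (e / 2))"
    using k(1) by (intro closure_minimal closed_UN) auto
  also have "\<dots> \<subseteq> (\<Union>x\<in>k. ball x e)" using e by (intro UN_mono) auto
  finally show "\<exists>k. finite k \<and> closure (X ` cball 0 1) \<subseteq> (\<Union>x\<in>k. ball x e)" using k(1) by blast
qed

text \<open>A maximizing sequence with convergent images is Cauchy by the parallelogram law, so no adjoint of
  \<open>X\<close> is needed.\<close>

lemma maximizer_exists:
  fixes X :: "'h::complex_hilbert_space \<Rightarrow> 'h"
  assumes inf: "\<not> (\<exists>B :: 'h set. finite B \<and> complex_vector.span B = UNIV)"
    and X: "bounded_clinear X" and cpt: "compact (closure (X ` cball 0 1))" and F: "finite F"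
  shows "\<exists>x. norm x = 1 \<and> (\<forall>f\<in>F. cinner x f = 0) \<and>
    (\<forall>v. (\<forall>f\<in>F. cinner v f = 0) \<longrightarrow> norm (X v) \<le> norm (X x) * norm v)"
proof -
  note lin = bounded_clinearD[OF X]
  define U where "U = {v. norm v = 1 \<and> (\<forall>f\<in>F. cinner v f = 0)}"
  define s where "s = (SUP v\<in>U. norm (X v))"
  from unit_orthogonal_exists[OF inf F] obtain u0
    where "norm u0 = 1" "\<And>f. f \<in> F \<Longrightarrow> cinner u0 f = 0" by blast
  then have u0: "u0 \<in> U" by (simp add: U_def)
  have bdd: "bdd_above ((\<lambda>v. norm (X v)) ` U)"
  proof (rule bdd_aboveI2)
    show "norm (X v) \<le> onorm X" if "v \<in> U" for v
      using norm_le_onorm[OF X, of v] that by (simp add: U_def)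
  qed
  have s_unit: "norm (X v) \<le> s" if "v \<in> U" for v
    unfolding s_def using that by (intro cSUP_upper bdd)
  then have s0: "0 \<le> s" using u0 norm_ge_zero order_trans by blast
  have s_le: "norm (X v) \<le> s * norm v" if v: "\<forall>f\<in>F. cinner v f = 0" for v
  proof (cases "v = 0")
    case False
    let ?w = "scaleC (1 / complex_of_real (norm v)) v"
    have "?w \<in> U" using False v by (simp add: U_def norm_scaleC norm_divide cinner_scaleC_left)
    from s_unit[OF this] have "norm (X v) / norm v \<le> s"
      by (simp add: lin(2) norm_scaleC norm_divide)
    then show ?thesis using False by (simp add: field_simps)
  qed (simp add: lin(3))
  show ?thesis
  proof (cases "s = 0")
    case True
    have "norm (X v) \<le> norm (X u0) * norm v" if "\<forall>f\<in>F. cinner v f = 0" for v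
    proof -
      have "norm (X v) \<le> 0" using s_le[OF that] True by simp
      also have "0 \<le> norm (X u0) * norm v" by simp
      finally show ?thesis .
    qed
    then show ?thesis using u0 by (auto simp: U_def)
  next
    case False
    with s0 have s: "0 < s" by simp
    have "\<exists>v\<in>U. s - 1 / Suc n < norm (X v)" for n
      using less_cSUP_iff[OF _ bdd, of "s - 1 / Suc n"] u0 by (auto simp: s_def)
    then obtain u where u: "\<And>n. u n \<in> U" "\<And>n. s - 1 / Suc n < norm (X (u n))" by metis
    have "X (u n) \<in> closure (X ` cball 0 1)" for n
      using u(1)[of n] by (intro subsetD[OF closure_subset] imageI) (simp add: U_def)
    then have "\<exists>l\<in>closure (X ` cball 0 1). \<exists>r. strict_mono r \<and> ((\<lambda>n. X (u n)) \<circ> r) \<longlonglongrightarrow> l"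
      using cpt[unfolded compact_def, rule_format, of "\<lambda>n. X (u n)"] by simp
    then obtain y r where r: "strict_mono r" "((\<lambda>n. X (u n)) \<circ> r) \<longlonglongrightarrow> y"
      by blast
    define w where "w n = u (r n)" for n
    have wU: "w n \<in> U" for n using u(1) by (simp add: w_def)
    have Xw: "(\<lambda>n. X (w n)) \<longlonglongrightarrow> y" using r(2) by (simp add: w_def o_def)
    have "(\<lambda>n. norm (X (u n))) \<longlonglongrightarrow> s"
    proof (rule real_tendsto_sandwich)
      show "(\<lambda>n. s - 1 / Suc n) \<longlonglongrightarrow> s"
        using tendsto_diff[OF tendsto_const LIMSEQ_inverse_real_of_nat, of s] by (simp add: inverse_eq_divide)
      show "\<forall>\<^sub>F n in sequentially. s - 1 / Suc n \<le> norm (X (u n))"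
        by (intro always_eventually allI less_imp_le u(2))
      show "\<forall>\<^sub>F n in sequentially. norm (X (u n)) \<le> s" using s_unit[OF u(1)] by auto
    qed (rule tendsto_const)
    then have "(\<lambda>n. norm (X (w n))) \<longlonglongrightarrow> s"
      using r(1) unfolding w_def by (rule LIMSEQ_subseq_LIMSEQ[unfolded o_def])
    then have y: "norm y = s" using tendsto_norm[OF Xw] LIMSEQ_unique by blast
    have "Cauchy w"
    proof (rule CauchyI)
      fix e :: real assume e: "0 < e"
      \<comment> \<open>The bound by \<open>s\<close> keeps \<open>2 * s - 2 * \<delta>\<close>
        nonnegative, so that the estimate can be squared. The other bound makes the resulting error
        \<open>8 * s * \<delta>\<close> smaller than \<open>s\<^sup>2 * e\<^sup>2\<close>, as
        \<open>8 / 9 < 1\<close>.\<close>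
      define \<delta> where "\<delta> = min s (s * e\<^sup>2 / 9)"
      have \<delta>: "0 < \<delta>" "\<delta> \<le> s" "\<delta> \<le> s * e\<^sup>2 / 9" using s e by (auto simp: \<delta>_def)
      obtain N where N: "\<And>n. n \<ge> N \<Longrightarrow> norm (X (w n) - y) < \<delta>"
        using LIMSEQ_D[OF Xw \<delta>(1)] by blast
      have "norm (w m - w n) < e" if mn: "m \<ge> N" "n \<ge> N" for m n
      proof -
        have "2 * s - norm (X (w m) + X (w n)) \<le> norm (2 *\<^sub>R y - (X (w m) + X (w n)))"
          using norm_triangle_ineq2[of "2 *\<^sub>R y" "X (w m) + X (w n)"] y by simp
        also have "2 *\<^sub>R y - (X (w m) + X (w n)) = - ((X (w m) - y) + (X (w n) - y))"
          by (simp add: scaleR_2)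
        also have "norm \<dots> \<le> norm (X (w m) - y) + norm (X (w n) - y)"
          unfolding norm_minus_cancel by (rule norm_triangle_ineq)
        also have "\<dots> < 2 * \<delta>" using N[OF mn(1)] N[OF mn(2)] by simp
        finally have "2 * s - 2 * \<delta> \<le> norm (X (w m + w n))" by (simp add: lin(4))
        also have "\<dots> \<le> s * norm (w m + w n)"
          using wU[of m] wU[of n] by (intro s_le) (simp add: U_def cinner_add_left)
        finally have "(2 * s - 2 * \<delta>)\<^sup>2 \<le> (s * norm (w m + w n))\<^sup>2"
          using \<delta>(2) by (intro power_mono) auto
        moreover have "(2 * s - 2 * \<delta>)\<^sup>2 = 4 * s\<^sup>2 - 8 * s * \<delta> + 4 * \<delta>\<^sup>2"
          by (simp add: power2_eq_square algebra_simps)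
        moreover have "s\<^sup>2 * (4 - (norm (w m + w n))\<^sup>2) = 4 * s\<^sup>2 - (s * norm (w m + w n))\<^sup>2"
          by (simp add: power_mult_distrib right_diff_distrib)
        ultimately have "s\<^sup>2 * (4 - (norm (w m + w n))\<^sup>2) \<le> 8 * s * \<delta>"
          using zero_le_power2[of \<delta>] by linarith
        also have "\<dots> \<le> 8 * s * (s * e\<^sup>2 / 9)" using \<delta>(3) s by (intro mult_left_mono) auto
        also have "\<dots> < s\<^sup>2 * e\<^sup>2" using s e by (simp add: power2_eq_square)
        finally have "4 - (norm (w m + w n))\<^sup>2 < e\<^sup>2" using s by simp
        moreover have "(norm (w m - w n))\<^sup>2 + (norm (w m + w n))\<^sup>2 = 4"
        proof -
          have "(norm (w m - w n))\<^sup>2 + (norm (w m + w n))\<^sup>2 = 2 * (norm (w m))\<^sup>2 + 2 * (norm (w n))\<^sup>2"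
            by (simp add: power2_norm_eq_inner inner_diff_left inner_diff_right inner_add_left
                inner_add_right inner_commute)
          then show ?thesis using wU[of m] wU[of n] by (simp add: U_def)
        qed
        ultimately have "(norm (w m - w n))\<^sup>2 < e\<^sup>2" by linarith
        then show ?thesis using e by (simp add: power_less_imp_less_base)
      qed
      then show "\<exists>N. \<forall>m\<ge>N. \<forall>n\<ge>N. norm (w m - w n) < e" by blast
    qed
    then obtain x where x: "w \<longlonglongrightarrow> x" using Cauchy_convergent convergent_def by blast
    have "norm x = 1"
      using tendsto_norm[OF x] wU LIMSEQ_unique[of "\<lambda>n. norm (w n)"] by (simp add: U_def LIMSEQ_const_iff)
    moreover have "cinner x f = 0" if "f \<in> F" for f
      using bounded_linear.tendsto[OF bounded_linear_cinner_left x, of f] wU that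
      by (simp add: U_def LIMSEQ_const_iff)
    moreover have "norm (X x) = s"
      using bounded_linear.tendsto[OF lin(1) x] Xw y LIMSEQ_unique by blast
    ultimately show ?thesis using s_le by auto
  qed
qed

text \<open>First variation: moving from \<open>x\<close> towards \<open>v\<close> would increase
  \<open>norm (X x)\<close> to first order if the inner product were nonzero, while the norm of the
  argument grows only to second order.\<close>

lemma maximizer_orthogonal:
  fixes X :: "'h::complex_hilbert_space \<Rightarrow> 'h"
  assumes X: "bounded_clinear X" and x: "norm x = 1" "\<forall>f\<in>F. cinner x f = 0"
    and max: "\<And>v. \<forall>f\<in>F. cinner v f = 0 \<Longrightarrow> norm (X v) \<le> norm (X x) * norm v"
    and v: "\<forall>f\<in>F. cinner v f = 0" "cinner v x = 0"
  shows "cinner (X x) (X v) = 0"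
proof (rule ccontr)
  define c where "c = cinner (X x) (X v)"
  assume "cinner (X x) (X v) \<noteq> 0"
  then have c: "0 < (cmod c)\<^sup>2" by (simp add: c_def)
  define K where "K = (norm (X x))\<^sup>2 * (norm v)\<^sup>2"
  have K: "0 \<le> K" by (simp add: K_def)
  \<comment> \<open>Chosen so that \<open>\<epsilon> * K < 1\<close>: the second order cost then
    stays below the first order gain.\<close>
  define \<epsilon> where "\<epsilon> = 1 / (K + 1)"
  have \<epsilon>: "0 < \<epsilon>" "\<epsilon> * K < 1" using K by (auto simp: \<epsilon>_def field_simps)
  \<comment> \<open>The factor \<open>c\<close> aligns the phase, making \<open>cnj t * c\<close>
    real and positive.\<close>
  define t where "t = complex_of_real \<epsilon> * c"
  have sq: "(norm (a + b))\<^sup>2 = (norm a)\<^sup>2 + 2 * Re (cinner a b) + (norm b)\<^sup>2" for a b :: 'h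
  proof -
    have "(norm (a + b))\<^sup>2 = (norm a)\<^sup>2 + 2 * inner a b + (norm b)\<^sup>2"
      by (simp add: power2_norm_eq_inner inner_add_left inner_add_right inner_commute)
    then show ?thesis by (simp only: inner_eq_Re_cinner)
  qed
  have "cinner x v = 0" using v(2) by (simp add: cinner_eq_0_commute[of x v])
  then have nx: "(norm (x + scaleC t v))\<^sup>2 = 1 + (cmod t)\<^sup>2 * (norm v)\<^sup>2"
    by (simp add: sq x cinner_scaleC_right norm_scaleC power_mult_distrib)
  have "cnj t * c = complex_of_real \<epsilon> * (c * cnj c)" by (simp add: t_def)
  also have "\<dots> = complex_of_real (\<epsilon> * (cmod c)\<^sup>2)"
    by (simp only: complex_norm_square[symmetric] of_real_mult)
  finally have Re: "Re (cnj t * c) = \<epsilon> * (cmod c)\<^sup>2" by (simp only: Re_complex_of_real)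
  have "(norm (X (x + scaleC t v)))\<^sup>2 \<le> (norm (X x) * norm (x + scaleC t v))\<^sup>2"
    using x v by (intro power_mono max) (auto simp: cinner_add_left cinner_scaleC_left)
  also have "\<dots> = (norm (X x))\<^sup>2 + (cmod t)\<^sup>2 * K"
    by (simp add: power_mult_distrib nx K_def algebra_simps)
  finally have "(norm (X x))\<^sup>2 + 2 * Re (cnj t * c) + (norm (scaleC t (X v)))\<^sup>2 \<le> (norm (X x))\<^sup>2 + (cmod t)\<^sup>2 * K"
    by (simp add: bounded_clinearD(2,4)[OF X] sq cinner_scaleC_right c_def)
  then have "2 * (\<epsilon> * (cmod c)\<^sup>2) \<le> (cmod t)\<^sup>2 * K"
    unfolding Re using zero_le_power2[of "norm (scaleC t (X v))"] by linarith
  also have "(cmod t)\<^sup>2 * K = (\<epsilon> * (cmod c)\<^sup>2) * (\<epsilon> * K)"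
    using \<epsilon> by (simp add: t_def norm_mult power2_eq_square)
  also have "\<dots> < (\<epsilon> * (cmod c)\<^sup>2) * 1"
    using \<epsilon> c by (intro mult_strict_left_mono) auto
  finally have "2 * (\<epsilon> * (cmod c)\<^sup>2) < \<epsilon> * (cmod c)\<^sup>2" by simp
  moreover have "0 < \<epsilon> * (cmod c)\<^sup>2" using \<epsilon>(1) c by (rule mult_pos_pos)
  ultimately show False by linarith
qed

section \<open>Singular vectors and the singular value decomposition\<close>

context
  fixes X :: "'h::complex_hilbert_space \<Rightarrow> 'h"
begin

definition next_singular_vector :: "'h set \<Rightarrow> 'h" where
  "next_singular_vector F = (SOME x. norm x = 1 \<and> (\<forall>f\<in>F. cinner x f = 0) \<and>
    (\<forall>v. (\<forall>f\<in>F. cinner v f = 0) \<longrightarrow> norm (X v) \<le> norm (X x) * norm v))"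

text \<open>Each vector depends on all earlier ones, so the recursion carries the set of vectors
  found so far.\<close>

primrec singular_vector_set :: "nat \<Rightarrow> 'h set" where
  "singular_vector_set 0 = {}"
| "singular_vector_set (Suc n) =
    insert (next_singular_vector (singular_vector_set n)) (singular_vector_set n)"

definition singular_vector :: "nat \<Rightarrow> 'h" where
  "singular_vector n = next_singular_vector (singular_vector_set n)"

lemma singular_vector_set_eq: "singular_vector_set n = singular_vector ` {..<n}"
  by (induction n) (auto simp: singular_vector_def lessThan_Suc)

end

text \<open>A dimension count: \<open>n + 1\<close> images lie in the span of at most
  \<open>n\<close> vectors.\<close>

lemma kernel_combination:
  fixes x :: "nat \<Rightarrow> 'h::complex_hilbert_space"
  assumes R: "bounded_clinear R" "rank_le R n"
  obtains d where "\<exists>k\<le>n. d k \<noteq> 0" and "R (\<Sum>k\<le>n. scaleC (d k) (x k)) = 0"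
proof -
  note lin = bounded_clinearD[OF R(1)]
  have R_sum: "R (\<Sum>k\<le>n. scaleC (d k) (x k)) = (\<Sum>k\<le>n. scaleC (d k) (R (x k)))" for d
    by (simp add: lin(2,6))
  obtain B where B: "finite B" "card B \<le> n" "range R \<subseteq> complex_vector.span B"
    using R(2) by (auto simp: rank_le_def)
  let ?f = "\<lambda>k. R (x k)"
  show ?thesis
  \<comment> \<open>Linear dependence is a property of sets, so coinciding images are treated
    separately, with coefficients 1 and -1.\<close>
  proof (cases "inj_on ?f {..n}")
    case False
    then obtain k l where kl: "k \<le> n" "l \<le> n" "k \<noteq> l" "?f k = ?f l" by (auto simp: inj_on_def)
    define d :: "nat \<Rightarrow> complex" where "d = (\<lambda>i. if i = k then 1 else if i = l then -1 else 0)"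
    have "(\<Sum>i\<le>n. scaleC (d i) (?f i)) = (\<Sum>i\<in>{k, l}. scaleC (d i) (?f i))"
      using kl by (intro sum.mono_neutral_right) (auto simp: d_def)
    also have "\<dots> = 0" using kl by (simp add: d_def)
    finally show ?thesis using kl by (intro that[of d]) (auto simp: R_sum d_def)
  next
    case True
    have "complex_vector.dependent (?f ` {..n})"
    proof (rule ccontr)
      assume "complex_vector.independent (?f ` {..n})"
      then have "card (?f ` {..n}) \<le> card B"
        using complex_vector.independent_span_bound[OF B(1)] B(3) by blast
      then show False using B(2) by (simp add: card_image[OF True])
    qed
    then obtain c where c: "\<exists>v\<in>?f ` {..n}. c v \<noteq> 0" "(\<Sum>v\<in>?f ` {..n}. scaleC (c v) v) = 0"
      using complex_vector.dependent_finite[of "?f ` {..n}"] by auto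
    show ?thesis
    proof (rule that[of "\<lambda>k. c (?f k)"])
      show "\<exists>k\<le>n. c (?f k) \<noteq> 0" using c(1) by auto
      show "R (\<Sum>k\<le>n. scaleC (c (?f k)) (x k)) = 0"
        using c(2) by (simp add: R_sum sum.reindex[OF True])
    qed
  qed
qed

text \<open>The numbers \<open>\<sigma> n\<close> are successive maxima of \<open>norm (X v)\<close>
  over unit vectors. Their bound by the singular numbers carries summability over to them: on the
  span of \<open>x 0\<close> to \<open>x n\<close>, \<open>X\<close> stretches every vector at least
  by \<open>\<sigma> n\<close>, whereas an operator of rank at most \<open>n\<close> annihilates
  some nonzero vector there.\<close>

lemma singular_value_decomposition:
  fixes X :: "'h::complex_hilbert_space \<Rightarrow> 'h"
  assumes inf: "\<not> (\<exists>B :: 'h set. finite B \<and> complex_vector.span B = UNIV)"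
    and X: "bounded_clinear X" and lim: "singular_number X \<longlonglongrightarrow> 0"
  shows "\<exists>\<sigma> x y. ortho_family x \<and> ortho_family y \<and> decseq \<sigma> \<and>
    (\<forall>n. 0 \<le> \<sigma> n \<and> \<sigma> n \<le> singular_number X n) \<and>
    X = diagop (\<lambda>n. complex_of_real (\<sigma> n)) x y"
proof -
  note lin = bounded_clinearD[OF X]
  have ne: "{onorm (\<lambda>u. X u - R u) | R. bounded_clinear R \<and> rank_le R n} \<noteq> {}" for n
  proof -
    have "rank_le (\<lambda>u. 0 :: 'h) n" unfolding rank_le_def by (intro exI[of _ "{}"]) auto
    then show ?thesis using bounded_clinear_zero by blast
  qed
  have approx: "\<exists>R n. bounded_clinear R \<and> rank_le R n \<and> onorm (\<lambda>u. X u - R u) < \<epsilon>" if \<epsilon>: "0 < \<epsilon>" for \<epsilon>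
  proof -
    obtain n where "singular_number X n < \<epsilon>"
      using order_tendstoD(2)[OF lim \<epsilon>] by (auto simp: eventually_sequentially)
    then show ?thesis using cInf_lessD[OF ne[of n]] unfolding singular_number_def by blast
  qed
  define x where "x = singular_vector X"
  define \<sigma> where "\<sigma> n = norm (X (x n))" for n
  have cpt: "compact (closure (X ` cball 0 1))" by (rule compact_image_closure[OF X approx])
  have next_props: "norm (next_singular_vector X F) = 1 \<and> (\<forall>f\<in>F. cinner (next_singular_vector X F) f = 0) \<and>
    (\<forall>v. (\<forall>f\<in>F. cinner v f = 0) \<longrightarrow> norm (X v) \<le> norm (X (next_singular_vector X F)) * norm v)"
    if F: "finite F" for F
    unfolding next_singular_vector_def by (rule someI_ex[OF maximizer_exists[OF inf X cpt F]])
  have x_eq: "x n = next_singular_vector X (x ` {..<n})" for n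
    by (simp only: x_def singular_vector_def[of X n] singular_vector_set_eq)
  have x_props: "norm (x n) = 1 \<and> (\<forall>f\<in>x ` {..<n}. cinner (x n) f = 0) \<and>
    (\<forall>v. (\<forall>f\<in>x ` {..<n}. cinner v f = 0) \<longrightarrow> norm (X v) \<le> norm (X (x n)) * norm v)" for n
    unfolding x_eq[of n] by (rule next_props) simp
  have norm_x: "norm (x n) = 1" for n using x_props by blast
  have perp: "cinner (x n) (x m) = 0" if "m < n" for m n using x_props[of n] that by simp
  have perp': "cinner (x n) (x m) = 0" if "m \<noteq> n" for m n
    using perp[of m n] perp[of n m] that cinner_eq_0_commute[of "x n" "x m"] by (cases "m < n") auto
  have max: "norm (X v) \<le> \<sigma> n * norm v" if "\<And>i. i < n \<Longrightarrow> cinner v (x i) = 0" for v n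
    using x_props[of n] that by (simp add: \<sigma>_def)
  have x: "ortho_family x" using norm_x perp' by (auto simp: ortho_family_def)
  have dec: "\<sigma> n \<le> \<sigma> m" if "m \<le> n" for m n
    using max[of m "x n"] perp'[of _ n] that norm_x[of n] by (simp add: \<sigma>_def)
  have X_perp: "cinner (X (x m)) (X (x n)) = 0" if "m < n" for m n
  proof (rule maximizer_orthogonal[OF X, of _ "x ` {..<m}"])
    show "norm (x m) = 1" by (rule norm_x)
    show "\<forall>f\<in>x ` {..<m}. cinner (x m) f = 0" using x_props by blast
    show "norm (X v) \<le> norm (X (x m)) * norm v" if "\<forall>f\<in>x ` {..<m}. cinner v f = 0" for v
      using x_props that by blast
    show "\<forall>f\<in>x ` {..<m}. cinner (x n) f = 0" using perp that by auto
    show "cinner (x n) (x m) = 0" by (rule perp[OF that])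
  qed
  have X_perp': "cinner (X (x m)) (X (x n)) = 0" if "m \<noteq> n" for m n
    using X_perp[of m n] X_perp[of n m] that cinner_eq_0_commute[of "X (x n)" "X (x m)"]
    by (cases "m < n") auto
  define y where "y n = (if \<sigma> n = 0 then 0 else scaleC (1 / complex_of_real (\<sigma> n)) (X (x n)))" for n
  have \<sigma>0: "0 \<le> \<sigma> n" for n by (simp add: \<sigma>_def)
  have \<sigma>y: "scaleC (complex_of_real (\<sigma> n)) (y n) = X (x n)" for n
    by (simp add: y_def scaleC_scaleC \<sigma>_def)
  have norm_y: "norm (y n) = (if \<sigma> n = 0 then 0 else 1)" for n
    by (simp add: y_def norm_scaleC norm_divide \<sigma>_def)
  have y: "ortho_family y"
    unfolding ortho_family_def
  proof (intro conjI allI impI)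
    show "cinner (y i) (y j) = 0" if "i \<noteq> j" for i j
      using X_perp'[OF that] by (simp add: y_def cinner_scaleC_left cinner_scaleC_right)
    show "norm (y i) \<le> 1" for i by (simp add: norm_y)
  qed
  have X_sum: "X (\<Sum>k\<in>A. scaleC (d k) (x k)) = (\<Sum>k\<in>A. scaleC (d k * complex_of_real (\<sigma> k)) (y k))" for A d
    by (simp only: lin(2,6) \<sigma>y scaleC_scaleC[symmetric])
  have le: "\<sigma> n \<le> singular_number X n" for n
    unfolding singular_number_def
  proof (rule cInf_greatest[OF ne])
    fix t assume "t \<in> {onorm (\<lambda>u. X u - R u) | R. bounded_clinear R \<and> rank_le R n}"
    then obtain R where R: "bounded_clinear R" "rank_le R n" "t = onorm (\<lambda>u. X u - R u)" by blast
    obtain d where d: "\<exists>k\<le>n. d k \<noteq> 0" "R (\<Sum>k\<le>n. scaleC (d k) (x k)) = 0"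
      using kernel_combination[OF R(1,2), of x] by blast
    define u where "u = (\<Sum>k\<le>n. scaleC (d k) (x k))"
    have u: "(norm u)\<^sup>2 = (\<Sum>k\<le>n. (cmod (d k))\<^sup>2)"
      unfolding u_def by (subst norm_sum_ortho[OF x]) (simp_all add: norm_x)
    obtain k where "k \<le> n" "d k \<noteq> 0" using d(1) by blast
    then have "0 < (norm u)\<^sup>2" unfolding u by (intro sum_pos2[of _ k]) auto
    then have u0: "0 < norm u" by simp
    have "(\<sigma> n * norm u)\<^sup>2 = (\<Sum>k\<le>n. (cmod (d k))\<^sup>2 * (\<sigma> n)\<^sup>2)"
      by (simp add: power_mult_distrib u sum_distrib_left mult.commute)
    also have "\<dots> \<le> (\<Sum>k\<le>n. (cmod (d k))\<^sup>2 * (\<sigma> k)\<^sup>2)"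
      by (intro sum_mono mult_left_mono power_mono dec \<sigma>0) auto
    also have "\<dots> = (\<Sum>k\<le>n. (cmod (d k * complex_of_real (\<sigma> k)))\<^sup>2 * (norm (y k))\<^sup>2)"
      by (intro sum.cong) (auto simp: norm_y norm_mult power_mult_distrib)
    also have "\<dots> = (norm (X u))\<^sup>2"
      unfolding u_def X_sum by (rule norm_sum_ortho[OF y, symmetric]) simp
    finally have "\<sigma> n * norm u \<le> norm (X u)" by (rule power2_le_imp_le) simp
    also have "X u = X u - R u" using d(2) by (simp add: u_def)
    also have "norm \<dots> \<le> t * norm u"
      unfolding R(3) by (rule norm_le_onorm[OF bounded_clinear_diff[OF X R(1)]])
    finally show "\<sigma> n \<le> t" using u0 by simp
  qed
  \<comment> \<open>The remainder of \<open>u\<close> is orthogonal to the first \<open>n\<close>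
    singular vectors, so maximality bounds its image by \<open>\<sigma> n * norm u\<close>.\<close>
  have sums: "(\<lambda>n. scaleC (complex_of_real (\<sigma> n) * cinner u (x n)) (y n)) sums X u" for u
    unfolding sums_def
  proof (rule LIM_zero_cancel, rule Lim_null_comparison)
    have "(\<lambda>n. \<sigma> n) \<longlonglongrightarrow> 0"
      by (rule real_tendsto_sandwich[OF _ _ tendsto_const lim]) (auto intro: \<sigma>0 le always_eventually)
    then show "(\<lambda>n. \<sigma> n * norm u) \<longlonglongrightarrow> 0" by (rule tendsto_mult_left_zero)
    show "\<forall>\<^sub>F n in sequentially.
      norm ((\<Sum>k<n. scaleC (complex_of_real (\<sigma> k) * cinner u (x k)) (y k)) - X u) \<le> \<sigma> n * norm u"
    proof (intro always_eventually allI)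
      fix n
      define p where "p = (\<Sum>k<n. scaleC (cinner u (x k)) (x k))"
      have perp_p: "cinner (u - p) (x i) = 0" if "i < n" for i
      proof -
        have "(\<Sum>k<n. cinner u (x k) * cinner (x k) (x i)) = (\<Sum>k<n. if k = i then cinner u (x i) else 0)"
          using perp' by (intro sum.cong) (auto simp: cinner_self norm_x)
        also have "\<dots> = cinner u (x i)" using that by simp
        finally show ?thesis by (simp add: p_def cinner_diff_left cinner_sum_left cinner_scaleC_left)
      qed
      have "cinner (u - p) p = (\<Sum>k<n. cnj (cinner u (x k)) * cinner (u - p) (x k))"
        by (subst (2) p_def) (simp only: cinner_sum_right cinner_scaleC_right)
      also have "\<dots> = 0" using perp_p by simp
      finally have "inner (u - p) p = 0" by (simp only: inner_eq_Re_cinner) simp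
      then have "(norm ((u - p) + p))\<^sup>2 = (norm (u - p))\<^sup>2 + (norm p)\<^sup>2"
        by (intro norm_add_Pythagorean) (simp add: orthogonal_def)
      then have "(norm (u - p))\<^sup>2 \<le> (norm u)\<^sup>2" by simp
      then have np: "norm (u - p) \<le> norm u" by (rule power2_le_imp_le) simp
      have "norm (X (u - p)) \<le> \<sigma> n * norm (u - p)" by (rule max[OF perp_p])
      also have "\<dots> \<le> \<sigma> n * norm u" by (rule mult_left_mono[OF np \<sigma>0])
      finally have "norm (X p - X u) \<le> \<sigma> n * norm u" by (simp add: lin(5) norm_minus_commute)
      then show "norm ((\<Sum>k<n. scaleC (complex_of_real (\<sigma> k) * cinner u (x k)) (y k)) - X u) \<le> \<sigma> n * norm u"
        by (simp add: p_def X_sum mult.commute)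
    qed
  qed
  show ?thesis
  proof (intro exI conjI allI)
    show "ortho_family x" "ortho_family y" "0 \<le> \<sigma> n" "\<sigma> n \<le> singular_number X n" for n
      by (fact x y \<sigma>0 le)+
    show "decseq \<sigma>" using dec by (auto simp: decseq_def)
    show "X = diagop (\<lambda>n. complex_of_real (\<sigma> n)) x y"
      unfolding diagop_def using sums_unique[OF sums] by (intro ext) simp
  qed
qed

section \<open>Diagonal operators in the ideal\<close>

lemma rank_one_schatten:
  assumes T: "bounded_clinear T" and range: "\<And>u. T u \<in> complex_vector.span {w}"
  shows "T \<in> schatten p"
proof -
  have "singular_number T n = 0" if "n \<notin> {0}" for n
  proof -
    have "rank_le T n" unfolding rank_le_def
      using range that by (intro exI[of _ "{w}"]) auto
    from singular_number_le[OF T T this] singular_number_nonneg[OF T, of n]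
    show ?thesis by (simp add: onorm_zero)
  qed
  \<comment> \<open>In the library \<open>0 powr x\<close> is 0 for every \<open>x\<close>, so this
    also holds for \<open>p = \<infinity>\<close>, where the exponent is 0.\<close>
  then have "summable (\<lambda>n. singular_number T n powr enn2real p)"
    by (intro summable_finite[of "{0}"]) auto
  then show ?thesis using T by (simp add: schatten_def)
qed

lemma rank_one_bounded_clinear: "bounded_clinear (\<lambda>u. scaleC (cinner u v) w)"
proof (rule bounded_clinearI)
  show "norm (scaleC (cinner u v) w) \<le> norm u * (norm v * norm w)" for u
    using mult_right_mono[OF cmod_cinner_le[of u v] norm_ge_zero[of w]] by (simp add: norm_scaleC)
qed (simp_all add: cinner_add_left scaleC_add_left cinner_scaleC_left scaleC_scaleC)

lemma rank_one_in_schatten: "(\<lambda>u. scaleC (cinner u v) w) \<in> schatten p"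
  by (rule rank_one_schatten[where w = w, OF rank_one_bounded_clinear])
    (intro complex_vector.span_scale complex_vector.span_base insertI1)

lemma diagop_schatten:
  assumes x: "ortho_family x" and y: "ortho_family y" and a: "decseq a" "\<And>n. 0 \<le> a n"
    and p: "p = \<infinity> \<or> summable (\<lambda>n. a n powr enn2real p)"
  shows "diagop (\<lambda>n. complex_of_real (a n)) x y \<in> schatten p"
proof -
  have norm_of_real_le: "cmod (complex_of_real (a k)) \<le> a n" if "n \<le> k" for k n
    using decseqD[OF a(1) that] a(2)[of k] by simp
  let ?T = "diagop (\<lambda>n. complex_of_real (a n)) x y"
  have T: "bounded_clinear ?T" by (rule bounded_clinear_diagop[OF x y norm_of_real_le[of 0]]) simp
  have le: "singular_number ?T n \<le> a n" for n
    by (rule singular_number_diagop_le[OF x y norm_of_real_le[of 0] norm_of_real_le a(2)]) simp_all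
  have "summable (\<lambda>n. singular_number ?T n powr enn2real p)" if "p \<noteq> \<infinity>"
  proof (rule summable_comparison_test)
    show "summable (\<lambda>n. a n powr enn2real p)" using p that by blast
    show "\<exists>N. \<forall>n\<ge>N. norm (singular_number ?T n powr enn2real p) \<le> a n powr enn2real p"
      using powr_mono2[OF enn2real_nonneg singular_number_nonneg[OF T] le] by simp
  qed
  then show ?thesis using T by (simp add: schatten_def)
qed

text \<open>The values are the powers of 2; injectivity makes the vectors
  \<open>reflection e k (e 0)\<close> orthonormal.\<close>

lemma inj_flip_bit_zero: "inj (\<lambda>k. flip_bit k (0::nat))"
proof (rule injI)
  fix j k :: nat assume "flip_bit j (0::nat) = flip_bit k 0"
  then have "bit (flip_bit j (0::nat)) j = bit (flip_bit k (0::nat)) j" by simp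
  then show "j = k" by (simp add: bit_simps)
qed

lemma sharp_cases: "(2 \<le> p \<and> sharp p = p) \<or> (p < 2 \<and> sharp p = 2)"
  by (cases "2 \<le> p") (auto simp: sharp_def max_def not_le)

context
  fixes e :: "nat \<Rightarrow> 'h::complex_hilbert_space" and a :: "nat \<Rightarrow> real"
  assumes e: "onbasis e" and a: "decseq a" "\<And>n. 0 \<le> a n"
begin

lemma norm_of_real_le: "cmod (complex_of_real (a k)) \<le> a 0"
  using decseqD[OF a(1), of 0 k] a(2)[of k] by simp

text \<open>Riesz-Fischer. The vector defines the rank one operators that serve for
  \<open>p < 2\<close>.\<close>

lemma ell2_vector:
  assumes "summable (\<lambda>n. a n powr 2)"
  obtains w where "\<And>k. cinner w (e k) = complex_of_real (a k)"
proof -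
  have "summable (\<lambda>n. (cmod (complex_of_real (a n)))\<^sup>2)"
    using assms a(2) by (simp add: powr_numeral)
  note sums = summable_sums[OF ortho_summable(1)[OF onbasis_ortho_family'[OF e] this]]
  have "cinner (\<Sum>n. scaleC (complex_of_real (a n)) (e n)) (e k) = complex_of_real (a k)" for k
  proof -
    have "(\<lambda>n. complex_of_real (a n) * cinner (e n) (e k)) sums
        cinner (\<Sum>n. scaleC (complex_of_real (a n)) (e n)) (e k)"
      using bounded_linear.sums[OF bounded_linear_cinner_left sums, of "e k"]
      by (simp only: cinner_scaleC_left)
    moreover have "(\<lambda>n. complex_of_real (a n) * cinner (e n) (e k)) sums complex_of_real (a k)"
      using sums_finite[of "{k}" "\<lambda>n. complex_of_real (a n) * cinner (e n) (e k)"]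
      by (simp add: onbasis_cinner[OF e])
    ultimately show ?thesis by (rule sums_unique2)
  qed
  then show ?thesis by (rule that)
qed

text \<open>A rank one operator lies in every Schatten class, so square summability of
  \<open>a\<close> suffices for all \<open>p < 2\<close>; this is the origin of
  \<open>sharp\<close>.\<close>

lemma left_factor_exists:
  assumes p: "sharp p = \<infinity> \<or> summable (\<lambda>n. a n powr enn2real (sharp p))"
  shows "\<exists>T d. T \<in> schatten p \<and>
    (\<forall>k u. cinner (T (if d then reflection e k u else u)) (e k) = complex_of_real (a k) * cinner u (e 0))"
  using sharp_cases[of p]
proof (elim disjE conjE)
  assume "sharp p = p"
  with p have p': "p = \<infinity> \<or> summable (\<lambda>n. a n powr enn2real p)" by simp
  let ?T = "diagop (\<lambda>n. complex_of_real (a n)) (\<lambda>k. e (flip_bit k 0)) e"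
  note fam = onbasis_ortho_family[OF e inj_flip_bit_zero] onbasis_ortho_family'[OF e]
  have "?T \<in> schatten p" by (rule diagop_schatten[OF fam a p'])
  moreover have "cinner (?T (reflection e k u)) (e k) = complex_of_real (a k) * cinner u (e 0)" for k u
    by (simp only: cinner_diagop[OF fam norm_of_real_le] cinner_reflection[OF e] flip_bit_flip_bit onbasis_cinner[OF e]
        if_True mult_1_right refl)
  ultimately show ?thesis by (intro exI[of _ ?T] exI[of _ True]) simp
next
  assume "sharp p = 2"
  with p have "summable (\<lambda>n. a n powr 2)" by auto
  from ell2_vector[OF this] obtain w where w: "\<And>k. cinner w (e k) = complex_of_real (a k)" by blast
  have "(\<lambda>u. scaleC (cinner u (e 0)) w) \<in> schatten p" by (rule rank_one_in_schatten)
  then show ?thesis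
    by (intro exI[of _ "\<lambda>u. scaleC (cinner u (e 0)) w"] exI[of _ False]) (simp add: cinner_scaleC_left w)
qed

lemma right_factor_exists:
  assumes p: "sharp p = \<infinity> \<or> summable (\<lambda>n. a n powr enn2real (sharp p))"
  shows "\<exists>T d. T \<in> schatten p \<and>
    (\<forall>k. T (e k) = scaleC (complex_of_real (a k)) (if d then reflection e k (e 0) else e 0))"
  using sharp_cases[of p]
proof (elim disjE conjE)
  assume "sharp p = p"
  with p have p': "p = \<infinity> \<or> summable (\<lambda>n. a n powr enn2real p)" by simp
  let ?T = "diagop (\<lambda>n. complex_of_real (a n)) e (\<lambda>k. e (flip_bit k 0))"
  note fam = onbasis_ortho_family'[OF e] onbasis_ortho_family[OF e inj_flip_bit_zero]
  have "?T \<in> schatten p" by (rule diagop_schatten[OF fam a p'])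
  moreover have "?T (e k) = scaleC (complex_of_real (a k)) (reflection e k (e 0))" for k
    by (simp only: diagop_apply[OF fam norm_of_real_le] reflection_basis[OF e] onbasis_cinner[OF e] if_True mult_1_right refl)
  ultimately show ?thesis by (intro exI[of _ ?T] exI[of _ True]) simp
next
  assume "sharp p = 2"
  with p have "summable (\<lambda>n. a n powr 2)" by auto
  from ell2_vector[OF this] obtain w where w: "\<And>k. cinner w (e k) = complex_of_real (a k)" by blast
  have "cinner (e k) w = complex_of_real (a k)" for k
    using w[of k] cinner_commute[of "e k" w] by simp
  moreover have "(\<lambda>u. scaleC (cinner u w) (e 0)) \<in> schatten p" by (rule rank_one_in_schatten)
  ultimately show ?thesis
    by (intro exI[of _ "\<lambda>u. scaleC (cinner u w) (e 0)"] exI[of _ False]) simp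
qed

end

lemma schatten_bounded: "T \<in> schatten p \<Longrightarrow> bounded_clinear T"
  by (auto simp: schatten_def split: if_splits)

text \<open>The size of \<open>'x\<close> enters here: the reals are equipollent to the sets of
  naturals, and an inverse of the injection pulls the membership bits back to
  \<open>'x\<close>.\<close>

lemma surj_bits_exists:
  assumes "\<exists>f :: real \<Rightarrow> 'x. inj f"
  shows "\<exists>bits :: 'x \<Rightarrow> nat \<Rightarrow> bool. surj bits"
proof -
  obtain f :: "real \<Rightarrow> 'x" where f: "inj f" using assms by blast
  obtain g :: "real \<Rightarrow> nat set" where g: "bij_betw g UNIV UNIV"
    using nat_sets_eqpoll_reals eqpoll_sym eqpoll_def by blast
  have "surj (\<lambda>x n. n \<in> g (inv f x))"
    unfolding surj_def
  proof
    fix b :: "nat \<Rightarrow> bool"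
    obtain t where t: "g t = Collect b" using g unfolding bij_betw_def surj_def by metis
    then have "b = (\<lambda>n. n \<in> g (inv f (f t)))" using inv_f_f[OF f, of t] by simp
    then show "\<exists>x. b = (\<lambda>n. n \<in> g (inv f x))" by blast
  qed
  then show ?thesis by blast
qed

lemma diagonal_in_ideal:
  fixes S :: "('h::complex_hilbert_space \<Rightarrow> 'h) set" and bits :: "'x \<Rightarrow> nat \<Rightarrow> bool"
  assumes bits: "surj bits" and e: "onbasis e" and m: "3 \<le> m"
    and a: "decseq a" "\<And>n. 0 \<le> a n" "sharp (p 1) = \<infinity> \<or> summable (\<lambda>n. a n powr enn2real (sharp (p 1)))"
    and b: "decseq b" "\<And>n. 0 \<le> b n"
      "sharp (p (m - 1)) = \<infinity> \<or> summable (\<lambda>n. b n powr enn2real (sharp (p (m - 1))))"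
    and S: "\<And>(M :: nat \<Rightarrow> 'x measure) (E :: nat \<Rightarrow> 'x set \<Rightarrow> 'h \<Rightarrow> 'h) \<Psi> T R.
           (\<forall>i\<in>{1..m}. spectral_measure (M i) (E i)) \<Longrightarrow>
           \<Psi> \<in> haagerup_tensor m M E \<Longrightarrow>
           (\<forall>j\<in>{1..m - 1}. T j \<in> schatten (p j)) \<Longrightarrow>
           has_multiple_operator_integral m M E \<Psi> T R \<Longrightarrow>
           R \<in> S"
  shows "diagop (\<lambda>n. complex_of_real (a n * b n)) e e \<in> S"
proof -
  obtain T1 d1 where T1: "T1 \<in> schatten (p 1)"
    "\<And>k u. cinner (T1 (if d1 then reflection e k u else u)) (e k) = complex_of_real (a k) * cinner u (e 0)"
    using left_factor_exists[OF e a] by blast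
  obtain T2 d2 where T2: "T2 \<in> schatten (p (m - 1))"
    "\<And>k. T2 (e k) = scaleC (complex_of_real (b k)) (if d2 then reflection e k (e 0) else e 0)"
    using right_factor_exists[OF e b] by blast
  \<comment> \<open>The indices 1 and \<open>m - 1\<close> differ because \<open>3 \<le> m\<close>,
    so the two outer operators can be prescribed independently.\<close>
  define T where "T i = (if i = 1 then T1 else if i = m - 1 then T2
    else (\<lambda>u. scaleC (cinner u (e 0)) (e 0)))" for i
  have T_simps: "T 1 = T1" "T (m - 1) = T2" using m by (auto simp: T_def)
  have T_sch: "T j \<in> schatten (p j)" for j
    using T1(1) T2(1) rank_one_in_schatten[of "e 0" "e 0"] by (auto simp: T_def)
  have bounded: "cmod (complex_of_real (a k) * complex_of_real (b k)) \<le> a 0 * b 0" for k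
    using mult_mono[OF decseqD[OF a(1), of 0 k] decseqD[OF b(1), of 0 k] a(2) b(2)] a(2)[of k] b(2)[of k]
    by (simp add: norm_mult)
  have "\<exists>M E \<Psi>. (\<forall>i\<in>{1..m}. spectral_measure (M i :: 'x measure) (E i)) \<and>
    \<Psi> \<in> haagerup_tensor m M E \<and>
    has_multiple_operator_integral m M E \<Psi> T
      (diagop (\<lambda>k. complex_of_real (a k) * complex_of_real (b k)) e e)"
  proof (rule diagonal_multiple_operator_integral[OF bits e m _ _ _ _ _ bounded])
    show "T i 0 = 0" for i by (rule bounded_clinearD(3)[OF schatten_bounded[OF T_sch]])
    show "T (m - 1) (scaleC c u) = scaleC c (T (m - 1) u)" for c u
      by (rule bounded_clinearD(2)[OF schatten_bounded[OF T_sch]])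
    show "cinner (T 1 (if d1 then reflection e k u else u)) (e k) = complex_of_real (a k) * cinner u (e 0)"
      for k u unfolding T_simps by (rule T1(2))
    show "T i u = scaleC (cinner u (e 0)) (e 0)" if "2 \<le> i" "i \<le> m - 2" for i u
      using that m by (auto simp: T_def)
    show "T (m - 1) (e k) = scaleC (complex_of_real (b k)) (if d2 then reflection e k (e 0) else e 0)" for k
      unfolding T_simps by (rule T2(2))
  qed
  then obtain M :: "nat \<Rightarrow> 'x measure" and E \<Psi> where *:
    "\<forall>i\<in>{1..m}. spectral_measure (M i) (E i)" "\<Psi> \<in> haagerup_tensor m M E"
    "has_multiple_operator_integral m M E \<Psi> T
      (diagop (\<lambda>k. complex_of_real (a k) * complex_of_real (b k)) e e)"
    by blast
  have "diagop (\<lambda>k. complex_of_real (a k) * complex_of_real (b k)) e e \<in> S"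
    by (rule S[OF *(1,2) _ *(3)]) (simp add: T_sch)
  then show ?thesis by simp
qed

text \<open>The outer factors are contractions between the given families and the basis; the ideal
  property thus reduces arbitrary families to the basis.\<close>

lemma diagop_eq_compose:
  assumes e: "onbasis e" and x: "ortho_family x" and y: "ortho_family y" and c: "\<And>n. cmod (c n) \<le> C"
  shows "diagop c x y = diagop (\<lambda>_. 1) e y \<circ> diagop c e e \<circ> diagop (\<lambda>_. 1) x e"
proof
  fix u
  note fam = onbasis_ortho_family'[OF e]
  have one: "cmod ((\<lambda>_. 1) n) \<le> 1" for n :: nat by simp
  have 1: "diagop c e e (diagop (\<lambda>_. 1) x e u) = diagop c x e u"
    unfolding diagop_def[of c]
    by (simp only: cinner_diagop[OF x fam one] onbasis_cinner[OF e]) simp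
  show "diagop c x y u = (diagop (\<lambda>_. 1) e y \<circ> diagop c e e \<circ> diagop (\<lambda>_. 1) x e) u"
    unfolding o_apply 1 unfolding diagop_def[of c x y] diagop_def[of "\<lambda>_. 1" e y]
    by (simp only: cinner_diagop[OF x fam c] onbasis_cinner[OF e]) simp
qed

text \<open>With \<open>1 / \<infinity> = 0\<close>; the library value \<open>enn2real \<infinity>\<close> is \<open>0\<close>.\<close>

definition reciprocal :: "ennreal \<Rightarrow> real" where
  "reciprocal s = (if s = \<infinity> then 0 else 1 / enn2real s)"

lemma reciprocal_nonneg: "0 \<le> reciprocal s"
  by (simp add: reciprocal_def)

lemma one_divide_eq_reciprocal:
  assumes "0 < s"
  shows "1 / s = ennreal (reciprocal s)"
proof (cases s)
  case (real t)
  with assms have "0 < t" by (simp add: ennreal_less_zero_iff)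
  then show ?thesis using real divide_ennreal[of 1 t] by (simp add: reciprocal_def)
next
  case top
  then show ?thesis by (simp add: reciprocal_def)
qed

lemma sharp_ge: "2 \<le> sharp p"
  by (simp add: sharp_def)

theorem theorem4p1:
  fixes m :: nat
    and p :: "nat \<Rightarrow> ennreal"
    and r :: ennreal
    and S :: "('h::complex_hilbert_space \<Rightarrow> 'h) set"
    and q :: "('h \<Rightarrow> 'h) \<Rightarrow> real"
  assumes separable: "\<exists>D :: 'h set. countable D \<and> closure D = UNIV"
    and infinite_dimensional: "\<not> (\<exists>B :: 'h set. finite B \<and> complex_vector.span B = UNIV)"
    and "3 \<le> m"
    and "\<forall>j\<in>{1..m - 1}. 0 < p j"
    and "1 / r = 1 / sharp (p 1) + 1 / sharp (p (m - 1))"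
    and "symmetrically_quasinormed_ideal S q"
    and "\<exists>f :: real \<Rightarrow> 'x. inj f"
    and "\<And>(M :: nat \<Rightarrow> 'x measure) (E :: nat \<Rightarrow> 'x set \<Rightarrow> 'h \<Rightarrow> 'h) \<Psi> T R.
           (\<forall>i\<in>{1..m}. spectral_measure (M i) (E i)) \<Longrightarrow>
           \<Psi> \<in> haagerup_tensor m M E \<Longrightarrow>
           (\<forall>j\<in>{1..m - 1}. T j \<in> schatten (p j)) \<Longrightarrow>
           has_multiple_operator_integral m M E \<Psi> T R \<Longrightarrow>
           R \<in> S"
  shows "schatten r \<subseteq> S"
proof (rule subsetI)
  fix X :: "'h \<Rightarrow> 'h" assume X: "X \<in> schatten r"
  then have Xb: "bounded_clinear X" by (rule schatten_bounded)
  obtain e :: "nat \<Rightarrow> 'h" where e: "onbasis e"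
    using onbasis_exists[OF separable infinite_dimensional] by blast
  obtain bits :: "'x \<Rightarrow> nat \<Rightarrow> bool" where bits: "surj bits"
    using surj_bits_exists[OF assms(7)] by blast
  note diagonal = diagonal_in_ideal[OF bits e assms(3) _ _ _ _ _ _ assms(8)]
  note two_sided = symmetrically_quasinormed_ideal.two_sided[OF assms(6)]
  let ?s = "sharp (p 1)" and ?t = "sharp (p (m - 1))"
  have pos: "0 < ?s" "0 < ?t" using sharp_ge by (auto intro: less_le_trans[of 0 2])
  show "X \<in> S"
  proof (cases "r = \<infinity>")
    \<comment> \<open>Both sharp exponents are then infinite, and constant sequences
      \<open>a\<close> and \<open>b\<close> put the identity, hence every bounded operator, into
      \<open>S\<close>.\<close>
    case True
    then have "1 / ?s = 0" "1 / ?t = 0" using assms(5) by (simp_all add: ennreal_top_divide)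
    then have inf: "?s = \<infinity>" "?t = \<infinity>" by simp_all
    have "diagop (\<lambda>n. complex_of_real (1 * 1)) e e \<in> S"
      by (rule diagonal) (use inf in \<open>auto simp: decseq_def\<close>)
    moreover have "diagop (\<lambda>n. complex_of_real (1 * 1)) e e = (\<lambda>u. u)"
      by (rule ext) (simp add: onbasis_diagop_1[OF e])
    ultimately have "X \<circ> (\<lambda>u. u) \<circ> (\<lambda>u. u) \<in> S"
      by (intro two_sided Xb bounded_clinear_id) simp
    then show ?thesis by (simp add: o_def)
  next
    case False
    have fin: "1 / ?s + 1 / ?t = ennreal (reciprocal ?s + reciprocal ?t)"
      by (simp only: one_divide_eq_reciprocal[OF pos(1)] one_divide_eq_reciprocal[OF pos(2)]
          ennreal_plus[OF reciprocal_nonneg reciprocal_nonneg])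
    \<comment> \<open>In \<open>ennreal\<close>, \<open>1 / 0\<close> is \<open>top\<close>, whereas
      the sum of the two reciprocals is finite because both sharp exponents are positive.\<close>
    have "0 < r"
    proof (rule ccontr)
      assume "\<not> 0 < r"
      then have "1 / r = top" by (simp add: ennreal_divide_zero)
      then show False using assms(5) unfolding fin by simp
    qed
    define R where "R = enn2real r"
    have R: "0 < R" using \<open>0 < r\<close> False by (simp add: R_def enn2real_positive_iff top.not_eq_extremum)
    have "ennreal (reciprocal r) = ennreal (reciprocal ?s + reciprocal ?t)"
      using assms(5) by (simp only: one_divide_eq_reciprocal[OF \<open>0 < r\<close>] fin)
    then have recip: "reciprocal ?s + reciprocal ?t = reciprocal r"
      by (subst (asm) ennreal_inj) (simp_all add: reciprocal_nonneg)
    \<comment> \<open>These are the exponents of the two factors into which \<open>\<sigma>\<close>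
      is split.\<close>
    then have sum1: "R * reciprocal ?s + R * reciprocal ?t = 1"
      unfolding distrib_left[symmetric] recip using R False by (simp add: reciprocal_def R_def)
    have Xsum: "summable (\<lambda>n. singular_number X n powr R)"
      using X False by (simp add: schatten_def R_def)
    have "(\<lambda>n. (singular_number X n powr R) powr (1 / R)) \<longlonglongrightarrow> 0"
      using R by (intro tendsto_zero_powrI[OF summable_LIMSEQ_zero[OF Xsum] tendsto_const]) auto
    then have lim: "singular_number X \<longlonglongrightarrow> 0"
      using R singular_number_nonneg[OF Xb] by (simp add: powr_powr)
    obtain \<sigma> x y where "ortho_family x \<and> ortho_family y \<and> decseq \<sigma> \<and>
      (\<forall>n. 0 \<le> \<sigma> n \<and> \<sigma> n \<le> singular_number X n) \<and> X = diagop (\<lambda>n. complex_of_real (\<sigma> n)) x y"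
      using singular_value_decomposition[OF infinite_dimensional Xb lim] by blast
    then have x: "ortho_family x" and y: "ortho_family y" and \<sigma>: "decseq \<sigma>"
      "\<And>n. 0 \<le> \<sigma> n" "\<And>n. \<sigma> n \<le> singular_number X n" and X_eq: "X = diagop (\<lambda>n. complex_of_real (\<sigma> n)) x y"
      by blast+
    have \<sigma>sum: "summable (\<lambda>n. \<sigma> n powr R)"
      by (rule summable_comparison_test[OF _ Xsum]) (use \<sigma> R in \<open>auto intro!: powr_mono2\<close>)
    \<comment> \<open>For \<open>s = \<infinity>\<close> the exponent is 0, and as
      \<open>0 powr 0 = 0\<close> the sequence is the indicator of
      \<open>\<sigma> n \<noteq> 0\<close>; it is still decreasing, and the product of the two
      factors is still \<open>\<sigma>\<close>.\<close>
    have dec: "decseq (\<lambda>n. \<sigma> n powr (R * reciprocal s))" for s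
      using \<sigma>(1,2) R unfolding decseq_def
      by (auto intro!: powr_mono2 mult_nonneg_nonneg reciprocal_nonneg)
    have sum: "s = \<infinity> \<or> summable (\<lambda>n. (\<sigma> n powr (R * reciprocal s)) powr enn2real s)" if "0 < s" for s
    proof (cases "s = \<infinity>")
      case False
      then have "0 < enn2real s" using that by (simp add: enn2real_positive_iff top.not_eq_extremum)
      then show ?thesis using \<sigma>sum False by (simp add: powr_powr reciprocal_def)
    qed simp
    have "diagop (\<lambda>n. complex_of_real (\<sigma> n powr (R * reciprocal ?s) * \<sigma> n powr (R * reciprocal ?t))) e e \<in> S"
      by (rule diagonal[OF dec _ sum[OF pos(1)] dec _ sum[OF pos(2)]]) simp_all
    also have "(\<lambda>n. \<sigma> n powr (R * reciprocal ?s) * \<sigma> n powr (R * reciprocal ?t)) = \<sigma>"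
      unfolding powr_add[symmetric] sum1 using \<sigma>(2) by simp
    finally have D: "diagop (\<lambda>n. complex_of_real (\<sigma> n)) e e \<in> S" .
    have \<sigma>le: "cmod (complex_of_real (\<sigma> n)) \<le> \<sigma> 0" for n
      using decseqD[OF \<sigma>(1), of 0 n] \<sigma>(2)[of n] by simp
    note fam = onbasis_ortho_family'[OF e]
    have one: "cmod ((\<lambda>_. 1) n) \<le> 1" for n :: nat by simp
    show ?thesis
      unfolding X_eq diagop_eq_compose[OF e x y \<sigma>le]
      by (intro two_sided D bounded_clinear_diagop[OF fam y one] bounded_clinear_diagop[OF x fam one])
  qed
qed

end
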